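(* Let $S^2$ be the two-dimensional Euclidean sphere. There is no non-Riemannian Finsler metric $F\colon TS^2\to\mathbb{R}$ such that $(S^2,F)$ is a locally conformally Berwald manifold. In particular, there is no non-Riemannian Finsler metric $F$ on $S^2$ such that $(S^2,F)$ is locally conformally flat.
   Context: A Finsler metric on a smooth manifold $M$ is a continuous function $F\colon TM\to\mathbb{R}$ such that: $F$ is smooth on the complement of the zero section; $F(tv)=tF(v)$ for all $t>0$ and $v\in TM$; and, with $E=\frac12F^2$ and $y^1,\dots,y^n$ the induced fibre coordinates on $TM$, the Hessian $g_{ij}=\frac{\partial^2E}{\partial y^i\partial y^j}$ is positive definite at every nonzero tangent vector. $F$ is called Riemannian if there is a Riemannian metric $\gamma$ on $M$ with $F(v)^2=\gamma(v,v)$ for all $v\in TM$, and non-Riemannian otherwise. A linear connection $\nabla$ on $M$ is compatible with $F$ if the parallel transports with respect to $\nabla$ preserve the Finslerian length $F(v)$ of tangent vectors. $(M,F)$ is a Berwald manifold if it admits a torsion-free compatible linear connection, and a locally Minkowski manifold if it admits a torsion-free compatible linear connection with identically zero curvature. Let $\pi\colon TM\to M$ be the canonical projection. Two Finsler metrics $F,\tilde F$ on the same manifold $U$ are conformally equivalent if $\tilde F=e^{\alpha\circ\pi}F$ for some smooth function $\alpha\colon U\to\mathbb{R}$. $(M,F)$ is locally conformally Berwald (respectively locally conformally flat) if every point of $M$ has an open neighbourhood $U$ on which the restriction of $F$ is conformally equivalent to a Finsler metric $\tilde F$ such that $(U,\tilde F)$ is a Berwald manifold (respectively a locally Minkowski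 manifold). *)

theory Defs
  imports "HOL-Analysis.Analysis"
begin

text \<open>
  Manifolds are smoothly embedded submanifolds M of a Euclidean space, given as
  sets: below, M is meant to be the unit sphere or a relatively open subset of it.
  Functions, fields and metrics on M are total functions on the ambient type
  whose values off M (or off the tangent bundle of M) are irrelevant.
\<close>

subsection \<open>Smooth maps\<close>

primrec C_k_on :: "nat \<Rightarrow> 'a::real_normed_vector set \<Rightarrow> ('a \<Rightarrow> 'b::real_normed_vector) \<Rightarrow> bool" where
  "C_k_on 0 S f \<longleftrightarrow> continuous_on S f"
| "C_k_on (Suc k) S f \<longleftrightarrow> (\<forall>x\<in>S. f differentiable (at x)) \<and>
     (\<forall>v. C_k_on k S (\<lambda>x. frechet_derivative f (at x) v))"

text \<open>
  \<^term>\<open>C_k_on\<close> is used for open sets only. A function on an arbitrary set A is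
  smooth if it extends locally to smooth functions on open sets of the ambient space.
\<close>

definition smooth_on :: "'a::real_normed_vector set \<Rightarrow> ('a \<Rightarrow> 'b::real_normed_vector) \<Rightarrow> bool" where
  "smooth_on A f \<longleftrightarrow> (\<forall>x\<in>A. \<exists>W g. open W \<and> x \<in> W \<and> (\<forall>k. C_k_on k W g) \<and> (\<forall>y\<in>W \<inter> A. g y = f y))"

subsection \<open>Tangent vectors and vector fields\<close>

definition tangent_space :: "'a::euclidean_space set \<Rightarrow> 'a \<Rightarrow> 'a set" where
  "tangent_space M p = {v. \<exists>c e. e > 0 \<and> smooth_on {-e<..<e} c \<and> c ` {-e<..<e} \<subseteq> M \<and>
     c (0::real) = p \<and> (c has_vector_derivative v) (at 0)}"

definition tangent_bundle :: "'a::euclidean_space set \<Rightarrow> ('a \<times> 'a) set" where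
  "tangent_bundle M = Sigma M (tangent_space M)"

definition vector_fields :: "'a::euclidean_space set \<Rightarrow> ('a \<Rightarrow> 'a) set" where
  "vector_fields M = {X. smooth_on M X \<and> (\<forall>p\<in>M. X p \<in> tangent_space M p)}"

text \<open>
  For f smooth on M, derivatives of f within M exist; they may differ in directions
  normal to M, but on tangent vectors they all agree with the derivative of f along curves in M.
\<close>

definition deriv_along :: "'a::euclidean_space set \<Rightarrow> ('a \<Rightarrow> 'b::euclidean_space) \<Rightarrow> ('a \<Rightarrow> 'a) \<Rightarrow> 'a \<Rightarrow> 'b" where
  "deriv_along M f X p = frechet_derivative f (at p within M) (X p)"

text \<open>
  The components of the Lie bracket in the ambient coordinates x_k
  are X(Y(x_k)) - Y(X(x_k)).
\<close>

definition lie_bracket :: "'a::euclidean_space set \<Rightarrow> ('a \<Rightarrow> 'a) \<Rightarrow> ('a \<Rightarrow> 'a) \<Rightarrow> 'a \<Rightarrow> 'a" where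
  "lie_bracket M X Y p = deriv_along M Y X p - deriv_along M X Y p"

subsection \<open>Finsler and Riemannian metrics\<close>

text \<open>
  For a basis B of the tangent space at p, this is the second partial derivative at y
  of E = F^2/2 in the fibre coordinates belonging to the basis vectors u and w.
\<close>

definition fundamental_tensor :: "('a::euclidean_space \<times> 'a \<Rightarrow> real) \<Rightarrow> 'a \<Rightarrow> 'a \<Rightarrow> 'a \<Rightarrow> 'a \<Rightarrow> real" where
  "fundamental_tensor F p y u w =
     deriv (\<lambda>s. deriv (\<lambda>t. (F (p, y + s *\<^sub>R u + t *\<^sub>R w))\<^sup>2 / 2) 0) 0"

definition finsler_metric :: "'a::euclidean_space set \<Rightarrow> ('a \<times> 'a \<Rightarrow> real) \<Rightarrow> bool" where
  "finsler_metric M F \<longleftrightarrow>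
     continuous_on (tangent_bundle M) F \<and>
     smooth_on {(p, v) \<in> tangent_bundle M. v \<noteq> 0} F \<and>
     (\<forall>(p, v) \<in> tangent_bundle M. \<forall>t>0. F (p, t *\<^sub>R v) = t * F (p, v)) \<and>
     (\<forall>(p, y) \<in> tangent_bundle M. y \<noteq> 0 \<longrightarrow>
        (\<forall>B. independent B \<and> span B = tangent_space M p \<longrightarrow>
           (\<forall>a. (\<exists>u\<in>B. a u \<noteq> 0) \<longrightarrow>
              (\<Sum>u\<in>B. \<Sum>w\<in>B. a u * a w * fundamental_tensor F p y u w) > 0)))"

definition riemannian_metric :: "'a::euclidean_space set \<Rightarrow> ('a \<Rightarrow> 'a \<Rightarrow> 'a \<Rightarrow> real) \<Rightarrow> bool" where
  "riemannian_metric M \<gamma> \<longleftrightarrow>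
     (\<forall>p\<in>M. \<forall>u\<in>tangent_space M p. \<forall>v\<in>tangent_space M p.
        \<gamma> p u v = \<gamma> p v u \<and> (u \<noteq> 0 \<longrightarrow> \<gamma> p u u > 0) \<and>
        (\<forall>r. \<gamma> p (r *\<^sub>R u) v = r * \<gamma> p u v) \<and>
        (\<forall>w\<in>tangent_space M p. \<gamma> p (u + w) v = \<gamma> p u v + \<gamma> p w v)) \<and>
     (\<forall>X\<in>vector_fields M. \<forall>Y\<in>vector_fields M. smooth_on M (\<lambda>p. \<gamma> p (X p) (Y p)))"

definition riemannian :: "'a::euclidean_space set \<Rightarrow> ('a \<times> 'a \<Rightarrow> real) \<Rightarrow> bool" where
  "riemannian M F \<longleftrightarrow>
     (\<exists>\<gamma>. riemannian_metric M \<gamma> \<and> (\<forall>(p, v) \<in> tangent_bundle M. (F (p, v))\<^sup>2 = \<gamma> p v v))"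

subsection \<open>Linear connections\<close>

text \<open>
  Covariant derivatives. Applying the two rules for products to functions that are 1 on M
  and arbitrary elsewhere shows that nabla X Y on M depends only on the values of
  X and Y on M.
\<close>

definition linear_connection :: "'a::euclidean_space set \<Rightarrow> (('a \<Rightarrow> 'a) \<Rightarrow> ('a \<Rightarrow> 'a) \<Rightarrow> 'a \<Rightarrow> 'a) \<Rightarrow> bool" where
  "linear_connection M nabla \<longleftrightarrow>
     (\<forall>X\<in>vector_fields M. \<forall>Y\<in>vector_fields M. nabla X Y \<in> vector_fields M) \<and>
     (\<forall>X\<in>vector_fields M. \<forall>X'\<in>vector_fields M. \<forall>Y\<in>vector_fields M. \<forall>p\<in>M.
        nabla (\<lambda>q. X q + X' q) Y p = nabla X Y p + nabla X' Y p) \<and>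
     (\<forall>X\<in>vector_fields M. \<forall>Y\<in>vector_fields M. \<forall>Y'\<in>vector_fields M. \<forall>p\<in>M.
        nabla X (\<lambda>q. Y q + Y' q) p = nabla X Y p + nabla X Y' p) \<and>
     (\<forall>X\<in>vector_fields M. \<forall>Y\<in>vector_fields M. \<forall>f. smooth_on M f \<longrightarrow> (\<forall>p\<in>M.
        nabla (\<lambda>q. f q *\<^sub>R X q) Y p = f p *\<^sub>R nabla X Y p \<and>
        nabla X (\<lambda>q. f q *\<^sub>R Y q) p = deriv_along M f X p *\<^sub>R Y p + f p *\<^sub>R nabla X Y p))"

definition torsion_free :: "'a::euclidean_space set \<Rightarrow> (('a \<Rightarrow> 'a) \<Rightarrow> ('a \<Rightarrow> 'a) \<Rightarrow> 'a \<Rightarrow> 'a) \<Rightarrow> bool" where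
  "torsion_free M nabla \<longleftrightarrow>
     (\<forall>X\<in>vector_fields M. \<forall>Y\<in>vector_fields M. \<forall>p\<in>M. nabla X Y p - nabla Y X p = lie_bracket M X Y p)"

definition zero_curvature :: "'a::euclidean_space set \<Rightarrow> (('a \<Rightarrow> 'a) \<Rightarrow> ('a \<Rightarrow> 'a) \<Rightarrow> 'a \<Rightarrow> 'a) \<Rightarrow> bool" where
  "zero_curvature M nabla \<longleftrightarrow>
     (\<forall>X\<in>vector_fields M. \<forall>Y\<in>vector_fields M. \<forall>Z\<in>vector_fields M. \<forall>p\<in>M.
        nabla X (nabla Y Z) p - nabla Y (nabla X Z) p - nabla (lie_bracket M X Y) Z p = 0)"

subsection \<open>Parallel transport\<close>

definition smooth_curve :: "'a::euclidean_space set \<Rightarrow> real \<Rightarrow> real \<Rightarrow> (real \<Rightarrow> 'a) \<Rightarrow> bool" where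
  "smooth_curve M a b c \<longleftrightarrow> a < b \<and> smooth_on {a..b} c \<and> c ` {a..b} \<subseteq> M"

definition fields_along :: "'a::euclidean_space set \<Rightarrow> real \<Rightarrow> real \<Rightarrow> (real \<Rightarrow> 'a) \<Rightarrow> (real \<Rightarrow> 'a) set" where
  "fields_along M a b c = {V. smooth_on {a..b} V \<and> (\<forall>t\<in>{a..b}. V t \<in> tangent_space M (c t))}"

text \<open>
  Along a smooth curve c there is, up to values outside the parameter interval, exactly one
  operator D with the following properties: the covariant derivative along c induced by nabla.
\<close>

definition covariant_derivative_along ::
    "'a::euclidean_space set \<Rightarrow> (('a \<Rightarrow> 'a) \<Rightarrow> ('a \<Rightarrow> 'a) \<Rightarrow> 'a \<Rightarrow> 'a) \<Rightarrow> real \<Rightarrow> real \<Rightarrow> (real \<Rightarrow> 'a)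
      \<Rightarrow> ((real \<Rightarrow> 'a) \<Rightarrow> real \<Rightarrow> 'a) \<Rightarrow> bool" where
  "covariant_derivative_along M nabla a b c D \<longleftrightarrow>
     (\<forall>V\<in>fields_along M a b c. D V \<in> fields_along M a b c) \<and>
     (\<forall>V\<in>fields_along M a b c. \<forall>W\<in>fields_along M a b c. \<forall>t\<in>{a..b}.
        D (\<lambda>s. V s + W s) t = D V t + D W t) \<and>
     (\<forall>V\<in>fields_along M a b c. \<forall>f. smooth_on {a..b} f \<longrightarrow> (\<forall>t\<in>{a..b}.
        D (\<lambda>s. f s *\<^sub>R V s) t = vector_derivative f (at t within {a..b}) *\<^sub>R V t + f t *\<^sub>R D V t)) \<and>
     (\<forall>X\<in>vector_fields M. \<forall>Y\<in>vector_fields M. \<forall>t\<in>{a..b}.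
        X (c t) = vector_derivative c (at t within {a..b}) \<longrightarrow>
        D (\<lambda>s. Y (c s)) t = nabla X Y (c t))"

definition parallel_along ::
    "'a::euclidean_space set \<Rightarrow> (('a \<Rightarrow> 'a) \<Rightarrow> ('a \<Rightarrow> 'a) \<Rightarrow> 'a \<Rightarrow> 'a) \<Rightarrow> real \<Rightarrow> real \<Rightarrow> (real \<Rightarrow> 'a)
      \<Rightarrow> (real \<Rightarrow> 'a) \<Rightarrow> bool" where
  "parallel_along M nabla a b c V \<longleftrightarrow> V \<in> fields_along M a b c \<and>
     (\<exists>D. covariant_derivative_along M nabla a b c D \<and> (\<forall>t\<in>{a..b}. D V t = 0))"

definition compatible ::
    "'a::euclidean_space set \<Rightarrow> ('a \<times> 'a \<Rightarrow> real) \<Rightarrow> (('a \<Rightarrow> 'a) \<Rightarrow> ('a \<Rightarrow> 'a) \<Rightarrow> 'a \<Rightarrow> 'a) \<Rightarrow> bool" where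
  "compatible M F nabla \<longleftrightarrow>
     (\<forall>a b c V. smooth_curve M a b c \<and> parallel_along M nabla a b c V \<longrightarrow> F (c b, V b) = F (c a, V a))"

subsection \<open>Classes of Finsler manifolds\<close>

definition berwald :: "'a::euclidean_space set \<Rightarrow> ('a \<times> 'a \<Rightarrow> real) \<Rightarrow> bool" where
  "berwald M F \<longleftrightarrow> finsler_metric M F \<and>
     (\<exists>nabla. linear_connection M nabla \<and> torsion_free M nabla \<and> compatible M F nabla)"

definition locally_minkowski :: "'a::euclidean_space set \<Rightarrow> ('a \<times> 'a \<Rightarrow> real) \<Rightarrow> bool" where
  "locally_minkowski M F \<longleftrightarrow> finsler_metric M F \<and>
     (\<exists>nabla. linear_connection M nabla \<and> torsion_free M nabla \<and> compatible M F nabla \<and> zero_curvature M nabla)"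

definition conformally_equivalent ::
    "'a::euclidean_space set \<Rightarrow> ('a \<times> 'a \<Rightarrow> real) \<Rightarrow> ('a \<times> 'a \<Rightarrow> real) \<Rightarrow> bool" where
  "conformally_equivalent U F F' \<longleftrightarrow>
     (\<exists>\<alpha>. smooth_on U \<alpha> \<and> (\<forall>(p, v) \<in> tangent_bundle U. F' (p, v) = exp (\<alpha> p) * F (p, v)))"

definition locally_conformally_berwald :: "'a::euclidean_space set \<Rightarrow> ('a \<times> 'a \<Rightarrow> real) \<Rightarrow> bool" where
  "locally_conformally_berwald M F \<longleftrightarrow>
     (\<forall>p\<in>M. \<exists>U. openin (top_of_set M) U \<and> p \<in> U \<and>
        (\<exists>F'. finsler_metric U F' \<and> conformally_equivalent U F F' \<and> berwald U F'))"

definition locally_conformally_flat :: "'a::euclidean_space set \<Rightarrow> ('a \<times> 'a \<Rightarrow> real) \<Rightarrow> bool" where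
  "locally_conformally_flat M F \<longleftrightarrow>
     (\<forall>p\<in>M. \<exists>U. openin (top_of_set M) U \<and> p \<in> U \<and>
        (\<exists>F'. finsler_metric U F' \<and> conformally_equivalent U F F' \<and> locally_minkowski U F'))"

subsection \<open>The tangent spaces of the sphere\<close>

lemma C_k_on_circular:
  "C_k_on n S (\<lambda>t::real. cos (k * t) *\<^sub>R a + sin (k * t) *\<^sub>R (b::'a::real_normed_vector))"
proof (induction n arbitrary: a b)
  case 0
  show ?case by (auto intro!: continuous_intros)
next
  case (Suc n)
  have d: "((\<lambda>t::real. cos (k * t) *\<^sub>R a + sin (k * t) *\<^sub>R b) has_derivative
      (\<lambda>h. h *\<^sub>R (k *\<^sub>R (cos (k * x) *\<^sub>R b - sin (k * x) *\<^sub>R a)))) (at x)"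
    for x and a b :: 'a
    by (auto intro!: derivative_eq_intros simp: algebra_simps)
  have e: "frechet_derivative (\<lambda>t::real. cos (k * t) *\<^sub>R a + sin (k * t) *\<^sub>R b) (at x) v =
      cos (k * x) *\<^sub>R ((v * k) *\<^sub>R b) + sin (k * x) *\<^sub>R ((- v * k) *\<^sub>R a)" for x v and a b :: 'a
    by (subst frechet_derivative_at[OF d, symmetric]) (simp add: algebra_simps)
  show ?case
    unfolding C_k_on.simps e using d Suc.IH unfolding differentiable_def by blast
qed

lemma tangent_space_sphere:
  fixes p :: "'a::euclidean_space"
  assumes U: "openin (top_of_set (sphere 0 1)) U" and p: "p \<in> U"
  shows "tangent_space U p = {v. p \<bullet> v = 0}"
proof (intro equalityI subsetI)
  have Us: "U \<subseteq> sphere 0 1" using U by (simp add: openin_imp_subset)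
  fix v assume "v \<in> tangent_space U p"
  then obtain c e where e: "e > 0" and c: "c ` {-e<..<e} \<subseteq> U" "c (0::real) = p"
      "(c has_vector_derivative v) (at 0)"
    unfolding tangent_space_def by blast
  have "((\<lambda>t. c t \<bullet> c t) has_vector_derivative (p \<bullet> v + v \<bullet> p)) (at 0)"
    using bounded_bilinear.has_vector_derivative[OF bounded_bilinear_inner c(3) c(3)] c(2) by simp
  moreover have "((\<lambda>t. c t \<bullet> c t) has_vector_derivative 0) (at 0)"
  proof (rule has_vector_derivative_transform_within_open[where S = "{-e<..<e}" and f = "\<lambda>t. 1"])
    fix t assume "t \<in> {-e<..<e}"
    then have "c t \<in> sphere 0 1" using c(1) Us by blast
    then show "1 = c t \<bullet> c t" by (simp add: dot_square_norm)
  qed (use e in auto)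
  ultimately have "p \<bullet> v + v \<bullet> p = 0" by (rule vector_derivative_unique_at)
  then show "v \<in> {v. p \<bullet> v = 0}" by (simp add: inner_commute)
next
  fix v assume "v \<in> {v. p \<bullet> v = 0}"
  then have v: "p \<bullet> v = 0" by simp
  have Us: "U \<subseteq> sphere 0 1" using U by (simp add: openin_imp_subset)
  have np: "p \<bullet> p = 1" using Us p by (auto simp: dot_square_norm)
  define k where "k = norm v"
  define w where "w = v /\<^sub>R k"
  have kw: "k *\<^sub>R w = v" unfolding w_def k_def by (cases "v = 0") simp_all
  have pw: "p \<bullet> w = 0" unfolding w_def using v by simp
  define c where "c = (\<lambda>t::real. cos (k * t) *\<^sub>R p + sin (k * t) *\<^sub>R w)"
  have d: "(c has_vector_derivative v) (at 0)"
    unfolding c_def has_vector_derivative_def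
    by (auto intro!: derivative_eq_intros simp: mult.commute simp flip: kw)
  have cs: "c t \<in> sphere 0 1" for t
  proof (cases "k = 0")
    case True
    then show ?thesis using np by (simp add: c_def norm_eq_1)
  next
    case False
    have "w \<bullet> w = 1" using False unfolding w_def k_def by (simp add: dot_square_norm power2_eq_square field_simps)
    then have "c t \<bullet> c t = 1"
      using pw np by (simp add: c_def inner_add_left inner_add_right inner_commute
          flip: power2_eq_square)
    then show ?thesis by (simp add: norm_eq_1)
  qed
  obtain T where T: "open T" "U = sphere 0 1 \<inter> T" using U by (auto simp: openin_open)
  have "continuous_on UNIV c" unfolding c_def by (intro continuous_intros)
  then have "open (c -` T)" using T(1) by (simp add: open_vimage)
  moreover have "0 \<in> c -` T" using p T by (simp add: c_def)
  ultimately obtain e where e: "e > 0" "ball 0 e \<subseteq> c -` T" by (meson openE)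
  have "c ` {-e<..<e} \<subseteq> U"
    using e(2) cs T(2) by (force simp: ball_def dist_norm)
  moreover have "smooth_on {-e<..<e} c"
    unfolding smooth_on_def c_def using C_k_on_circular by blast
  moreover have "c 0 = p" by (simp add: c_def)
  ultimately show "v \<in> tangent_space U p"
    unfolding tangent_space_def using e(1) d by blast
qed

end

theory Submission
  imports Defs
begin

text \<open>
  Let \<open>N\<close> be the Finsler norm on a tangent plane. There is a linear complex coordinate \<open>z\<close> on the plane, unique
  up to a factor and up to conjugation, whose second moment with respect to the weight \<open>max 0 (1 - N)\<close> vanishes.
  The vanishing of a mixed moment of \<open>z\<^sup>a (cnj z)\<^sup>b\<close> is then invariant under linear isomorphisms and
  rescalings of \<open>N\<close>; if all of them with \<open>b < a\<close> vanish, the weight is rotationally symmetric in \<open>z\<close> and \<open>N\<close> is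
  Euclidean. Parallel transports of local Berwald metrics in the conformal class are linear isomorphisms
  preserving \<open>N\<close> up to a factor, so a mixed moment that vanishes at one point of the sphere vanishes everywhere.
  A nowhere vanishing one would be a nonvanishing section of the \<open>(a - b)\<close>-th power of the tangent bundle,
  which does not exist: on the 3-sphere, the double cover of the unit tangent bundle, it would have a logarithm.
  Hence all mixed moments vanish and \<open>F\<close> is Riemannian.
\<close>

subsection \<open>Calculus of smooth maps\<close>

text \<open>The weight \<open>max 0 (1 - N)\<close> stands in for the indicator of the unit ball
  because it is continuous with compact support: every moment is the integral of a continuous
  function over a box, and moments depend continuously on \<open>N\<close>. Only the vanishing of a
  mixed moment is transported, never its value, so the ambiguity of the coordinate does no harm and
  holonomy does not enter: short arcs of a great circle joining two given points suffice. For the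
  topological half, however, the coordinate must depend continuously on the frame; hence it is given
  by an explicit formula. This formula is equivariant under rotations, so on the 3-sphere the mixed
  moment has weight \<open>2 * (a - b)\<close> under multiplication by phases, the factor 2 being
  due to the double cover. Along one phase circle a logarithm would have to grow by 2 pi i times
  this weight and yet return to its initial value.\<close>

lemma C_k_on_cong:
  assumes "open S" "\<And>x. x \<in> S \<Longrightarrow> f x = g x"
  shows "C_k_on k S f \<longleftrightarrow> C_k_on k S g"
  using assms(2)
proof (induction k arbitrary: f g)
  case 0
  then show ?case by (simp cong: continuous_on_cong)
next
  case (Suc k)
  have hd: "(f has_derivative D) (at x) \<longleftrightarrow> (g has_derivative D) (at x)" if "x \<in> S" for x D
    using has_derivative_transform_within_open[OF _ assms(1) that, of _ D UNIV] Suc.prems by metis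
  then have df: "f differentiable (at x) \<longleftrightarrow> g differentiable (at x)" if "x \<in> S" for x
    using that unfolding differentiable_def by blast
  have "frechet_derivative f (at x) = frechet_derivative g (at x)" if "x \<in> S" for x
    unfolding frechet_derivative_def using hd[OF that] by simp
  then have "C_k_on k S (\<lambda>x. frechet_derivative f (at x) v) \<longleftrightarrow> C_k_on k S (\<lambda>x. frechet_derivative g (at x) v)" for v
    by (intro Suc.IH) auto
  then show ?case using df by simp
qed

text \<open>Derivatives at points of an open set are unique, so an explicit \<open>D\<close> may
  stand in for the one chosen by \<open>frechet_derivative\<close>.\<close>

lemma C_k_on_SucI:
  assumes "open S" "\<And>x. x \<in> S \<Longrightarrow> (f has_derivative D x) (at x)"
    and "\<And>v. C_k_on k S (\<lambda>x. D x v)"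
  shows "C_k_on (Suc k) S f"
proof -
  have "C_k_on k S (\<lambda>x. frechet_derivative f (at x) v)" for v
    using C_k_on_cong[OF assms(1), of "\<lambda>x. frechet_derivative f (at x) v" "\<lambda>x. D x v"]
      assms(2,3) frechet_derivative_at by metis
  then show ?thesis using assms(2) by (auto simp: differentiable_def)
qed

lemma C_k_on_Suc_imp: "C_k_on (Suc k) S f \<Longrightarrow> C_k_on k S f"
proof (induction k arbitrary: f)
  case 0
  then show ?case
    by (simp add: continuous_at_imp_continuous_on differentiable_imp_continuous_within)
next
  case (Suc k)
  then show ?case by simp
qed

lemma C_k_on_subset: "C_k_on k S f \<Longrightarrow> T \<subseteq> S \<Longrightarrow> C_k_on k T f"
  by (induction k arbitrary: f) (auto intro: continuous_on_subset)

lemma C_k_on_has_derivative: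
  "C_k_on (Suc k) S f \<Longrightarrow> x \<in> S \<Longrightarrow> (f has_derivative frechet_derivative f (at x)) (at x)"
  by (simp add: frechet_derivative_works)

lemma C_k_on_add:
  assumes "open S" "C_k_on k S f" "C_k_on k S g"
  shows "C_k_on k S (\<lambda>x. f x + g x)"
  using assms(2,3)
proof (induction k arbitrary: f g)
  case 0
  then show ?case by (auto intro: continuous_intros)
next
  case (Suc k)
  show ?case
    by (rule C_k_on_SucI[OF assms(1) has_derivative_add[OF C_k_on_has_derivative[OF Suc.prems(1)]
        C_k_on_has_derivative[OF Suc.prems(2)]]]) (use Suc in auto)
qed

lemma C_k_on_const: "open S \<Longrightarrow> C_k_on k S (\<lambda>x. c)"
proof (induction k arbitrary: c)
  case (Suc k)
  then show ?case by (intro C_k_on_SucI[where D = "\<lambda>x v. 0"]) auto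
qed simp

lemma C_k_on_bounded_linear:
  assumes "open S" "bounded_linear h" "C_k_on k S f"
  shows "C_k_on k S (\<lambda>x. h (f x))"
  using assms(3)
proof (induction k arbitrary: f)
  case 0
  then show ?case by (simp add: bounded_linear.continuous_on[OF assms(2)])
next
  case (Suc k)
  show ?case
    by (rule C_k_on_SucI[OF assms(1) bounded_linear.has_derivative[OF assms(2)
        C_k_on_has_derivative[OF Suc.prems]]]) (use Suc in auto)
qed

lemma C_k_on_ident: "open S \<Longrightarrow> C_k_on k S (\<lambda>x. x)"
proof (induction k)
  case (Suc k)
  then show ?case by (intro C_k_on_SucI[where D = "\<lambda>x v. v"] C_k_on_const) auto
qed simp

lemma C_k_on_bounded_bilinear:
  assumes "open S" "bounded_bilinear h" "C_k_on k S f" "C_k_on k S g"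
  shows "C_k_on k S (\<lambda>x. h (f x) (g x))"
  using assms(3,4)
proof (induction k arbitrary: f g)
  case 0
  then show ?case by (simp add: bounded_bilinear.continuous_on[OF assms(2)])
next
  case (Suc k)
  show ?case
  proof (rule C_k_on_SucI[OF assms(1) bounded_bilinear.FDERIV[OF assms(2)
        C_k_on_has_derivative[OF Suc.prems(1)] C_k_on_has_derivative[OF Suc.prems(2)]]])
    fix v
    have "C_k_on k S f" "C_k_on k S g" using Suc.prems C_k_on_Suc_imp by blast+
    then show "C_k_on k S (\<lambda>x. h (f x) (frechet_derivative g (at x) v) + h (frechet_derivative f (at x) v) (g x))"
      using Suc by (intro C_k_on_add assms) auto
  qed
qed

lemma C_k_on_sum:
  assumes "open S" "\<And>i. i \<in> A \<Longrightarrow> C_k_on k S (f i)"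
  shows "C_k_on k S (\<lambda>x. \<Sum>i\<in>A. f i x)"
  using assms(2)
proof (induction A rule: infinite_finite_induct)
  case (insert x F)
  then show ?case by (auto intro: C_k_on_add assms(1))
qed (auto intro: C_k_on_const assms(1))

lemma C_k_on_compose:
  fixes f :: "'a::real_normed_vector \<Rightarrow> 'b::euclidean_space" and g :: "'b \<Rightarrow> 'c::real_normed_vector"
  assumes "open S" "open T" "f ` S \<subseteq> T" "C_k_on k S f" "C_k_on k T g"
  shows "C_k_on k S (\<lambda>x. g (f x))"
  using assms(4,5)
proof (induction k arbitrary: g)
  case 0
  then show ?case using continuous_on_compose2 assms(3) by auto
next
  case (Suc k)
  let ?f = "\<lambda>x. frechet_derivative f (at x)" and ?g = "\<lambda>y. frechet_derivative g (at y)"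
  have d: "((\<lambda>x. g (f x)) has_derivative (\<lambda>v. ?g (f x) (?f x v))) (at x)" if "x \<in> S" for x
  proof -
    have "f x \<in> T" using that assms(3) by blast
    then show ?thesis
      using diff_chain_at[OF C_k_on_has_derivative[OF Suc.prems(1) that] C_k_on_has_derivative[OF Suc.prems(2)]]
      by (simp add: o_def)
  qed
  \<comment> \<open>The linear map and its argument both vary with \<open>x\<close>. Expanded over
    \<open>Basis\<close>, the derivative becomes a sum of scalars times derivatives of
    \<open>g\<close> in fixed directions composed with \<open>f\<close>, which the induction
    hypothesis covers.\<close>
  have e: "?g (f x) (?f x v) = (\<Sum>b\<in>Basis. (?f x v \<bullet> b) *\<^sub>R ?g (f x) b)" if "x \<in> S" for x v
  proof -
    have "f x \<in> T" using that assms(3) by blast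
    then have "linear (?g (f x))"
      using C_k_on_has_derivative[OF Suc.prems(2)] has_derivative_linear by blast
    then have "?g (f x) (\<Sum>b\<in>Basis. (?f x v \<bullet> b) *\<^sub>R b) = (\<Sum>b\<in>Basis. (?f x v \<bullet> b) *\<^sub>R ?g (f x) b)"
      by (simp add: linear_sum linear_cmul)
    then show ?thesis by (simp add: euclidean_representation)
  qed
  have "C_k_on k S (\<lambda>x. \<Sum>b\<in>Basis. (?f x v \<bullet> b) *\<^sub>R ?g (f x) b)" for v
    using Suc C_k_on_Suc_imp[OF Suc.prems(1)]
    by (intro C_k_on_sum[OF assms(1)] C_k_on_bounded_bilinear[OF assms(1) bounded_bilinear_scaleR]
        C_k_on_bounded_linear[OF assms(1) bounded_linear_inner_left] Suc.IH) auto
  then have "C_k_on k S (\<lambda>x. ?g (f x) (?f x v))" for v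
    using C_k_on_cong[OF assms(1), of "\<lambda>x. ?g (f x) (?f x v)"] e by simp
  with d show ?case by (intro C_k_on_SucI[OF assms(1), where D = "\<lambda>x v. ?g (f x) (?f x v)"]) auto
qed

lemma smooth_onI:
  assumes "open W" "A \<subseteq> W" "\<And>k. C_k_on k W f"
  shows "smooth_on A f"
  unfolding smooth_on_def using assms by blast

lemma smooth_onE:
  assumes "smooth_on A f" "x \<in> A"
  obtains W g where "open W" "x \<in> W" "\<And>k. C_k_on k W g" "\<And>y. y \<in> W \<inter> A \<Longrightarrow> g y = f y"
  using assms unfolding smooth_on_def by metis

lemma smooth_on_cong: "(\<And>x. x \<in> A \<Longrightarrow> f x = g x) \<Longrightarrow> smooth_on A f \<longleftrightarrow> smooth_on A g"
  unfolding smooth_on_def by simp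

lemma smooth_on_subset:
  assumes "smooth_on A f" "B \<subseteq> A"
  shows "smooth_on B f"
  unfolding smooth_on_def
proof
  fix x assume "x \<in> B"
  then have "x \<in> A" using assms(2) by blast
  then obtain W g where "open W" "x \<in> W" "\<And>k. C_k_on k W g" "\<And>y. y \<in> W \<inter> A \<Longrightarrow> g y = f y"
    by (rule smooth_onE[OF assms(1)]) (rule that)
  then show "\<exists>W g. open W \<and> x \<in> W \<and> (\<forall>k. C_k_on k W g) \<and> (\<forall>y\<in>W \<inter> B. g y = f y)"
    using assms(2) by blast
qed

lemma smooth_on_bounded_bilinear:
  assumes h: "bounded_bilinear h" and "smooth_on A f" "smooth_on A g"
  shows "smooth_on A (\<lambda>x. h (f x) (g x))"
  unfolding smooth_on_def
proof
  fix x assume x: "x \<in> A"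
  obtain W f' where f': "open W" "x \<in> W" "\<And>k. C_k_on k W f'" "\<And>y. y \<in> W \<inter> A \<Longrightarrow> f' y = f y"
    by (rule smooth_onE[OF assms(2) x]) (rule that)
  obtain W' g' where g': "open W'" "x \<in> W'" "\<And>k. C_k_on k W' g'" "\<And>y. y \<in> W' \<inter> A \<Longrightarrow> g' y = g y"
    by (rule smooth_onE[OF assms(3) x]) (rule that)
  have o: "open (W \<inter> W')" using f' g' by blast
  have "C_k_on k (W \<inter> W') (\<lambda>x. h (f' x) (g' x))" for k
    by (rule C_k_on_bounded_bilinear[OF o h C_k_on_subset[OF f'(3)] C_k_on_subset[OF g'(3)]]) auto
  then show "\<exists>W k. open W \<and> x \<in> W \<and> (\<forall>n. C_k_on n W k) \<and> (\<forall>y\<in>W \<inter> A. k y = h (f y) (g y))"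
    using o f'(2,4) g'(2,4) by (intro exI[of _ "W \<inter> W'"] exI[of _ "\<lambda>x. h (f' x) (g' x)"]) force
qed

lemma smooth_on_compose:
  fixes f :: "'a::real_normed_vector \<Rightarrow> 'b::euclidean_space" and g :: "'b \<Rightarrow> 'c::real_normed_vector"
  assumes "smooth_on A f" "smooth_on B g" "f ` A \<subseteq> B"
  shows "smooth_on A (\<lambda>x. g (f x))"
  unfolding smooth_on_def
proof
  fix x assume x: "x \<in> A"
  obtain W f' where f': "open W" "x \<in> W" "\<And>k. C_k_on k W f'" "\<And>y. y \<in> W \<inter> A \<Longrightarrow> f' y = f y"
    by (rule smooth_onE[OF assms(1) x]) (rule that)
  have "f x \<in> B" using x assms(3) by blast
  then obtain W' g' where g': "open W'" "f x \<in> W'" "\<And>k. C_k_on k W' g'" "\<And>y. y \<in> W' \<inter> B \<Longrightarrow> g' y = g y"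
    by (rule smooth_onE[OF assms(2)]) (rule that)
  have "continuous_on W f'" using f'(3)[of 0] by simp
  then have o: "open (W \<inter> f' -` W')" using f'(1) g'(1) by (simp add: continuous_on_open_vimage Int_commute)
  show "\<exists>W h. open W \<and> x \<in> W \<and> (\<forall>k. C_k_on k W h) \<and> (\<forall>y\<in>W \<inter> A. h y = g (f y))"
  proof (intro exI conjI ballI allI)
    show "open (W \<inter> f' -` W')" by (fact o)
    show "x \<in> W \<inter> f' -` W'" using f' g' x by auto
    show "C_k_on k (W \<inter> f' -` W') (\<lambda>x. g' (f' x))" for k
      by (rule C_k_on_compose[OF o g'(1) _ C_k_on_subset[OF f'(3)] g'(3)]) auto
    show "g' (f' y) = g (f y)" if "y \<in> W \<inter> f' -` W' \<inter> A" for y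
      using that f'(4)[of y] g'(4)[of "f y"] assms(3) by auto
  qed
qed

lemma smooth_on_const: "smooth_on A (\<lambda>x. c)"
  by (rule smooth_onI[of UNIV]) (auto intro: C_k_on_const)

lemma smooth_on_ident: "smooth_on A (\<lambda>x. x)"
  by (rule smooth_onI[of UNIV]) (auto intro: C_k_on_ident)

lemma smooth_on_add:
  assumes "smooth_on A f" "smooth_on A g"
  shows "smooth_on A (\<lambda>x. f x + g x)"
  unfolding smooth_on_def
proof
  fix x assume x: "x \<in> A"
  obtain W f' where f': "open W" "x \<in> W" "\<And>k. C_k_on k W f'" "\<And>y. y \<in> W \<inter> A \<Longrightarrow> f' y = f y"
    by (rule smooth_onE[OF assms(1) x]) (rule that)
  obtain W' g' where g': "open W'" "x \<in> W'" "\<And>k. C_k_on k W' g'" "\<And>y. y \<in> W' \<inter> A \<Longrightarrow> g' y = g y"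
    by (rule smooth_onE[OF assms(2) x]) (rule that)
  have o: "open (W \<inter> W')" using f' g' by blast
  have "C_k_on k (W \<inter> W') (\<lambda>x. f' x + g' x)" for k
    by (rule C_k_on_add[OF o C_k_on_subset[OF f'(3)] C_k_on_subset[OF g'(3)]]) auto
  then show "\<exists>W h. open W \<and> x \<in> W \<and> (\<forall>k. C_k_on k W h) \<and> (\<forall>y\<in>W \<inter> A. h y = f y + g y)"
    using o f'(2,4) g'(2,4) by (intro exI[of _ "W \<inter> W'"] exI[of _ "\<lambda>x. f' x + g' x"]) force
qed

lemma smooth_on_bounded_linear:
  assumes h: "bounded_linear h" and "smooth_on A f"
  shows "smooth_on A (\<lambda>x. h (f x))"
  unfolding smooth_on_def
proof
  fix x assume "x \<in> A"
  then obtain W f' where f': "open W" "x \<in> W" "\<And>k. C_k_on k W f'" "\<And>y. y \<in> W \<inter> A \<Longrightarrow> f' y = f y"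
    by (rule smooth_onE[OF assms(2)]) (rule that)
  have "C_k_on k W (\<lambda>x. h (f' x))" for k
    by (rule C_k_on_bounded_linear[OF f'(1) h f'(3)])
  then show "\<exists>W g. open W \<and> x \<in> W \<and> (\<forall>k. C_k_on k W g) \<and> (\<forall>y\<in>W \<inter> A. g y = h (f y))"
    using f'(1,2,4) by (intro exI[of _ W] exI[of _ "\<lambda>x. h (f' x)"]) force
qed

lemmas smooth_on_scaleR = smooth_on_bounded_bilinear[OF bounded_bilinear_scaleR]
lemmas smooth_on_mult = smooth_on_bounded_bilinear[OF bounded_bilinear_mult]
lemmas smooth_on_inner = smooth_on_bounded_bilinear[OF bounded_bilinear_inner]
lemmas smooth_on_minus = smooth_on_bounded_linear[OF bounded_linear_minus[OF bounded_linear_ident]]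

lemma smooth_on_diff: "smooth_on A f \<Longrightarrow> smooth_on A g \<Longrightarrow> smooth_on A (\<lambda>x. f x - g x)"
  using smooth_on_add[of A f "\<lambda>x. - g x"] smooth_on_minus[of A g] by simp

lemma smooth_on_sum: "(\<And>i. i \<in> I \<Longrightarrow> smooth_on A (f i)) \<Longrightarrow> smooth_on A (\<lambda>x. \<Sum>i\<in>I. f i x)"
  by (induction I rule: infinite_finite_induct) (auto intro: smooth_on_const smooth_on_add)

lemma smooth_on_Pair:
  "smooth_on A f \<Longrightarrow> smooth_on A g \<Longrightarrow> smooth_on A (\<lambda>x. (f x, g x))"
  using smooth_on_add[OF smooth_on_bounded_linear[of "\<lambda>y. (y, 0)" A f] smooth_on_bounded_linear[of "\<lambda>y. (0, y)" A g]]
  by (simp add: bounded_linear_Pair bounded_linear_zero bounded_linear_ident)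

lemmas smooth_intros = smooth_on_const smooth_on_ident smooth_on_add smooth_on_diff smooth_on_minus
  smooth_on_scaleR smooth_on_mult smooth_on_inner smooth_on_sum smooth_on_Pair

lemma smooth_on_differentiable:
  assumes "smooth_on A f" "x \<in> A"
  shows "f differentiable (at x within A)"
proof -
  obtain W g where g: "open W" "x \<in> W" "\<And>k. C_k_on k W g" "\<And>y. y \<in> W \<inter> A \<Longrightarrow> g y = f y"
    by (rule smooth_onE[OF assms]) (rule that)
  have "(g has_derivative frechet_derivative g (at x)) (at x within A)"
    using C_k_on_has_derivative[OF g(3) g(2)] has_derivative_at_withinI by blast
  moreover have "eventually (\<lambda>y. g y = f y) (at x within A)"
    unfolding eventually_at_topological using g(1,2,4) by (intro exI[of _ W]) auto
  ultimately have "(f has_derivative frechet_derivative g (at x)) (at x within A)"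
    using g(2) g(4)[of x] assms(2) by (auto intro: has_derivative_transform_eventually[of g _ x A])
  then show ?thesis unfolding differentiable_def by blast
qed

lemma smooth_on_continuous: "smooth_on A f \<Longrightarrow> continuous_on A f"
  by (simp add: continuous_on_eq_continuous_within differentiable_imp_continuous_within smooth_on_differentiable)

text \<open>At an end point the derivative is one-sided, but it is that of any local extension
  \<open>g\<close>, since derivatives within a nondegenerate interval are unique. Hence the
  derivative of \<open>g\<close> extends that of \<open>f\<close>.\<close>

lemma smooth_on_vector_derivative:
  fixes f :: "real \<Rightarrow> 'a::real_normed_vector"
  assumes "smooth_on {a..b} f" "a < b"
  shows "smooth_on {a..b} (\<lambda>t. vector_derivative f (at t within {a..b}))"
  unfolding smooth_on_def
proof
  fix x assume "x \<in> {a..b}"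
  then obtain W g where g: "open W" "x \<in> W" "\<And>k. C_k_on k W g" "\<And>y. y \<in> W \<inter> {a..b} \<Longrightarrow> g y = f y"
    by (rule smooth_onE[OF assms(1)]) (rule that)
  have "frechet_derivative g (at t) 1 = vector_derivative f (at t within {a..b})" if t: "t \<in> W \<inter> {a..b}" for t
  proof -
    have "(g has_vector_derivative frechet_derivative g (at t) 1) (at t)"
      using C_k_on_has_derivative[OF g(3), of t] t
      by (metis IntD1 differentiableI frechet_derivative_eq_vector_derivative scaleR_one vector_derivative_works)
    then have "(g has_vector_derivative frechet_derivative g (at t) 1) (at t within {a..b})"
      by (rule has_vector_derivative_at_within)
    moreover have "eventually (\<lambda>y. g y = f y) (at t within {a..b})"
      unfolding eventually_at_topological using g(1,4) t by (intro exI[of _ W]) auto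
    ultimately have "(f has_vector_derivative frechet_derivative g (at t) 1) (at t within {a..b})"
      using g(4)[of t] t unfolding has_vector_derivative_def
      by (auto intro: has_derivative_transform_eventually[of g _ t])
    then show ?thesis
      using vector_derivative_within_cbox assms(2) t by (metis IntD2 cbox_interval)
  qed
  moreover have "C_k_on k W (\<lambda>t. frechet_derivative g (at t) 1)" for k
    using g(3)[of "Suc k"] by simp
  ultimately show "\<exists>W g. open W \<and> x \<in> W \<and> (\<forall>k. C_k_on k W g) \<and>
      (\<forall>y\<in>W \<inter> {a..b}. g y = vector_derivative f (at y within {a..b}))"
    using g by blast
qed

subsection \<open>Linear differential equations\<close>

text \<open>Compactness of \<open>{a..b}\<close> times the unit sphere bounds the operators on unit
  vectors; homogeneity does the rest.\<close>

lemma linear_family_bound: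
  fixes A :: "real \<Rightarrow> 'a::euclidean_space \<Rightarrow> 'a"
  assumes "continuous_on ({a..b} \<times> UNIV) (\<lambda>(t, x). A t x)" and lin: "\<And>t. linear (A t)"
  obtains K where "K > 0" "\<And>t x. t \<in> {a..b} \<Longrightarrow> norm (A t x) \<le> K * norm x"
proof -
  have "continuous_on ({a..b} \<times> sphere 0 1) (\<lambda>(t, x). A t x)"
    using assms(1) by (rule continuous_on_subset) auto
  then have "compact ((\<lambda>(t, x). A t x) ` ({a..b} \<times> sphere 0 1))"
    by (intro compact_continuous_image compact_Times) auto
  then obtain K where K: "K > 0" "\<And>y. y \<in> (\<lambda>(t, x). A t x) ` ({a..b} \<times> sphere 0 1) \<Longrightarrow> norm y \<le> K"
    using compact_imp_bounded bounded_pos by metis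
  have "norm (A t x) \<le> K * norm x" if t: "t \<in> {a..b}" for t x
  proof (cases "x = 0")
    case True
    then show ?thesis using linear_0[OF lin] by simp
  next
    case False
    have "norm (A t (x /\<^sub>R norm x)) \<le> K"
      using False t by (intro K(2) image_eqI[of _ _ "(t, x /\<^sub>R norm x)"]) auto
    then show ?thesis using False by (simp add: linear_cmul[OF lin] field_simps)
  qed
  then show ?thesis using K(1) that by blast
qed

text \<open>Picard iteration. The length \<open>d\<close> depends only on a bound for the operators
  and thus precedes the quantifier over initial values: later one interval serves all tangent
  vectors at a point.\<close>

lemma linear_ode_solution:
  fixes A :: "real \<Rightarrow> 'a::euclidean_space \<Rightarrow> 'a"
  assumes e: "e > 0" and cont: "continuous_on ({t0-e..t0+e} \<times> UNIV) (\<lambda>(t, x). A t x)"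
    and lin: "\<And>t. linear (A t)"
  shows "\<exists>d>0. d \<le> e \<and> (\<forall>x0. \<exists>x. x t0 = x0 \<and>
    (\<forall>t\<in>{t0-d<..<t0+d}. (x has_vector_derivative A t (x t)) (at t)))"
proof -
  obtain K where K: "K > 0" "\<And>t x. t \<in> {t0-e..t0+e} \<Longrightarrow> norm (A t x) \<le> K * norm x"
    using linear_family_bound[OF cont lin] by blast
  \<comment> \<open>With \<open>K * d \<le> 1/2\<close> the Picard operator contracts distances by
    the factor 1/2.\<close>
  define d where "d = min e (1 / (2 * K))"
  have d: "d > 0" "d \<le> e" "K * d \<le> 1/2" using e K(1) by (auto simp: d_def min_def field_simps)
  define I where "I = {t0-d..t0+d}"
  have I: "I \<subseteq> {t0-e..t0+e}" "t0 \<in> I" using d by (auto simp: I_def)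
  define H where "H = (\<lambda>x t. integral {t0-d..t} (\<lambda>s. A s (x s)))"
  have contA: "continuous_on I (\<lambda>s. A s (x s))" if "continuous_on UNIV x" for x
  proof -
    have "continuous_on I (\<lambda>s. (s, x s))"
      using that by (intro continuous_intros) (auto intro: continuous_on_subset)
    then show ?thesis using continuous_on_compose2[OF cont, of I "\<lambda>s. (s, x s)"] I by auto
  qed
  have H: "(H x has_vector_derivative A t (x t)) (at t within I)" if "continuous_on UNIV x" "t \<in> I" for x t
    using integral_has_vector_derivative[OF contA[OF that(1), unfolded I_def] that(2)[unfolded I_def]]
    by (simp add: H_def I_def)
  have cH: "continuous_on I (H x)" if "continuous_on UNIV x" for x
    unfolding continuous_on_eq_continuous_within
    using has_vector_derivative_continuous[OF H[OF that]] by blast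
  \<comment> \<open>Clamping the time to \<open>I\<close> turns the iterates into bounded continuous
    functions on the whole line, which form a complete space.\<close>
  define cl where "cl = (\<lambda>t. max (t0-d) (min (t0+d) t))"
  have cl: "cl t \<in> I" "t \<in> I \<Longrightarrow> cl t = t" for t using d by (auto simp: cl_def I_def)
  have ccl: "continuous_on UNIV cl" unfolding cl_def by (intro continuous_intros)
  have ex: "\<exists>x. x t0 = x0 \<and> (\<forall>t\<in>{t0-d<..<t0+d}. (x has_vector_derivative A t (x t)) (at t))" for x0
  proof -
    \<comment> \<open>\<open>H\<close> integrates from the left end \<open>t0 - d\<close>;
      subtracting its value at \<open>t0\<close> gives the integral from \<open>t0\<close> in both
      directions.\<close>
    define T where "T = (\<lambda>x::real \<Rightarrow>\<^sub>C 'a. Bcontfun (\<lambda>t. x0 + (H (apply_bcontfun x) (cl t) - H (apply_bcontfun x) t0)))"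
    have ca: "continuous_on UNIV (apply_bcontfun x)" for x :: "real \<Rightarrow>\<^sub>C 'a"
      using apply_bcontfun[of x] by (auto simp: bcontfun_def)
    have T: "apply_bcontfun (T x) t = x0 + (H (apply_bcontfun x) (cl t) - H (apply_bcontfun x) t0)" for x t
    proof -
      have c: "continuous_on UNIV (\<lambda>t. H (apply_bcontfun x) (cl t))"
        using continuous_on_compose2[OF cH[OF ca] ccl] cl by auto
      have "compact (H (apply_bcontfun x) ` I)"
        by (intro compact_continuous_image cH ca) (simp add: I_def)
      then have "bounded (range (\<lambda>t. H (apply_bcontfun x) (cl t)))"
        using cl(1) by (intro bounded_subset[OF compact_imp_bounded]) auto
      then have "bounded (range (\<lambda>t. (x0 - H (apply_bcontfun x) t0) + H (apply_bcontfun x) (cl t)))"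
        using bounded_translation[of "range (\<lambda>t. H (apply_bcontfun x) (cl t))" "x0 - H (apply_bcontfun x) t0"]
        by (simp add: image_image)
      then have "(\<lambda>t. x0 + (H (apply_bcontfun x) (cl t) - H (apply_bcontfun x) t0)) \<in> bcontfun"
        using c unfolding bcontfun_def by (auto intro!: continuous_intros simp: algebra_simps)
      then show ?thesis unfolding T_def by (simp add: Bcontfun_inverse)
    qed
    have "dist (T x) (T y) \<le> 1/2 * dist x y" for x y
    proof (rule dist_bound)
      fix t
      define g where "g = (\<lambda>u. H (apply_bcontfun x) u - H (apply_bcontfun y) u)"
      have "norm (g (cl t) - g t0) \<le> (K * dist x y) * norm (cl t - t0)"
      proof (rule differentiable_bound[where S = I])
        show "convex I" by (simp add: I_def)
        fix s assume s: "s \<in> I"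
        show "(g has_derivative (\<lambda>h. h *\<^sub>R (A s (apply_bcontfun x s) - A s (apply_bcontfun y s)))) (at s within I)"
          using has_vector_derivative_diff[OF H[OF ca s] H[OF ca s], of x y]
          by (simp add: g_def has_vector_derivative_def)
        have "norm (A s (apply_bcontfun x s) - A s (apply_bcontfun y s)) \<le> K * norm (apply_bcontfun x s - apply_bcontfun y s)"
          using K(2)[of s "apply_bcontfun x s - apply_bcontfun y s"] s I by (auto simp: linear_diff[OF lin])
        also have "\<dots> \<le> K * dist x y"
          using dist_bounded[of x s y] K(1) by (simp add: dist_norm)
        finally show "onorm (\<lambda>h. h *\<^sub>R (A s (apply_bcontfun x s) - A s (apply_bcontfun y s))) \<le> K * dist x y"
          by (intro onorm_le) (auto simp: mult.commute[of "K * dist x y"] intro: mult_left_mono)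
      qed (use cl I in auto)
      also have "\<dots> \<le> (K * dist x y) * d"
        using cl(1)[of t] K(1) by (intro mult_left_mono) (auto simp: I_def)
      also have "\<dots> \<le> 1/2 * dist x y"
        using mult_right_mono[OF d(3), of "dist x y"] by (simp add: algebra_simps)
      finally show "dist (apply_bcontfun (T x) t) (apply_bcontfun (T y) t) \<le> 1/2 * dist x y"
        by (simp add: T g_def dist_norm algebra_simps)
    qed
    then have "\<exists>!x. T x = x" by (intro banach_fix_type[of "1/2"]) auto
    then obtain x where "T x = x" by blast
    then have x: "apply_bcontfun x t = x0 + (H (apply_bcontfun x) (cl t) - H (apply_bcontfun x) t0)" for t
      using T[of x t] by simp
    have "(apply_bcontfun x has_vector_derivative A t (apply_bcontfun x t)) (at t)" if t: "t \<in> {t0-d<..<t0+d}" for t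
    proof -
      have tI: "t \<in> I" using t by (auto simp: I_def)
      have "((\<lambda>t. x0 + (H (apply_bcontfun x) t - H (apply_bcontfun x) t0)) has_vector_derivative A t (apply_bcontfun x t)) (at t within I)"
        using H[OF ca tI, of x] by (auto intro!: derivative_eq_intros)
      then have "(apply_bcontfun x has_vector_derivative A t (apply_bcontfun x t)) (at t within I)"
        by (rule has_vector_derivative_transform[OF tI, rotated]) (subst x, simp add: cl(2))
      then have "(apply_bcontfun x has_vector_derivative A t (apply_bcontfun x t)) (at t within {t0-d<..<t0+d})"
        by (rule has_vector_derivative_within_subset) (auto simp: I_def)
      then show ?thesis
        by (simp only: has_vector_derivative_within_open[OF t open_greaterThanLessThan])
    qed
    moreover have "apply_bcontfun x t0 = x0" using x[of t0] cl(2)[OF I(2)] by simp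
    ultimately show ?thesis by blast
  qed
  then show ?thesis using d by blast
qed

text \<open>If \<open>x\<close> is of class k, so is the right-hand side \<open>f\<close>, which is
  the derivative of \<open>x\<close>; so \<open>x\<close> gains one order at a time.\<close>

lemma C_k_on_ode_bootstrap:
  fixes x :: "real \<Rightarrow> 'a::euclidean_space"
  assumes "open I" and ode: "\<And>t. t \<in> I \<Longrightarrow> (x has_vector_derivative f t) (at t)"
    and step: "\<And>k. C_k_on k I x \<Longrightarrow> C_k_on k I f"
  shows "C_k_on k I x"
proof (induction k)
  case 0
  show ?case
    using has_vector_derivative_continuous[OF ode] by (simp add: continuous_at_imp_continuous_on)
next
  case (Suc k)
  show ?case
  proof (rule C_k_on_SucI[OF assms(1)])
    show "(x has_derivative (\<lambda>h. h *\<^sub>R f t)) (at t)" if "t \<in> I" for t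
      using ode[OF that] by (simp add: has_vector_derivative_def)
    show "C_k_on k I (\<lambda>t. v *\<^sub>R f t)" for v
      by (rule C_k_on_bounded_linear[OF assms(1) bounded_linear_scaleR_right step[OF Suc]])
  qed
qed

subsection \<open>Parallel transport along great circles\<close>

lemma C_k_on_local:
  assumes "open S" "\<And>x. x \<in> S \<Longrightarrow> \<exists>W. open W \<and> x \<in> W \<and> C_k_on k W f"
  shows "C_k_on k S f"
  using assms(2)
proof (induction k arbitrary: f)
  case 0
  have "isCont f x" if "x \<in> S" for x
  proof -
    obtain W where "open W" "x \<in> W" "continuous_on W f" using "0"[OF \<open>x \<in> S\<close>] by auto
    then show ?thesis by (simp add: continuous_on_eq_continuous_at)
  qed
  then show ?case by (simp add: continuous_at_imp_continuous_on)
next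
  case (Suc k)
  have "f differentiable (at x)" if "x \<in> S" for x
    using Suc.prems[OF that] by auto
  moreover have "C_k_on k S (\<lambda>x. frechet_derivative f (at x) v)" for v
    by (rule Suc.IH) (use Suc.prems in force)
  ultimately show ?case by simp
qed

lemma smooth_on_open_imp:
  assumes "open S" "smooth_on S f"
  shows "C_k_on k S f"
proof (rule C_k_on_local[OF assms(1)])
  fix x assume "x \<in> S"
  then obtain W g where g: "open W" "x \<in> W" "\<And>k. C_k_on k W g" "\<And>y. y \<in> W \<inter> S \<Longrightarrow> g y = f y"
    by (rule smooth_onE[OF assms(2)]) (rule that)
  have o: "open (W \<inter> S)" using assms(1) g(1) by blast
  have "C_k_on k (W \<inter> S) g" by (rule C_k_on_subset[OF g(3)]) blast
  then have "C_k_on k (W \<inter> S) f" using C_k_on_cong[OF o, of g f k] g(4) by blast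
  then show "\<exists>W. open W \<and> x \<in> W \<and> C_k_on k W f" using o g(2) \<open>x \<in> S\<close> by blast
qed

text \<open>\<open>frechet_derivative\<close> within \<open>M\<close> is merely one of the possible
  derivatives, but the chain rule holds for each of them along a curve that stays in
  \<open>M\<close>.\<close>

lemma deriv_along_curve:
  assumes f: "smooth_on M f" and c: "(c has_vector_derivative X (c t)) (at t within T)"
    and "c ` T \<subseteq> M" "t \<in> T"
  shows "((\<lambda>s. f (c s)) has_vector_derivative deriv_along M f X (c t)) (at t within T)"
proof -
  let ?F = "frechet_derivative f (at (c t) within M)"
  have F: "(f has_derivative ?F) (at (c t) within M)"
    using smooth_on_differentiable[OF f, of "c t"] assms(3,4) frechet_derivative_works by blast
  then have "(f has_derivative ?F) (at (c t) within c ` T)"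
    by (rule has_derivative_subset) (use assms in auto)
  from has_derivative_in_compose[OF c[unfolded has_vector_derivative_def] this]
  show ?thesis
    using linear_cmul[OF has_derivative_linear[OF F]]
    by (simp add: has_vector_derivative_def deriv_along_def)
qed

text \<open>The projection of the constant vector \<open>b\<close> to the tangent space at the point
  \<open>q\<close> of the unit sphere. For \<open>b\<close> in \<open>Basis\<close> these fields
  span all tangent spaces globally and replace a local frame.\<close>

definition tangential :: "'a::euclidean_space \<Rightarrow> 'a \<Rightarrow> 'a" where
  "tangential b q = b - (b \<bullet> q) *\<^sub>R q"

text \<open>For orthonormal \<open>p\<close> and \<open>w\<close>, the velocity field of the
  rotations in their plane. The great circle is an integral curve, so its velocity extends to a
  field on the sphere.\<close>

definition rotation_field :: "'a::euclidean_space \<Rightarrow> 'a \<Rightarrow> 'a \<Rightarrow> 'a" where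
  "rotation_field p w q = (p \<bullet> q) *\<^sub>R w - (w \<bullet> q) *\<^sub>R p"

definition great_circle :: "'a::euclidean_space \<Rightarrow> 'a \<Rightarrow> real \<Rightarrow> 'a" where
  "great_circle p w t = cos t *\<^sub>R p + sin t *\<^sub>R w"

lemma smooth_on_great_circle: "smooth_on A (great_circle p w)"
  using C_k_on_circular[of _ UNIV 1 p w]
  by (intro smooth_onI[of UNIV]) (auto simp: great_circle_def[abs_def])

lemma great_circle_derivative:
  assumes "p \<bullet> p = 1" "w \<bullet> w = 1" "p \<bullet> w = 0"
  shows "(great_circle p w has_vector_derivative rotation_field p w (great_circle p w t)) (at t within T)"
  unfolding great_circle_def[abs_def] rotation_field_def has_vector_derivative_def
  using assms by (auto intro!: derivative_eq_intros simp: algebra_simps inner_commute)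

section \<open>Linear connections on open subsets of the sphere\<close>

locale sphere_connection =
  fixes U :: "'a::euclidean_space set" and nabla
  assumes open_U: "openin (top_of_set (sphere 0 1)) U"
    and connection: "linear_connection U nabla"
begin

lemma inner_self: "q \<in> U \<Longrightarrow> q \<bullet> q = 1"
  using openin_imp_subset[OF open_U] by (auto simp: dot_square_norm)

lemma tangent_space_U: "q \<in> U \<Longrightarrow> tangent_space U q = {v. q \<bullet> v = 0}"
  by (rule tangent_space_sphere[OF open_U])

lemma vector_fields_iff: "X \<in> vector_fields U \<longleftrightarrow> smooth_on U X \<and> (\<forall>q\<in>U. q \<bullet> X q = 0)"
  unfolding vector_fields_def using tangent_space_U by auto

lemma vector_fields_smooth: "X \<in> vector_fields U \<Longrightarrow> smooth_on U X"
  by (simp add: vector_fields_iff)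

lemma tangential_vf: "tangential b \<in> vector_fields U"
  unfolding vector_fields_iff tangential_def[abs_def]
  by (auto intro!: smooth_intros simp: inner_diff_right inner_self inner_commute)

lemma rotation_vf: "rotation_field p w \<in> vector_fields U"
  unfolding vector_fields_iff rotation_field_def[abs_def]
  by (auto intro!: smooth_intros simp: inner_diff_right inner_commute)

lemma scale_vf: "smooth_on U f \<Longrightarrow> X \<in> vector_fields U \<Longrightarrow> (\<lambda>q. f q *\<^sub>R X q) \<in> vector_fields U"
  unfolding vector_fields_iff by (auto intro!: smooth_intros)

lemma sum_vf: "(\<And>i. i \<in> I \<Longrightarrow> X i \<in> vector_fields U) \<Longrightarrow> (\<lambda>q. \<Sum>i\<in>I. X i q) \<in> vector_fields U"
  unfolding vector_fields_iff by (auto intro!: smooth_intros simp: inner_sum_right)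

lemma zero_vf: "(\<lambda>q. 0) \<in> vector_fields U"
  unfolding vector_fields_iff by (auto intro!: smooth_intros)

lemma tangential_sum: "(\<Sum>b\<in>Basis. (v \<bullet> b) *\<^sub>R tangential b q) = v - (q \<bullet> v) *\<^sub>R q"
proof -
  have "(\<Sum>b\<in>Basis. (v \<bullet> b) *\<^sub>R tangential b q) = (\<Sum>b\<in>Basis. (v \<bullet> b) *\<^sub>R b) - (\<Sum>b\<in>Basis. (v \<bullet> b) * (q \<bullet> b)) *\<^sub>R q"
    by (simp add: tangential_def scaleR_right_diff_distrib sum_subtractf scaleR_sum_left inner_commute)
  also have "\<dots> = v - (v \<bullet> q) *\<^sub>R q"
    by (simp add: euclidean_representation flip: euclidean_inner)
  finally show ?thesis by (simp add: inner_commute)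
qed

lemma tangential_expansion: "q \<bullet> v = 0 \<Longrightarrow> v = (\<Sum>b\<in>Basis. (v \<bullet> b) *\<^sub>R tangential b q)"
  by (simp add: tangential_sum)

text \<open>A derivative within \<open>U\<close> is determined only on tangent vectors; therefore
  \<open>X q\<close> is realised by a curve in \<open>U\<close>, along which \<open>f\<close> is
  constant.\<close>

lemma deriv_along_eq_0:
  fixes f :: "'a \<Rightarrow> real"
  assumes X: "X \<in> vector_fields U" and q: "q \<in> U" and f: "\<And>q. q \<in> U \<Longrightarrow> f q = k"
  shows "deriv_along U f X q = 0"
proof -
  have "X q \<in> tangent_space U q" using X q by (simp add: vector_fields_def)
  then obtain c e where c: "e > 0" "c ` {-e<..<e} \<subseteq> U" "c (0::real) = q" "(c has_vector_derivative X q) (at 0)"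
    unfolding tangent_space_def by blast
  have sf: "smooth_on U f" using f by (subst smooth_on_cong[of U f "\<lambda>_. k"]) (auto intro: smooth_on_const)
  have "(c has_vector_derivative X (c 0)) (at 0 within {-e<..<e})"
    using c by (simp add: has_vector_derivative_at_within)
  then have "((\<lambda>s. f (c s)) has_vector_derivative deriv_along U f X (c 0)) (at 0 within {-e<..<e})"
    using c by (intro deriv_along_curve[OF sf]) auto
  moreover have "((\<lambda>s. f (c s)) has_vector_derivative 0) (at 0 within {-e<..<e})"
    by (rule has_vector_derivative_transform[where f = "\<lambda>s. k"]) (use c f in \<open>auto simp: image_subset_iff\<close>)
  moreover have "0 \<in> {-e<..<e}" using c by simp
  ultimately show ?thesis
    using vector_derivative_unique_at c(3) by (metis has_vector_derivative_within_open open_greaterThanLessThan)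
qed

lemma nabla_vf: "X \<in> vector_fields U \<Longrightarrow> Y \<in> vector_fields U \<Longrightarrow> nabla X Y \<in> vector_fields U"
  using connection unfolding linear_connection_def by blast

lemma nabla_add_left: "X \<in> vector_fields U \<Longrightarrow> X' \<in> vector_fields U \<Longrightarrow> Y \<in> vector_fields U \<Longrightarrow> q \<in> U \<Longrightarrow>
    nabla (\<lambda>q. X q + X' q) Y q = nabla X Y q + nabla X' Y q"
  using connection unfolding linear_connection_def by blast

lemma nabla_add_right: "X \<in> vector_fields U \<Longrightarrow> Y \<in> vector_fields U \<Longrightarrow> Y' \<in> vector_fields U \<Longrightarrow> q \<in> U \<Longrightarrow>
    nabla X (\<lambda>q. Y q + Y' q) q = nabla X Y q + nabla X Y' q"
  using connection unfolding linear_connection_def by blast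

lemma nabla_scale_left: "X \<in> vector_fields U \<Longrightarrow> Y \<in> vector_fields U \<Longrightarrow> smooth_on U f \<Longrightarrow> q \<in> U \<Longrightarrow>
    nabla (\<lambda>q. f q *\<^sub>R X q) Y q = f q *\<^sub>R nabla X Y q"
  using connection unfolding linear_connection_def by blast

lemma nabla_scale_right: "X \<in> vector_fields U \<Longrightarrow> Y \<in> vector_fields U \<Longrightarrow> smooth_on U f \<Longrightarrow> q \<in> U \<Longrightarrow>
    nabla X (\<lambda>q. f q *\<^sub>R Y q) q = deriv_along U f X q *\<^sub>R Y q + f q *\<^sub>R nabla X Y q"
  using connection unfolding linear_connection_def by blast

text \<open>Multiplication by the function that is 1 on \<open>U\<close> and 0 elsewhere makes
  \<open>Y\<close> and \<open>Y'\<close> equal as total functions, while by the product rules it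
  leaves \<open>nabla\<close> unchanged at points of \<open>U\<close>.\<close>

lemma
  assumes "X \<in> vector_fields U" "Y \<in> vector_fields U" "Y' \<in> vector_fields U" "q \<in> U"
    and eq: "\<And>q. q \<in> U \<Longrightarrow> Y q = Y' q"
  shows nabla_cong_right: "nabla X Y q = nabla X Y' q"
    and nabla_cong_left: "nabla Y X q = nabla Y' X q"
proof -
  define f :: "'a \<Rightarrow> real" where "f = (\<lambda>q. if q \<in> U then 1 else 0)"
  have f: "smooth_on U f"
    by (subst smooth_on_cong[of U f "\<lambda>_. 1"]) (auto intro: smooth_on_const simp: f_def)
  have d: "deriv_along U f X q = 0" by (rule deriv_along_eq_0) (auto simp: f_def assms)
  have fq: "f q = 1" using assms by (simp add: f_def)
  have e: "(\<lambda>q. f q *\<^sub>R Y q) = (\<lambda>q. f q *\<^sub>R Y' q)" using eq by (auto simp: f_def)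
  show "nabla X Y q = nabla X Y' q"
    using nabla_scale_right[OF assms(1,2) f assms(4)] nabla_scale_right[OF assms(1,3) f assms(4)]
    by (simp add: d fq e)
  show "nabla Y X q = nabla Y' X q"
    using nabla_scale_left[OF assms(2,1) f assms(4)] nabla_scale_left[OF assms(3,1) f assms(4)]
    by (simp add: fq e)
qed

lemma nabla_sum_right:
  assumes "X \<in> vector_fields U" "q \<in> U" "\<And>i. i \<in> I \<Longrightarrow> Y i \<in> vector_fields U"
  shows "nabla X (\<lambda>q. \<Sum>i\<in>I. Y i q) q = (\<Sum>i\<in>I. nabla X (Y i) q)"
proof -
  have 0: "nabla X (\<lambda>q. 0) q = 0"
    using nabla_scale_right[OF assms(1) zero_vf smooth_on_const[of _ 0] assms(2)] by simp
  show ?thesis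
    using assms(3)
    by (induction I rule: infinite_finite_induct) (auto simp: 0 nabla_add_right assms sum_vf)
qed

lemma nabla_sum_left:
  assumes "X \<in> vector_fields U" "q \<in> U" "\<And>i. i \<in> I \<Longrightarrow> Y i \<in> vector_fields U"
  shows "nabla (\<lambda>q. \<Sum>i\<in>I. Y i q) X q = (\<Sum>i\<in>I. nabla (Y i) X q)"
proof -
  have 0: "nabla (\<lambda>q. 0) X q = 0"
    using nabla_scale_left[OF zero_vf assms(1) smooth_on_const[of _ 0] assms(2)] by simp
  show ?thesis
    using assms(3)
    by (induction I rule: infinite_finite_induct) (auto simp: 0 nabla_add_left assms sum_vf)
qed

lemma smooth_component: "X \<in> vector_fields U \<Longrightarrow> smooth_on U (\<lambda>q. X q \<bullet> b)"
  unfolding vector_fields_iff by (auto intro!: smooth_intros)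

lemma nabla_expansion:
  assumes X: "X \<in> vector_fields U" and Y: "Y \<in> vector_fields U" and q: "q \<in> U"
  shows "nabla X Y q = (\<Sum>b\<in>Basis. deriv_along U (\<lambda>q. Y q \<bullet> b) X q *\<^sub>R tangential b q +
    (Y q \<bullet> b) *\<^sub>R nabla X (tangential b) q)"
proof -
  have vf: "(\<lambda>q. (Y q \<bullet> b) *\<^sub>R tangential b q) \<in> vector_fields U" for b
    by (intro scale_vf smooth_component Y tangential_vf)
  have "nabla X Y q = nabla X (\<lambda>q. \<Sum>b\<in>Basis. (Y q \<bullet> b) *\<^sub>R tangential b q) q"
    using Y by (intro nabla_cong_right[OF X Y sum_vf[OF vf] q] tangential_expansion)
      (simp add: vector_fields_iff)
  also have "\<dots> = (\<Sum>b\<in>Basis. nabla X (\<lambda>q. (Y q \<bullet> b) *\<^sub>R tangential b q) q)"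
    by (rule nabla_sum_right[OF X q vf])
  finally show ?thesis
    by (simp add: nabla_scale_right[OF X tangential_vf smooth_component[OF Y] q])
qed

text \<open>Tensoriality in the first argument: once \<open>X\<close> is expanded in the globally
  defined fields \<open>tangential b\<close>, only the coefficients \<open>X q \<bullet> b\<close>
  remain.\<close>

lemma nabla_pointwise:
  assumes X: "X \<in> vector_fields U" and X': "X' \<in> vector_fields U" and Y: "Y \<in> vector_fields U"
    and q: "q \<in> U" and eq: "X q = X' q"
  shows "nabla X Y q = nabla X' Y q"
proof -
  have "nabla X Y q = (\<Sum>b\<in>Basis. (X q \<bullet> b) *\<^sub>R nabla (tangential b) Y q)" if X: "X \<in> vector_fields U" for X
  proof -
    have vf: "(\<lambda>q. (X q \<bullet> b) *\<^sub>R tangential b q) \<in> vector_fields U" for b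
      by (intro scale_vf smooth_component X tangential_vf)
    have "nabla X Y q = nabla (\<lambda>q. \<Sum>b\<in>Basis. (X q \<bullet> b) *\<^sub>R tangential b q) Y q"
      using X by (intro nabla_cong_left[OF Y X sum_vf[OF vf] q] tangential_expansion)
        (simp add: vector_fields_iff)
    also have "\<dots> = (\<Sum>b\<in>Basis. nabla (\<lambda>q. (X q \<bullet> b) *\<^sub>R tangential b q) Y q)"
      by (rule nabla_sum_left[OF Y q vf])
    finally show ?thesis
      by (simp add: nabla_scale_left[OF tangential_vf Y smooth_component[OF X] q])
  qed
  from this[OF X] this[OF X'] eq show ?thesis by simp
qed


text \<open>The analogue of the Christoffel symbols along the great circle, relative to the spanning
  fields \<open>tangential b\<close>.\<close>

definition gamma :: "'a \<Rightarrow> 'a \<Rightarrow> 'a \<Rightarrow> real \<Rightarrow> 'a" where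
  "gamma p w b t = nabla (rotation_field p w) (tangential b) (great_circle p w t)"

lemma gamma_tangent: "great_circle p w t \<in> U \<Longrightarrow> great_circle p w t \<bullet> gamma p w b t = 0"
  using nabla_vf[OF rotation_vf tangential_vf] unfolding vector_fields_iff gamma_def by blast

lemma smooth_gamma:
  assumes "great_circle p w ` A \<subseteq> U"
  shows "smooth_on A (gamma p w b)"
  unfolding gamma_def[abs_def]
  by (rule smooth_on_compose[OF smooth_on_great_circle vector_fields_smooth[OF nabla_vf[OF rotation_vf tangential_vf]] assms])

text \<open>This is \<open>nabla_expansion\<close> read along the curve, for fields \<open>V\<close>
  that need not be restrictions of fields on \<open>U\<close>: the first summands add up to the
  tangential part of \<open>V'\<close>, the second are the Christoffel terms.\<close>

definition circle_derivative :: "'a \<Rightarrow> 'a \<Rightarrow> real \<Rightarrow> real \<Rightarrow> (real \<Rightarrow> 'a) \<Rightarrow> real \<Rightarrow> 'a" where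
  "circle_derivative p w a b V t = (\<Sum>i\<in>Basis.
     (vector_derivative V (at t within {a..b}) \<bullet> i) *\<^sub>R tangential i (great_circle p w t) + (V t \<bullet> i) *\<^sub>R gamma p w i t)"

text \<open>Parallelism asks for an operator with the axioms of a covariant derivative. This
  provides one, so that fields annihilated by it are parallel and \<open>compatible\<close> applies
  to them.\<close>

lemma covariant_derivative_circle:
  assumes pw: "p \<bullet> p = 1" "w \<bullet> w = 1" "p \<bullet> w = 0"
    and ab: "a < b" and cU: "great_circle p w ` {a..b} \<subseteq> U"
  shows "covariant_derivative_along U nabla a b (great_circle p w) (circle_derivative p w a b)"
proof -
  let ?c = "great_circle p w" and ?D = "circle_derivative p w a b"
  have fa: "V \<in> fields_along U a b ?c \<longleftrightarrow> smooth_on {a..b} V \<and> (\<forall>t\<in>{a..b}. ?c t \<bullet> V t = 0)" for V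
    using cU tangent_space_U unfolding fields_along_def by (auto simp: image_subset_iff)
  have vd: "(V has_vector_derivative vector_derivative V (at t within {a..b})) (at t within {a..b})"
    if "smooth_on {a..b} V" "t \<in> {a..b}" for V :: "real \<Rightarrow> 'b::real_normed_vector" and t
    using smooth_on_differentiable[OF that]
    by (simp add: vector_derivative_works)
  have vdI: "vector_derivative V (at t within {a..b}) = V'"
    if "(V has_vector_derivative V') (at t within {a..b})" "t \<in> {a..b}" for V :: "real \<Rightarrow> 'b::real_normed_vector" and V' t
    using vector_derivative_within_cbox[of a b t V V'] ab that by simp
  have "?D V \<in> fields_along U a b ?c" if V: "V \<in> fields_along U a b ?c" for V
    unfolding fa
  proof
    show "smooth_on {a..b} (?D V)"
      unfolding circle_derivative_def[abs_def] tangential_def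
      using V ab cU by (intro smooth_intros smooth_gamma smooth_on_vector_derivative smooth_on_great_circle) (auto simp: fa)
    show "\<forall>t\<in>{a..b}. ?c t \<bullet> ?D V t = 0"
      using cU gamma_tangent tangential_vf
      unfolding circle_derivative_def vector_fields_iff
      by (auto simp: inner_sum_right inner_add_right image_subset_iff)
  qed
  moreover have "?D (\<lambda>s. V s + W s) t = ?D V t + ?D W t"
    if "V \<in> fields_along U a b ?c" "W \<in> fields_along U a b ?c" "t \<in> {a..b}" for V W t
  proof -
    have "vector_derivative (\<lambda>s. V s + W s) (at t within {a..b}) =
        vector_derivative V (at t within {a..b}) + vector_derivative W (at t within {a..b})"
      using that by (intro vdI has_vector_derivative_add vd) (auto simp: fa)
    then show ?thesis
      by (simp add: circle_derivative_def inner_add_left scaleR_left_distrib sum.distrib)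
  qed
  moreover have "?D (\<lambda>s. f s *\<^sub>R V s) t = vector_derivative f (at t within {a..b}) *\<^sub>R V t + f t *\<^sub>R ?D V t"
    if V: "V \<in> fields_along U a b ?c" and f: "smooth_on {a..b} f" and t: "t \<in> {a..b}" for V f t
  proof -
    have "vector_derivative (\<lambda>s. f s *\<^sub>R V s) (at t within {a..b}) =
        f t *\<^sub>R vector_derivative V (at t within {a..b}) + vector_derivative f (at t within {a..b}) *\<^sub>R V t"
      using V f t by (intro vdI has_vector_derivative_scaleR vd)
        (auto simp: fa has_real_derivative_iff_has_vector_derivative intro: vd)
    \<comment> \<open>In the product rule the term with the derivative of \<open>f\<close> is
      projected to the tangent space, which leaves the tangent vector \<open>V t\<close>
      unchanged.\<close>
    moreover have "?c t \<bullet> V t = 0" using V t by (simp add: fa)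
    ultimately show ?thesis
      unfolding circle_derivative_def sum.distrib tangential_sum
      by (simp add: inner_add_right scaleR_sum_right algebra_simps)
  qed
  moreover have "?D (\<lambda>s. Y (?c s)) t = nabla X Y (?c t)"
    if X: "X \<in> vector_fields U" and Y: "Y \<in> vector_fields U" and t: "t \<in> {a..b}"
      and Xt: "X (?c t) = vector_derivative ?c (at t within {a..b})" for X Y t
  proof -
    have q: "?c t \<in> U" using cU t by blast
    have Xr: "X (?c t) = rotation_field p w (?c t)"
      using vdI[OF great_circle_derivative[OF pw] t] Xt by simp
    have *: "(?c has_vector_derivative X (?c t)) (at t within {a..b})"
      unfolding Xr by (rule great_circle_derivative[OF pw])
    have "smooth_on {a..b} (\<lambda>s. Y (?c s))"
      by (rule smooth_on_compose[OF smooth_on_great_circle vector_fields_smooth[OF Y] cU])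
    then have dY: "((\<lambda>s. Y (?c s)) has_vector_derivative vector_derivative (\<lambda>s. Y (?c s)) (at t within {a..b})) (at t within {a..b})"
      using t by (rule vd)
    have "vector_derivative (\<lambda>s. Y (?c s)) (at t within {a..b}) \<bullet> i = deriv_along U (\<lambda>q. Y q \<bullet> i) X (?c t)" for i
    proof -
      have "((\<lambda>s. Y (?c s) \<bullet> i) has_vector_derivative vector_derivative (\<lambda>s. Y (?c s)) (at t within {a..b}) \<bullet> i) (at t within {a..b})"
        using bounded_linear.has_vector_derivative[OF bounded_linear_inner_left dY] .
      moreover have "((\<lambda>s. Y (?c s) \<bullet> i) has_vector_derivative deriv_along U (\<lambda>q. Y q \<bullet> i) X (?c t)) (at t within {a..b})"
        by (rule deriv_along_curve[where c = ?c and X = X and t = t, OF smooth_component[OF Y] * cU t])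
      ultimately show ?thesis using vdI[OF _ t] by metis
    qed
    \<comment> \<open>The axiom admits any \<open>X\<close> that matches the velocity at this one
      parameter; tensoriality trades it for the rotation field.\<close>
    moreover have "gamma p w i t = nabla X (tangential i) (?c t)" for i
      unfolding gamma_def by (rule nabla_pointwise[OF rotation_vf X tangential_vf q Xr[symmetric]])
    ultimately show ?thesis by (simp add: circle_derivative_def nabla_expansion[OF X Y q])
  qed
  ultimately show ?thesis unfolding covariant_derivative_along_def by blast
qed

text \<open>For tangent \<open>V\<close>, the equation \<open>circle_derivative V = 0\<close> fixes only the tangential part of \<open>V'\<close>; its normal
  part is found by differentiating \<open>c \<bullet> V = 0\<close>.\<close>

definition transport_generator :: "'a \<Rightarrow> 'a \<Rightarrow> real \<Rightarrow> 'a \<Rightarrow> 'a" where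
  "transport_generator p w t x = - (x \<bullet> rotation_field p w (great_circle p w t)) *\<^sub>R great_circle p w t -
     (\<Sum>i\<in>Basis. (x \<bullet> i) *\<^sub>R gamma p w i t)"

lemma linear_transport_generator: "linear (transport_generator p w t)"
  unfolding transport_generator_def[abs_def]
  by (rule linearI) (simp_all add: inner_add_left sum.distrib algebra_simps scaleR_sum_right)

text \<open>The normal component of the generator makes \<open>c \<bullet> V\<close> constant, so a
  field that starts tangent stays tangent; the tangential component then is the equation of
  parallelism.\<close>

lemma parallel_circle:
  assumes pw: "p \<bullet> p = 1" "w \<bullet> w = 1" "p \<bullet> w = 0"
    and I: "open I" "is_interval I" "t0 \<in> I" and cU: "great_circle p w ` I \<subseteq> U"
    and V0: "great_circle p w t0 \<bullet> V t0 = 0"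
    and ode: "\<And>t. t \<in> I \<Longrightarrow> (V has_vector_derivative transport_generator p w t (V t)) (at t)"
  shows "t \<in> I \<Longrightarrow> great_circle p w t \<bullet> V t = 0"
    and "a < b \<Longrightarrow> {a..b} \<subseteq> I \<Longrightarrow> parallel_along U nabla a b (great_circle p w) V"
proof -
  let ?c = "great_circle p w" and ?R = "\<lambda>t. rotation_field p w (great_circle p w t)"
  have sV: "C_k_on k I V" for k
  proof (rule C_k_on_ode_bootstrap[OF I(1) ode])
    fix k assume V: "C_k_on k I V"
    have *: "C_k_on k I ?c" "C_k_on k I (gamma p w i)" "C_k_on k I ?R" for i
      using smooth_on_open_imp[OF I(1)] smooth_on_great_circle smooth_gamma[OF cU]
        smooth_on_compose[OF smooth_on_great_circle vector_fields_smooth[OF rotation_vf] cU] by blast+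
    \<comment> \<open>The generator is rewritten with factors -1, so that the rules for sums and
      products suffice.\<close>
    have "C_k_on k I (\<lambda>t. (- 1) *\<^sub>R ((V t \<bullet> ?R t) *\<^sub>R ?c t) + (- 1) *\<^sub>R (\<Sum>i\<in>Basis. (V t \<bullet> i) *\<^sub>R gamma p w i t))"
      by (intro C_k_on_add[OF I(1)] C_k_on_bounded_bilinear[OF I(1) bounded_bilinear_scaleR]
          C_k_on_bounded_bilinear[OF I(1) bounded_bilinear_inner] C_k_on_sum[OF I(1)]
          C_k_on_const[OF I(1)] * V)
    then show "C_k_on k I (\<lambda>t. transport_generator p w t (V t))"
      by (simp add: transport_generator_def)
  qed
  have cc: "?c t \<bullet> ?c t = 1" "?c t \<bullet> ?R t = 0" "\<And>i. ?c t \<bullet> gamma p w i t = 0" if "t \<in> I" for t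
    using that cU inner_self gamma_tangent rotation_vf unfolding vector_fields_iff by blast+
  have "((\<lambda>t. ?c t \<bullet> V t) has_vector_derivative 0) (at t within I)" if t: "t \<in> I" for t
  proof -
    have "((\<lambda>t. ?c t \<bullet> V t) has_vector_derivative ?c t \<bullet> transport_generator p w t (V t) + ?R t \<bullet> V t) (at t)"
      by (rule bounded_bilinear.has_vector_derivative[OF bounded_bilinear_inner great_circle_derivative[OF pw] ode[OF t]])
    moreover have "?c t \<bullet> transport_generator p w t (V t) + ?R t \<bullet> V t = 0"
      using cc[OF t] by (simp add: transport_generator_def inner_diff_right inner_sum_right inner_commute)
    ultimately show ?thesis by (simp add: has_vector_derivative_at_within)
  qed
  then obtain k where "\<And>t. t \<in> I \<Longrightarrow> ?c t \<bullet> V t = k"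
    using has_vector_derivative_zero_constant[OF is_interval_convex[OF I(2)], of "\<lambda>t. ?c t \<bullet> V t"] by blast
  then have tan: "?c t \<bullet> V t = 0" if "t \<in> I" for t using V0 I(3) that by metis
  then show "t \<in> I \<Longrightarrow> ?c t \<bullet> V t = 0" .
  assume ab: "a < b" "{a..b} \<subseteq> I"
  have cab: "?c ` {a..b} \<subseteq> U" using ab cU by blast
  have "V \<in> fields_along U a b ?c"
    unfolding fields_along_def
    using smooth_onI[OF I(1) ab(2) sV] tan ab cab tangent_space_U by (auto simp: image_subset_iff)
  moreover have "circle_derivative p w a b V t = 0" if t: "t \<in> {a..b}" for t
  proof -
    have tI: "t \<in> I" using t ab by blast
    have "vector_derivative V (at t within {a..b}) = transport_generator p w t (V t)"
      using vector_derivative_within_cbox[of a b t V] ab(1) t has_vector_derivative_at_within[OF ode[OF tI]] by simp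
    then show ?thesis
      using cc[OF tI] unfolding circle_derivative_def
      by (simp add: sum.distrib tangential_sum) (simp add: transport_generator_def inner_diff_right inner_sum_right)
  qed
  ultimately show "parallel_along U nabla a b ?c V"
    unfolding parallel_along_def using covariant_derivative_circle[OF pw ab(1) cab] by blast
qed

text \<open>The equation is linear, so \<open>r *\<^sub>R V1 + s *\<^sub>R V2\<close> is the
  transport of the combination of \<open>u1\<close> and \<open>u2\<close>, and compatibility applies
  to all combinations at once. For \<open>t < t0\<close> it is applied on the interval from
  \<open>t\<close> to \<open>t0\<close> and read backwards.\<close>

lemma local_isometries:
  assumes pw: "p \<bullet> p = 1" "w \<bullet> w = 1" "p \<bullet> w = 0" and c0: "great_circle p w t0 \<in> U"
    and F: "compatible U F nabla"
  obtains d where "d > 0" "\<And>t. \<bar>t - t0\<bar> < d \<Longrightarrow> great_circle p w t \<in> U"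
    "\<And>u1 u2. great_circle p w t0 \<bullet> u1 = 0 \<Longrightarrow> great_circle p w t0 \<bullet> u2 = 0 \<Longrightarrow>
      \<exists>V1 V2. \<forall>t. \<bar>t - t0\<bar> < d \<longrightarrow> great_circle p w t \<bullet> V1 t = 0 \<and> great_circle p w t \<bullet> V2 t = 0 \<and>
        (\<forall>r s. F (great_circle p w t, r *\<^sub>R V1 t + s *\<^sub>R V2 t) = F (great_circle p w t0, r *\<^sub>R u1 + s *\<^sub>R u2))"
proof -
  let ?c = "great_circle p w"
  have cc: "continuous_on A ?c" for A
    by (rule smooth_on_continuous[OF smooth_on_great_circle])
  have cs: "?c t \<in> sphere 0 1" for t
    using pw by (simp add: norm_eq_1 great_circle_def inner_add_left inner_add_right inner_commute flip: power2_eq_square)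
  obtain T where T: "open T" "U = sphere 0 1 \<inter> T" using open_U by (auto simp: openin_open)
  have "open (?c -` T)" using cc[of UNIV] T(1) by (simp add: open_vimage)
  moreover have "t0 \<in> ?c -` T" using c0 T by simp
  ultimately obtain e0 where e0: "e0 > 0" "ball t0 e0 \<subseteq> ?c -` T" by (meson openE)
  \<comment> \<open>Half the radius, so that even the closed interval stays in the open
    preimage.\<close>
  define e where "e = e0 / 2"
  have e: "e > 0" using e0 by (simp add: e_def)
  have cU: "?c ` {t0-e..t0+e} \<subseteq> U"
  proof
    fix q assume "q \<in> ?c ` {t0-e..t0+e}"
    then obtain t where t: "q = ?c t" "t \<in> {t0-e..t0+e}" by blast
    then have "t \<in> ball t0 e0" using e0 by (auto simp: dist_real_def e_def)
    then show "q \<in> U" using t e0 T cs by blast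
  qed
  have "continuous_on ({t0-e..t0+e} \<times> UNIV) (\<lambda>(t, x). transport_generator p w t x)"
  proof -
    have cg: "continuous_on {t0-e..t0+e} (gamma p w i)" for i
      by (rule smooth_on_continuous[OF smooth_gamma[OF cU]])
    have "continuous_on ({t0-e..t0+e} \<times> (UNIV :: 'a set)) (\<lambda>z. gamma p w i (fst z))" for i
      by (rule continuous_on_compose2[OF cg]) (auto intro: continuous_intros)
    moreover have "continuous_on ({t0-e..t0+e} \<times> (UNIV :: 'a set)) (\<lambda>z. ?c (fst z))"
      by (rule continuous_on_compose2[OF cc]) (auto intro: continuous_intros)
    ultimately show ?thesis
      unfolding transport_generator_def rotation_field_def case_prod_beta by (intro continuous_intros)
  qed
  from linear_ode_solution[OF e this linear_transport_generator]
  obtain d where d: "d > 0" "d \<le> e" "\<And>x0. \<exists>x. x t0 = x0 \<and>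
    (\<forall>t\<in>{t0-d<..<t0+d}. (x has_vector_derivative transport_generator p w t (x t)) (at t))"
    by blast
  define I where "I = {t0-d<..<t0+d}"
  have I: "open I" "is_interval I" "t0 \<in> I" using d by (auto simp: I_def is_interval_convex_1)
  have cUI: "?c ` I \<subseteq> U" using cU d by (force simp: I_def)
  have tI: "t \<in> I \<longleftrightarrow> \<bar>t - t0\<bar> < d" for t by (auto simp: I_def abs_less_iff)
  show ?thesis
  proof
    show "d > 0" by fact
    show "great_circle p w t \<in> U" if "\<bar>t - t0\<bar> < d" for t using cUI that tI by blast
    fix u1 u2 assume u: "?c t0 \<bullet> u1 = 0" "?c t0 \<bullet> u2 = 0"
    obtain V1 where V1: "V1 t0 = u1" "\<And>t. t \<in> I \<Longrightarrow> (V1 has_vector_derivative transport_generator p w t (V1 t)) (at t)"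
      using d(3)[of u1] unfolding I_def by blast
    obtain V2 where V2: "V2 t0 = u2" "\<And>t. t \<in> I \<Longrightarrow> (V2 has_vector_derivative transport_generator p w t (V2 t)) (at t)"
      using d(3)[of u2] unfolding I_def by blast
    have "F (?c t, r *\<^sub>R V1 t + s *\<^sub>R V2 t) = F (?c t0, r *\<^sub>R u1 + s *\<^sub>R u2)" if t: "t \<in> I" for r s t
    proof -
      define V where "V = (\<lambda>t. r *\<^sub>R V1 t + s *\<^sub>R V2 t)"
      have V0: "?c t0 \<bullet> V t0 = 0" using u V1 V2 by (simp add: V_def inner_add_right)
      have ode: "(V has_vector_derivative transport_generator p w t (V t)) (at t)" if "t \<in> I" for t
      proof -
        have "(V has_vector_derivative r *\<^sub>R transport_generator p w t (V1 t) + s *\<^sub>R transport_generator p w t (V2 t)) (at t)"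
          unfolding V_def using V1(2)[OF that] V2(2)[OF that] by (auto intro!: derivative_eq_intros)
        then show ?thesis
          by (simp only: V_def linear_add[OF linear_transport_generator] linear_cmul[OF linear_transport_generator])
      qed
      have *: "F (?c b, V b) = F (?c a, V a)" if "a < b" "{a..b} \<subseteq> I" for a b
      proof -
        have "smooth_curve U a b ?c"
          unfolding smooth_curve_def using that cUI smooth_on_great_circle by blast
        then show ?thesis
          using F parallel_circle(2)[OF pw I cUI V0 ode that] unfolding compatible_def by blast
      qed
      have "F (?c t, V t) = F (?c t0, V t0)"
      proof (cases t t0 rule: linorder_cases)
        case less
        then show ?thesis using *[of t t0] t by (force simp: I_def)
      next
        case greater
        then show ?thesis using *[of t0 t] t by (force simp: I_def)
      qed simp
      then show ?thesis using V1(1) V2(1) by (simp add: V_def)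
    qed
    moreover have "?c t \<bullet> V1 t = 0" "?c t \<bullet> V2 t = 0" if "t \<in> I" for t
      using parallel_circle(1)[OF pw I cUI _ V1(2) that] parallel_circle(1)[OF pw I cUI _ V2(2) that] u V1 V2 by auto
    ultimately show "\<exists>V1 V2. \<forall>t. \<bar>t - t0\<bar> < d \<longrightarrow> ?c t \<bullet> V1 t = 0 \<and> ?c t \<bullet> V2 t = 0 \<and>
        (\<forall>r s. F (?c t, r *\<^sub>R V1 t + s *\<^sub>R V2 t) = F (?c t0, r *\<^sub>R u1 + s *\<^sub>R u2))"
      unfolding tI[symmetric] by blast
  qed
qed

end

subsection \<open>Moments of planar gauges\<close>

lemma integral_compact_support:
  fixes g :: "'a::euclidean_space \<Rightarrow> 'b::euclidean_space"
  assumes "continuous_on UNIV g" "\<And>v. v \<notin> cbox a b \<Longrightarrow> g v = 0"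
  shows "g absolutely_integrable_on UNIV" "integral UNIV g = integral (cbox a b) g"
proof -
  have e: "(\<lambda>x. if x \<in> cbox a b then g x else 0) = g" using assms(2) by auto
  have "g absolutely_integrable_on cbox a b"
    by (rule absolutely_integrable_continuous[OF continuous_on_subset[OF assms(1)]]) auto
  then show "g absolutely_integrable_on UNIV"
    using absolutely_integrable_restrict_UNIV[of "cbox a b" g] e by simp
  show "integral UNIV g = integral (cbox a b) g"
    using integral_restrict_UNIV[of "cbox a b" g] e by simp
qed

text \<open>Linear substitution is applied to \<open>\<psi> \<circ> g\<close>, with values in
  \<open>real^2\<close>; being linear and injective, \<open>\<psi>\<close> commutes with the
  integrals and can be cancelled.\<close>

lemma integral_linear_image_complex:
  fixes g :: "real^2 \<Rightarrow> complex" and A :: "real^2 \<Rightarrow> real^2"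
  assumes A: "linear A" "inj A" and g: "g absolutely_integrable_on UNIV" and gA: "(\<lambda>v. g (A v)) absolutely_integrable_on UNIV"
  shows "integral UNIV g = \<bar>det (matrix A)\<bar> *\<^sub>R integral UNIV (\<lambda>v. g (A v))"
proof -
  define \<psi> :: "complex \<Rightarrow> real^2" where "\<psi> z = vector [Re z, Im z]" for z
  have "linear \<psi>" by (rule linearI) (auto simp: \<psi>_def vec_eq_iff forall_2)
  then have \<psi>: "bounded_linear \<psi>" by (simp add: linear_conv_bounded_linear)
  have inj: "z = w" if "\<psi> z = \<psi> w" for z w
    using that by (auto simp: \<psi>_def vec_eq_iff forall_2 complex_eq_iff)
  have "A ` UNIV = UNIV" using linear_injective_imp_surjective[OF A] by simp
  then have "integral UNIV (\<psi> \<circ> g) = \<bar>det (matrix A)\<bar> *\<^sub>R integral UNIV ((\<psi> \<circ> g) \<circ> A)"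
    using integral_change_of_variables_linear[OF A(1), where f = "\<psi> \<circ> g" and S = UNIV]
      absolutely_integrable_linear[OF g \<psi>] by simp
  moreover have "integral UNIV (\<psi> \<circ> g) = \<psi> (integral UNIV g)"
    using g \<psi> by (intro integral_linear) (auto simp: absolutely_integrable_on_def)
  moreover have "integral UNIV (\<psi> \<circ> (\<lambda>v. g (A v))) = \<psi> (integral UNIV (\<lambda>v. g (A v)))"
    using gA \<psi> by (intro integral_linear) (auto simp: absolutely_integrable_on_def)
  ultimately have "\<psi> (integral UNIV g) = \<psi> (\<bar>det (matrix A)\<bar> *\<^sub>R integral UNIV (\<lambda>v. g (A v)))"
    by (simp add: o_def linear_cmul[OF \<open>linear \<psi>\<close>])
  then show ?thesis by (rule inj)
qed

text \<open>Homogeneity is required for positive factors only, since a Finsler norm may be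
  asymmetric.\<close>

definition gauge_fun :: "(real^2 \<Rightarrow> real) \<Rightarrow> bool" where
  "gauge_fun N \<longleftrightarrow> continuous_on UNIV N \<and> (\<forall>v. \<forall>t>0. N (t *\<^sub>R v) = t * N v) \<and> (\<forall>v. v \<noteq> 0 \<longrightarrow> N v > 0)"

definition moment :: "(real^2 \<Rightarrow> real) \<Rightarrow> (real^2 \<Rightarrow> complex) \<Rightarrow> complex" where
  "moment N f = integral UNIV (\<lambda>v. max 0 (1 - N v) *\<^sub>R f v)"

lemma gauge_fun_0: "gauge_fun N \<Longrightarrow> N 0 = 0"
  unfolding gauge_fun_def by (metis mult_cancel_right1 numeral_eq_one_iff scaleR_zero_right semiring_norm(85) zero_less_numeral)

lemma gauge_fun_scale: "gauge_fun N \<Longrightarrow> t \<ge> 0 \<Longrightarrow> N (t *\<^sub>R v) = t * N v"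
  using gauge_fun_0[of N] by (cases "t = 0") (auto simp: gauge_fun_def)

text \<open>The minimum over the compact unit circle is positive and scales by homogeneity. It
  confines the unit ball of \<open>N\<close> to a box.\<close>

lemma gauge_fun_lower_bound:
  assumes "gauge_fun N"
  obtains c where "c > 0" "\<And>v. c * norm v \<le> N v"
proof -
  have "continuous_on (sphere 0 1) N" using assms continuous_on_subset unfolding gauge_fun_def by blast
  moreover have "sphere (0::real^2) 1 \<noteq> {}" by simp
  ultimately obtain v0 where v0: "v0 \<in> sphere 0 1" "\<And>v. v \<in> sphere 0 1 \<Longrightarrow> N v0 \<le> N v"
    using continuous_attains_inf[of "sphere 0 1" N] by auto
  show ?thesis
  proof
    show "N v0 > 0" using assms v0(1) unfolding gauge_fun_def by (metis dist_0_norm mem_sphere norm_zero zero_neq_one)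
    show "N v0 * norm v \<le> N v" for v
    proof (cases "v = 0")
      case False
      then have "N v0 \<le> N (v /\<^sub>R norm v)" by (intro v0(2)) simp
      also have "\<dots> = N v / norm v" using gauge_fun_scale[OF assms, of "inverse (norm v)" v] by (simp add: divide_inverse)
      finally show ?thesis using False by (simp add: field_simps)
    qed (simp add: gauge_fun_0[OF assms])
  qed
qed

lemma weight_support:
  assumes c: "c > 0" "\<And>v. c * norm v \<le> N v" and v: "v \<notin> cbox (- (\<chi> i. 1 / c)) (\<chi> i. 1 / c)"
  shows "max 0 (1 - N v) = (0::real)"
proof -
  obtain i where "\<not> (- (1 / c) \<le> v $ i \<and> v $ i \<le> 1 / c)"
    using v by (auto simp: mem_box_cart)
  then have "\<bar>v $ i\<bar> > 1 / c" by linarith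
  then have "norm v > 1 / c" using component_le_norm_cart[of v i] by linarith
  then have "c * norm v > 1" using c(1) by (simp add: field_simps)
  then show ?thesis using c(2)[of v] by simp
qed

lemma moment_integrable:
  fixes f :: "real^2 \<Rightarrow> complex"
  assumes N: "gauge_fun N" and f: "continuous_on UNIV f"
  shows "(\<lambda>v. max 0 (1 - N v) *\<^sub>R f v) absolutely_integrable_on UNIV"
proof -
  obtain c where c: "c > 0" "\<And>v. c * norm v \<le> N v" using gauge_fun_lower_bound[OF N] by blast
  show ?thesis
  proof (rule integral_compact_support(1))
    show "continuous_on UNIV (\<lambda>v. max 0 (1 - N v) *\<^sub>R f v)"
      using N f unfolding gauge_fun_def by (intro continuous_intros) auto
    show "max 0 (1 - N v) *\<^sub>R f v = 0" if "v \<notin> cbox (- (\<chi> i. 1 / c)) (\<chi> i. 1 / c)" for v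
      using weight_support[OF c that] by simp
  qed
qed

lemma moment_integrable_on:
  fixes f :: "real^2 \<Rightarrow> complex"
  assumes "gauge_fun N" "continuous_on UNIV f"
  shows "(\<lambda>v. max 0 (1 - N v) *\<^sub>R f v) integrable_on UNIV"
  using moment_integrable[OF assms] by (simp add: absolutely_integrable_on_def)

lemma moment_add:
  assumes "gauge_fun N" "continuous_on UNIV f" "continuous_on UNIV g"
  shows "moment N (\<lambda>v. f v + g v) = moment N f + moment N g"
  using moment_integrable_on[OF assms(1,2)] moment_integrable_on[OF assms(1,3)]
  by (simp add: moment_def scaleR_right_distrib integral_add)

lemma moment_cmul:
  assumes "gauge_fun N" "continuous_on UNIV f"
  shows "moment N (\<lambda>v. c * f v) = c * moment N f"
  using integral_linear[OF moment_integrable_on[OF assms] bounded_linear_mult_right[of c]]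
  by (simp add: moment_def o_def)

lemma moment_cnj:
  assumes "gauge_fun N" "continuous_on UNIV f"
  shows "moment N (\<lambda>v. cnj (f v)) = cnj (moment N f)"
  using integral_linear[OF moment_integrable_on[OF assms] bounded_linear_cnj]
  by (simp add: moment_def o_def)

lemma moment_combination:
  assumes N: "gauge_fun N" and "continuous_on UNIV f" "continuous_on UNIV g" "continuous_on UNIV h"
  shows "moment N (\<lambda>v. a * f v + (b * g v + c * cnj (h v))) = a * moment N f + (b * moment N g + c * cnj (moment N h))"
  by (simp add: moment_add[OF N] moment_cmul[OF N] moment_cnj[OF N] continuous_on_add continuous_on_mult
      continuous_on_cnj assms)

lemma gauge_fun_comp:
  assumes N: "gauge_fun N" and A: "linear A" "inj A"
  shows "gauge_fun (\<lambda>v. N (A v))"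
proof -
  have "continuous_on UNIV A" using A(1) by (simp add: linear_continuous_on linear_conv_bounded_linear)
  then have "continuous_on UNIV (\<lambda>v. N (A v))"
    using N continuous_on_compose2[of UNIV N UNIV A] by (auto simp: gauge_fun_def)
  moreover have "A v \<noteq> 0" if "v \<noteq> 0" for v using A that linear_injective_0 by blast
  ultimately show ?thesis using N A(1) by (auto simp: gauge_fun_def linear_cmul)
qed

lemma moment_change:
  assumes N: "gauge_fun N" and A: "linear A" "inj A" and f: "continuous_on UNIV f"
  shows "moment N f = \<bar>det (matrix A)\<bar> *\<^sub>R moment (\<lambda>v. N (A v)) (\<lambda>v. f (A v))"
proof -
  have "continuous_on UNIV A" using A(1) by (simp add: linear_continuous_on linear_conv_bounded_linear)
  then have fA: "continuous_on UNIV (\<lambda>v. f (A v))"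
    using f continuous_on_compose2[of UNIV f UNIV A] by auto
  show ?thesis
    unfolding moment_def
    using integral_linear_image_complex[OF A moment_integrable[OF N f]] moment_integrable[OF gauge_fun_comp[OF N A] fA]
    by simp
qed

text \<open>A nonnegative continuous function whose integral over a box is 0 vanishes there, but the
  integrand is positive at \<open>v0\<close>.\<close>

lemma moment_pos:
  fixes h :: "real^2 \<Rightarrow> real"
  assumes N: "gauge_fun N" and h: "continuous_on UNIV h" "\<And>v. h v \<ge> 0" and v0: "h v0 > 0" "N v0 < 1"
  shows "Re (moment N (\<lambda>v. of_real (h v))) > 0"
proof -
  define g where "g = (\<lambda>v. max 0 (1 - N v) * h v)"
  obtain c where c: "c > 0" "\<And>v. c * norm v \<le> N v" using gauge_fun_lower_bound[OF N] by blast
  let ?a = "- (\<chi> i. 1 / c) :: real^2" and ?b = "(\<chi> i. 1 / c) :: real^2"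
  have cg: "continuous_on UNIV g"
    unfolding g_def using N h by (intro continuous_intros) (auto simp: gauge_fun_def)
  have supp: "g v = 0" if "v \<notin> cbox ?a ?b" for v
    using weight_support[OF c that] by (simp add: g_def)
  have "Re (moment N (\<lambda>v. of_real (h v))) = integral UNIV g"
    using integral_linear[OF moment_integrable_on[OF N, of "\<lambda>v. of_real (h v)"] bounded_linear_Re] h(1)
    by (simp add: moment_def o_def g_def continuous_on_of_real)
  also have "\<dots> = integral (cbox ?a ?b) g" by (rule integral_compact_support(2)[OF cg supp])
  finally have e: "Re (moment N (\<lambda>v. of_real (h v))) = integral (cbox ?a ?b) g" .
  have cb: "continuous_on (cbox ?a ?b) g" using cg continuous_on_subset by blast
  then have int: "g integrable_on cbox ?a ?b" by (rule integrable_continuous)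
  have nn: "g v \<ge> 0" for v using h(2) by (simp add: g_def)
  then have "integral (cbox ?a ?b) g \<ge> 0" by (intro integral_nonneg int)
  moreover have "integral (cbox ?a ?b) g \<noteq> 0"
  proof
    assume "integral (cbox ?a ?b) g = 0"
    then have z: "(g has_integral 0) (cbox ?a ?b)" using int by (simp add: has_integral_integrable_integral)
    have "0 \<in> box ?a ?b" using c by (simp add: mem_box_cart)
    then have "box ?a ?b \<noteq> {}" by blast
    moreover have g0: "g v0 > 0" using v0 by (simp add: g_def)
    then have "v0 \<in> cbox ?a ?b" using supp by fastforce
    ultimately show False using has_integral_0_cbox_imp_0[OF cb nn z] g0 by auto
  qed
  ultimately show ?thesis using e by simp
qed

section \<open>Conformal coordinates and mixed moments\<close>

definition conformal :: "(real^2 \<Rightarrow> real) \<Rightarrow> (real^2 \<Rightarrow> complex) \<Rightarrow> bool" where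
  "conformal N z \<longleftrightarrow> linear z \<and> inj z \<and> moment N (\<lambda>v. z v * z v) = 0"

definition mixed_moment :: "(real^2 \<Rightarrow> real) \<Rightarrow> (real^2 \<Rightarrow> complex) \<Rightarrow> nat \<Rightarrow> nat \<Rightarrow> complex" where
  "mixed_moment N z a b = moment N (\<lambda>v. z v ^ a * cnj (z v) ^ b)"

lemma continuous_on_linear_complex: "linear z \<Longrightarrow> continuous_on A (z :: real^2 \<Rightarrow> complex)"
  by (simp add: linear_continuous_on linear_conv_bounded_linear)

lemma real_linear_complex:
  fixes z w :: "real^2 \<Rightarrow> complex"
  assumes z: "linear z" "inj z" and w: "linear w"
  obtains a b where "\<And>v. w v = a * z v + b * cnj (z v)"
proof -
  obtain g where g: "linear g" "g \<circ> z = id" using linear_injective_left_inverse[OF z] by blast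
  have G: "linear (\<lambda>x. w (g x))" using linear_compose[OF g(1) w] by (simp add: o_def)
  \<comment> \<open>The coefficients are the two Wirtinger derivatives of the real-linear map
    \<open>w \<circ> g\<close> of the complex plane.\<close>
  have "w v = (w (g 1) - \<i> * w (g \<i>)) / 2 * z v + (w (g 1) + \<i> * w (g \<i>)) / 2 * cnj (z v)" for v
  proof -
    have "z v = Re (z v) *\<^sub>R 1 + Im (z v) *\<^sub>R \<i>" by (simp add: complex_eq_iff)
    then have "w (g (z v)) = Re (z v) *\<^sub>R w (g 1) + Im (z v) *\<^sub>R w (g \<i>)"
      using linear_add[OF G] linear_cmul[OF G] by metis
    moreover have "g (z v) = v" using g(2) by (metis comp_apply id_apply)
    ultimately have "w v = Re (z v) *\<^sub>R w (g 1) + Im (z v) *\<^sub>R w (g \<i>)" by simp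
    then show ?thesis by (simp add: complex_eq_iff field_simps)
  qed
  then show ?thesis by (rule that)
qed

lemma gauge_small_vector:
  assumes N: "gauge_fun N" and v: "v \<noteq> 0"
  obtains t where "t > 0" "N (t *\<^sub>R v) < 1"
proof
  have "N v > 0" using assms by (simp add: gauge_fun_def)
  then show "1 / (2 * N v) > 0" "N ((1 / (2 * N v)) *\<^sub>R v) < 1"
    using gauge_fun_scale[OF N, of "1 / (2 * N v)" v] by auto
qed

lemma moment_norm_square_pos:
  assumes N: "gauge_fun N" and z: "linear z" "inj z"
  shows "Re (moment N (\<lambda>v. z v * cnj (z v))) > 0"
proof -
  obtain t where t: "t > 0" "N (t *\<^sub>R axis 1 1) < 1"
    using gauge_small_vector[OF N, of "axis 1 1"] by auto
  have "t *\<^sub>R (axis 1 1 :: real^2) \<noteq> 0" using t by simp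
  then have "z (t *\<^sub>R axis 1 1) \<noteq> 0" using z linear_injective_0 by blast
  then have "Re (moment N (\<lambda>v. of_real ((cmod (z v))\<^sup>2))) > 0"
    using t by (intro moment_pos[OF N, where ?v0.0 = "t *\<^sub>R axis 1 1"])
      (auto intro!: continuous_intros continuous_on_linear_complex z)
  then show ?thesis by (simp only: complex_norm_square)
qed

text \<open>Write \<open>w = a * z + b * cnj z\<close>. As the second moment of \<open>z\<close>
  vanishes, that of \<open>w\<close> is \<open>2 * a * b\<close> times the positive moment of
  \<open>z * cnj z\<close>. So \<open>a * b = 0\<close>.\<close>

lemma conformal_unique:
  assumes N: "gauge_fun N" and z: "conformal N z" and w: "conformal N w"
  obtains l where "l \<noteq> 0" "(\<forall>v. w v = l * z v) \<or> (\<forall>v. w v = l * cnj (z v))"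
proof -
  have lz: "linear z" "inj z" and lw: "linear w" "inj w" using z w by (auto simp: conformal_def)
  obtain a b where ab: "\<And>v. w v = a * z v + b * cnj (z v)"
    using real_linear_complex[OF lz lw(1)] by blast
  note cz = continuous_on_linear_complex[OF lz(1)]
  have "0 = moment N (\<lambda>v. a\<^sup>2 * (z v * z v) + (2 * a * b * (z v * cnj (z v)) + b\<^sup>2 * cnj (z v * z v)))"
    using w ab by (simp add: conformal_def algebra_simps power2_eq_square)
  also have "\<dots> = a\<^sup>2 * moment N (\<lambda>v. z v * z v) + (2 * a * b * moment N (\<lambda>v. z v * cnj (z v)) + b\<^sup>2 * cnj (moment N (\<lambda>v. z v * z v)))"
    by (rule moment_combination[OF N]) (intro continuous_intros cz)+
  also have "\<dots> = 2 * a * b * moment N (\<lambda>v. z v * cnj (z v))" using z by (simp add: conformal_def)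
  finally have "a * b = 0" using moment_norm_square_pos[OF N lz] by auto
  moreover have "axis 1 1 \<noteq> (0 :: real^2)" by simp
  then have "w (axis 1 1) \<noteq> 0" using lw linear_injective_0 by blast
  then have "a \<noteq> 0 \<or> b \<noteq> 0" using ab by auto
  ultimately show ?thesis using that[of a] that[of b] ab by auto
qed

text \<open>Passing from \<open>z\<close> to \<open>l * z\<close> multiplies the mixed moment by
  \<open>l ^ a * cnj l ^ b\<close>; passing to \<open>l * cnj z\<close> conjugates it as well.
  Neither affects its vanishing.\<close>

lemma mixed_moment_unique:
  assumes N: "gauge_fun N" and z: "conformal N z" and w: "conformal N w"
  shows "mixed_moment N z a b = 0 \<longleftrightarrow> mixed_moment N w a b = 0"
proof -
  obtain l where l: "l \<noteq> 0" "(\<forall>v. w v = l * z v) \<or> (\<forall>v. w v = l * cnj (z v))"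
    using conformal_unique[OF assms] by blast
  have cz: "continuous_on UNIV (\<lambda>v. z v ^ a * cnj (z v) ^ b)"
    using z by (intro continuous_intros continuous_on_linear_complex) (auto simp: conformal_def)
  from l(2) show ?thesis
  proof
    assume "\<forall>v. w v = l * z v"
    then have "mixed_moment N w a b = moment N (\<lambda>v. (l ^ a * cnj l ^ b) * (z v ^ a * cnj (z v) ^ b))"
      by (simp add: mixed_moment_def power_mult_distrib mult_ac)
    then show ?thesis using l(1) by (simp add: moment_cmul[OF N cz] mixed_moment_def)
  next
    assume "\<forall>v. w v = l * cnj (z v)"
    then have "mixed_moment N w a b = moment N (\<lambda>v. (l ^ a * cnj l ^ b) * cnj (z v ^ a * cnj (z v) ^ b))"
      by (simp add: mixed_moment_def power_mult_distrib mult_ac)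
    then show ?thesis
      using l(1) by (simp add: moment_cmul[OF N] moment_cnj[OF N cz] mixed_moment_def continuous_on_cnj cz
          del: complex_cnj_mult complex_cnj_power)
  qed
qed

lemma
  assumes N: "gauge_fun N" and A: "linear A" "inj A" and z: "conformal N z"
  shows conformal_comp: "conformal (\<lambda>v. N (A v)) (\<lambda>v. z (A v))"
    and mixed_moment_comp: "mixed_moment N z a b = \<bar>det (matrix A)\<bar> *\<^sub>R mixed_moment (\<lambda>v. N (A v)) (\<lambda>v. z (A v)) a b"
proof -
  have lz: "linear z" "inj z" "moment N (\<lambda>v. z v * z v) = 0" using z by (auto simp: conformal_def)
  note cz = continuous_on_linear_complex[OF lz(1)]
  have "det (matrix A) \<noteq> 0" using A det_nz_iff_inj by blast
  then have "moment (\<lambda>v. N (A v)) (\<lambda>v. z (A v) * z (A v)) = 0"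
    using moment_change[OF N A, of "\<lambda>v. z v * z v"] lz(3) cz by (simp add: continuous_on_mult)
  then show "conformal (\<lambda>v. N (A v)) (\<lambda>v. z (A v))"
    using linear_compose[OF A(1) lz(1)] inj_compose[OF lz(2) A(2)] by (simp add: conformal_def o_def)
  show "mixed_moment N z a b = \<bar>det (matrix A)\<bar> *\<^sub>R mixed_moment (\<lambda>v. N (A v)) (\<lambda>v. z (A v)) a b"
    unfolding mixed_moment_def by (rule moment_change[OF N A]) (intro continuous_intros cz)
qed

definition plane_complex :: "real^2 \<Rightarrow> complex" where
  "plane_complex v = Complex (v $ 1) (v $ 2)"

lemma linear_plane_complex: "linear plane_complex"
  by (rule linearI) (auto simp: plane_complex_def complex_eq_iff)

lemma inj_plane_complex: "inj plane_complex"
  by (rule injI) (auto simp: plane_complex_def vec_eq_iff forall_2)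

lemmas continuous_on_plane_complex [continuous_intros] = continuous_on_linear_complex[OF linear_plane_complex]

definition inertia :: "(real^2 \<Rightarrow> real) \<Rightarrow> real" where
  "inertia N = Re (moment N (\<lambda>v. plane_complex v * cnj (plane_complex v)))"

definition quadrupole :: "(real^2 \<Rightarrow> real) \<Rightarrow> complex" where
  "quadrupole N = moment N (\<lambda>v. plane_complex v * plane_complex v)"

text \<open>The coordinate \<open>w + \<mu> * cnj w\<close> has vanishing second moment iff \<open>Q + 2 \<mu> I + \<mu>\<^sup>2 cnj Q = 0\<close>, with
  \<open>Q\<close> the quadrupole and \<open>I\<close> the inertia; this is the root of modulus less than 1.\<close>

definition beltrami :: "(real^2 \<Rightarrow> real) \<Rightarrow> complex" where
  "beltrami N = - quadrupole N / of_real (inertia N + sqrt ((inertia N)\<^sup>2 - (cmod (quadrupole N))\<^sup>2))"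

definition conformal_coordinate :: "(real^2 \<Rightarrow> real) \<Rightarrow> real^2 \<Rightarrow> complex" where
  "conformal_coordinate N v = plane_complex v + beltrami N * cnj (plane_complex v)"

lemma inertia_pos: "gauge_fun N \<Longrightarrow> inertia N > 0"
  unfolding inertia_def by (rule moment_norm_square_pos[OF _ linear_plane_complex inj_plane_complex])

lemma moment_norm_square_inertia:
  assumes "gauge_fun N"
  shows "moment N (\<lambda>v. plane_complex v * cnj (plane_complex v)) = of_real (inertia N)"
proof -
  have "cnj (moment N (\<lambda>v. plane_complex v * cnj (plane_complex v))) = moment N (\<lambda>v. plane_complex v * cnj (plane_complex v))"
    by (subst moment_cnj[OF assms, symmetric]) (auto intro!: continuous_intros simp: mult.commute)
  then have "Im (moment N (\<lambda>v. plane_complex v * cnj (plane_complex v))) = 0" by (simp add: complex_eq_iff)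
  then show ?thesis by (simp add: inertia_def complex_eq_iff)
qed

text \<open>Choose a unit number \<open>s\<close> that turns the quadrupole into its modulus. With
  \<open>x = s * plane_complex v\<close>, the difference of inertia and modulus is the moment of
  \<open>x * cnj x - Re (x * x)\<close>, which is \<open>2 * (Im x)\<^sup>2\<close>, nonnegative and
  somewhere positive in the unit ball.\<close>

lemma quadrupole_less: 
  assumes N: "gauge_fun N"
  shows "cmod (quadrupole N) < inertia N"
proof -
  obtain s where s: "cmod s = 1" "s * s * quadrupole N = of_real (cmod (quadrupole N))"
  proof (cases "quadrupole N = 0")
    case False
    define s where "s = csqrt (cnj (quadrupole N) / of_real (cmod (quadrupole N)))"
    have "s * s = cnj (quadrupole N) / of_real (cmod (quadrupole N))"
      unfolding s_def by (simp flip: power2_eq_square)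
    moreover from this have "cmod s * cmod s = 1" using False by (simp flip: norm_mult add: norm_divide)
    then have "cmod s = 1" by (metis abs_norm_cancel power2_eq_1_iff power2_eq_square abs_1 abs_minus_cancel)
    moreover have "s * s * quadrupole N = of_real (cmod (quadrupole N))"
    proof -
      have "s * s * quadrupole N = of_real ((cmod (quadrupole N))\<^sup>2) / of_real (cmod (quadrupole N))"
        unfolding complex_norm_square calculation(1) by simp
      also have "\<dots> = of_real (cmod (quadrupole N))" by (simp add: power2_eq_square)
      finally show ?thesis .
    qed
    ultimately show ?thesis using that[of s] by blast
  qed (use that[of 1] in auto)
  define h where "h = (\<lambda>v. 2 * (Im (s * plane_complex v))\<^sup>2)"
  have eq: "complex_of_real (h v) = plane_complex v * cnj (plane_complex v) +
     (- (s * s) / 2 * (plane_complex v * plane_complex v) + cnj (- (s * s) / 2) * cnj (plane_complex v * plane_complex v))" for v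
  proof -
    define x where "x = s * plane_complex v"
    have "plane_complex v * cnj (plane_complex v) = x * cnj x"
    proof -
      have "s * cnj s = 1" using s(1) complex_norm_square[of s] by simp
      moreover have "x * cnj x = (s * cnj s) * (plane_complex v * cnj (plane_complex v))"
        by (simp add: x_def mult_ac)
      ultimately show ?thesis by simp
    qed
    moreover have "complex_of_real (2 * (Im x)\<^sup>2) = x * cnj x - x * x / 2 - cnj (x * x) / 2"
      by (simp add: complex_eq_iff power2_eq_square)
    ultimately show ?thesis by (simp add: h_def x_def algebra_simps)
  qed
  have "moment N (\<lambda>v. of_real (h v)) = moment N (\<lambda>v. plane_complex v * cnj (plane_complex v)) +
     (- (s * s) / 2 * quadrupole N + cnj (- (s * s) / 2) * cnj (quadrupole N))"
    unfolding eq quadrupole_def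
    using moment_combination[OF N, of "\<lambda>v. plane_complex v * cnj (plane_complex v)"
        "\<lambda>v. plane_complex v * plane_complex v" "\<lambda>v. plane_complex v * plane_complex v" 1]
    by (simp only: mult_1 continuous_intros)
  also have "\<dots> = of_real (inertia N) - of_real (cmod (quadrupole N)) / 2 - cnj (of_real (cmod (quadrupole N))) / 2"
    by (simp only: moment_norm_square_inertia[OF N] flip: s(2)) (simp add: algebra_simps)
  finally have m: "Re (moment N (\<lambda>v. of_real (h v))) = inertia N - cmod (quadrupole N)" by simp
  have "\<exists>v. Im (s * plane_complex v) \<noteq> 0"
  proof (rule ccontr)
    assume "\<not> ?thesis"
    then have "Im (s * plane_complex (vector [1, 0])) = 0" "Im (s * plane_complex (vector [0, 1])) = 0" by auto
    then have "s = 0" by (simp add: plane_complex_def complex_eq_iff)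
    then show False using s(1) by simp
  qed
  then obtain v where v: "Im (s * plane_complex v) \<noteq> 0" by blast
  then have "v \<noteq> 0" using linear_0[OF linear_plane_complex] by auto
  then obtain t where t: "t > 0" "N (t *\<^sub>R v) < 1" using gauge_small_vector[OF N] by blast
  have "Re (moment N (\<lambda>v. of_real (h v))) > 0"
  proof (rule moment_pos[OF N])
    show "continuous_on UNIV h" unfolding h_def by (intro continuous_intros)
    have "Im (s * plane_complex (t *\<^sub>R v)) = t * Im (s * plane_complex v)"
      by (simp add: linear_cmul[OF linear_plane_complex] algebra_simps)
    then show "h (t *\<^sub>R v) > 0" using v t(1) by (simp only: h_def) simp
  qed (use t in \<open>auto simp: h_def\<close>)
  then show ?thesis using m by simp
qed

text \<open>The denominator is at least the inertia, which exceeds the modulus of the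
  quadrupole.\<close>

lemma beltrami_less_1:
  assumes N: "gauge_fun N"
  shows "cmod (beltrami N) < 1"
proof -
  let ?s = "sqrt ((inertia N)\<^sup>2 - (cmod (quadrupole N))\<^sup>2)"
  have "?s \<ge> 0" using quadrupole_less[OF N] by (simp add: power_mono)
  then have "cmod (quadrupole N) < \<bar>inertia N + ?s\<bar>" using quadrupole_less[OF N] by linarith
  moreover have "cmod (beltrami N) = cmod (quadrupole N) / \<bar>inertia N + ?s\<bar>"
    unfolding beltrami_def norm_divide norm_of_real by simp
  ultimately show ?thesis by (simp add: divide_less_eq)
qed

text \<open>A kernel vector would satisfy
  \<open>plane_complex v = - beltrami N * cnj (plane_complex v)\<close>, which forces 0 as the
  coefficient has modulus below 1. With \<open>K = k + r\<close>, the second moment contains the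
  factor \<open>K\<^sup>2 - 2 * k * K + (cmod m)\<^sup>2 = r\<^sup>2 - k\<^sup>2 + (cmod
  m)\<^sup>2\<close>, which is 0 by the choice of \<open>r\<close>.\<close>

lemma conformal_conformal_coordinate:
  assumes N: "gauge_fun N"
  shows "conformal N (conformal_coordinate N)"
proof -
  let ?z = "conformal_coordinate N" and ?\<mu> = "beltrami N"
  have lin: "linear ?z"
    by (rule linearI) (simp_all add: conformal_coordinate_def linear_add[OF linear_plane_complex]
        linear_cmul[OF linear_plane_complex] algebra_simps)
  have "v = 0" if "?z v = 0" for v
  proof -
    have "?\<mu> * cnj (plane_complex v) = - plane_complex v"
      using that by (simp add: conformal_coordinate_def add_eq_0_iff)
    then have "cmod (plane_complex v) = cmod ?\<mu> * cmod (plane_complex v)"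
      by (metis complex_mod_cnj norm_minus_cancel norm_mult)
    then have "plane_complex v = 0" using beltrami_less_1[OF N] by simp
    then show "v = 0" using linear_injective_0[OF linear_plane_complex] inj_plane_complex by blast
  qed
  then have "inj ?z" using linear_injective_0[OF lin] by blast
  define m where "m = quadrupole N"
  define k where "k = inertia N"
  define r where "r = sqrt (k\<^sup>2 - (cmod m)\<^sup>2)"
  have mk: "cmod m < k" "k > 0" using quadrupole_less[OF N] inertia_pos[OF N] by (auto simp: m_def k_def)
  then have r: "r \<ge> 0" "r\<^sup>2 = k\<^sup>2 - (cmod m)\<^sup>2" unfolding r_def by (auto simp: power_mono)
  then have kr: "k + r \<noteq> 0" using mk by linarith
  have mu: "?\<mu> = - m / of_real (k + r)" by (simp add: beltrami_def m_def k_def r_def)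
  have "moment N (\<lambda>v. ?z v * ?z v) = moment N (\<lambda>v. plane_complex v * plane_complex v +
      (2 * ?\<mu> * (plane_complex v * cnj (plane_complex v)) + ?\<mu>\<^sup>2 * cnj (plane_complex v * plane_complex v)))"
    by (simp add: conformal_coordinate_def algebra_simps power2_eq_square)
  also have "\<dots> = m + (2 * ?\<mu> * of_real k + ?\<mu>\<^sup>2 * cnj m)"
    unfolding m_def k_def quadrupole_def moment_norm_square_inertia[OF N, symmetric]
    using moment_combination[OF N, of "\<lambda>v. plane_complex v * plane_complex v"
        "\<lambda>v. plane_complex v * cnj (plane_complex v)" "\<lambda>v. plane_complex v * plane_complex v" 1]
    by (simp only: mult_1 continuous_intros)
  also have "\<dots> = 0"
  proof -
    define K where "K = complex_of_real (k + r)"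
    have K: "K \<noteq> 0" "?\<mu> = - m / K" using kr mu unfolding K_def of_real_eq_0_iff by auto
    have "m + (2 * ?\<mu> * of_real k + ?\<mu>\<^sup>2 * cnj m) = m * (K\<^sup>2 - 2 * of_real k * K + m * cnj m) / K\<^sup>2"
      using K(1) by (simp add: K(2) field_simps power2_eq_square)
    also have "K\<^sup>2 - 2 * of_real k * K + m * cnj m = of_real ((k + r)\<^sup>2 - 2 * k * (k + r) + (cmod m)\<^sup>2)"
      unfolding K_def by (simp add: complex_norm_square[of m, symmetric])
    also have "(k + r)\<^sup>2 - 2 * k * (k + r) + (cmod m)\<^sup>2 = 0" using r(2) by (simp add: power2_eq_square algebra_simps)
    finally show ?thesis by simp
  qed
  finally show ?thesis using lin \<open>inj ?z\<close> by (simp add: conformal_def)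
qed

section \<open>Equivariance under rotations of the plane\<close>

definition rot :: "complex \<Rightarrow> real^2 \<Rightarrow> real^2" where
  "rot u v = vector [Re (u * plane_complex v), Im (u * plane_complex v)]"

lemma plane_complex_rot: "plane_complex (rot u v) = u * plane_complex v"
  by (simp add: rot_def plane_complex_def complex_eq_iff)

lemma linear_rot: "linear (rot u)"
  by (rule linearI) (simp_all add: rot_def vec_eq_iff forall_2 plane_complex_def algebra_simps)

lemma inj_rot: "u \<noteq> 0 \<Longrightarrow> inj (rot u)"
  by (rule injI) (metis plane_complex_rot inj_plane_complex injD mult_left_cancel)

lemma det_rot:
  assumes "cmod u = 1"
  shows "det (matrix (rot u)) = 1"
proof -
  have "(Re u)\<^sup>2 + (Im u)\<^sup>2 = 1" using assms by (simp add: cmod_def)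
  then show ?thesis
    by (simp add: det_2 matrix_def rot_def plane_complex_def axis_def power2_eq_square)
qed

lemma moment_rot:
  assumes "gauge_fun N" "cmod u = 1" "continuous_on UNIV f"
  shows "moment (\<lambda>v. N (rot u v)) (\<lambda>v. f (rot u v)) = moment N f"
proof -
  have "u \<noteq> 0" using assms(2) by auto
  then show ?thesis
    using moment_change[OF assms(1) linear_rot inj_rot assms(3), of u] det_rot[OF assms(2)] by simp
qed

text \<open>Composing \<open>N\<close> with \<open>rot u\<close> divides the quadrupole by
  \<open>u\<^sup>2\<close> and keeps the inertia, so \<open>beltrami\<close> is divided by
  \<open>u\<^sup>2\<close> too. The factor \<open>u ^ a * cnj u ^ b\<close> is \<open>u\<close> to
  the power \<open>a - b\<close>: the transformation law of a section of that power of the tangent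
  bundle.\<close>

lemma
  assumes N: "gauge_fun N" and u: "cmod u = 1"
  shows conformal_coordinate_rot:
      "u * conformal_coordinate (\<lambda>v. N (rot u v)) v = conformal_coordinate N (rot u v)"
    and mixed_moment_rot: "mixed_moment N (conformal_coordinate N) a b =
      u ^ a * cnj u ^ b * mixed_moment (\<lambda>v. N (rot u v)) (conformal_coordinate (\<lambda>v. N (rot u v))) a b"
proof -
  let ?N = "\<lambda>v. N (rot u v)"
  have u0: "u \<noteq> 0" and uu: "u * cnj u = 1" using u complex_norm_square[of u] by auto
  have N': "gauge_fun ?N" by (rule gauge_fun_comp[OF N linear_rot inj_rot[OF u0]])
  have "quadrupole N = moment ?N (\<lambda>v. (u * u) * (plane_complex v * plane_complex v))"
    unfolding quadrupole_def
    by (subst moment_rot[OF N u, symmetric]) (auto intro!: continuous_intros simp: plane_complex_rot mult_ac)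
  then have q: "quadrupole N = u * u * quadrupole ?N"
    by (simp add: moment_cmul[OF N'] quadrupole_def continuous_intros)
  have "moment N (\<lambda>v. plane_complex v * cnj (plane_complex v)) =
      moment ?N (\<lambda>v. (u * cnj u) * (plane_complex v * cnj (plane_complex v)))"
    by (subst moment_rot[OF N u, symmetric]) (auto intro!: continuous_intros simp: plane_complex_rot mult_ac)
  then have i: "inertia N = inertia ?N" by (simp add: inertia_def uu)
  have "cmod (quadrupole N) = cmod (quadrupole ?N)" unfolding q using u by (simp add: norm_mult)
  then have b: "beltrami N = u * u * beltrami ?N" unfolding beltrami_def i q by simp
  show cr: "u * conformal_coordinate ?N v = conformal_coordinate N (rot u v)" for v
    unfolding conformal_coordinate_def plane_complex_rot b using uu by (simp add: algebra_simps)
  have lz: "linear (conformal_coordinate M)" if "gauge_fun M" for M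
    using conformal_conformal_coordinate[OF that] by (simp add: conformal_def)
  have "mixed_moment N (conformal_coordinate N) a b = moment ?N (\<lambda>v. (u ^ a * cnj u ^ b) *
      (conformal_coordinate ?N v ^ a * cnj (conformal_coordinate ?N v) ^ b))"
    unfolding mixed_moment_def
    by (subst moment_rot[OF N u, symmetric])
      (auto intro!: continuous_intros continuous_on_linear_complex[OF lz[OF N]] simp flip: cr simp: power_mult_distrib mult_ac)
  then show "mixed_moment N (conformal_coordinate N) a b =
      u ^ a * cnj u ^ b * mixed_moment ?N (conformal_coordinate ?N) a b"
    by (simp add: mixed_moment_def moment_cmul[OF N'] continuous_intros continuous_on_linear_complex lz N')
qed

section \<open>Recovering a gauge from its moments\<close>

inductive zpoly :: "(real^2 \<Rightarrow> complex) \<Rightarrow> (real^2 \<Rightarrow> complex) \<Rightarrow> bool" for z where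
  monomial: "zpoly z (\<lambda>v. c * (z v ^ a * cnj (z v) ^ b))"
| add: "zpoly z f \<Longrightarrow> zpoly z g \<Longrightarrow> zpoly z (\<lambda>v. f v + g v)"

lemma zpoly_mult:
  assumes "zpoly z f" "zpoly z g"
  shows "zpoly z (\<lambda>v. f v * g v)"
  using assms(1)
proof induction
  case (monomial c a b)
  show ?case using assms(2)
  proof induction
    case (monomial c' a' b')
    then show ?case
      using zpoly.monomial[of z "c * c'" "a + a'" "b + b'"] by (simp add: power_add mult_ac)
  next
    case (add f g)
    then show ?case using zpoly.add by (simp add: distrib_left)
  qed
next
  case (add f1 f2)
  then show ?case using zpoly.add by (simp add: distrib_right)
qed

lemma zpoly_real_polynomial_function:
  assumes z: "linear z" "inj z" and f: "real_polynomial_function f"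
  shows "zpoly z (\<lambda>v. of_real (f v))"
  using f
proof induction
  case (linear f)
  then have "linear (\<lambda>v. complex_of_real (f v))"
    using linear_compose[OF bounded_linear.linear bounded_linear.linear[OF bounded_linear_of_real]] by (simp add: o_def)
  then obtain a b where "\<And>v. complex_of_real (f v) = a * z v + b * cnj (z v)"
    using real_linear_complex[OF z] by metis
  then show ?case using zpoly.add[OF zpoly.monomial[of z a 1 0] zpoly.monomial[of z b 0 1]] by simp
next
  case (const c)
  show ?case using zpoly.monomial[of z "of_real c" 0 0] by simp
next
  case (add f g)
  then show ?case using zpoly.add by simp
next
  case (mult f g)
  then show ?case using zpoly_mult by simp
qed

lemma continuous_on_zpoly:
  assumes "zpoly z f" "linear z"
  shows "continuous_on UNIV f"
  using assms(1) by induction (auto intro!: continuous_intros continuous_on_linear_complex[OF assms(2)])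

text \<open>The weight is 0 outside the unit ball and carries no information there, so
  \<open>v\<close> is first scaled to gauge 1/2.\<close>

lemma gauge_fun_eqI:
  assumes N: "gauge_fun N" and M: "gauge_fun M" and eq: "\<And>v. max 0 (1 - N v) = max 0 (1 - M v)"
  shows "N v = M v"
proof (cases "v = 0")
  case False
  define t where "t = 1 / (2 * N v)"
  have p: "N v > 0" using N False by (simp add: gauge_fun_def)
  then have t: "t > 0" by (simp add: t_def)
  have "N (t *\<^sub>R v) = 1 / 2" using gauge_fun_scale[OF N, of t v] t p by (simp add: t_def)
  moreover from this have "M (t *\<^sub>R v) = 1 / 2" using eq[of "t *\<^sub>R v"] by (simp add: max_def split: if_splits)
  ultimately have "t * N v = t * M v"
    using gauge_fun_scale[OF N, of t v] gauge_fun_scale[OF M, of t v] t by linarith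
  then show ?thesis using t mult_left_cancel[of t "N v" "M v"] by linarith
qed (simp add: gauge_fun_0 N M)

text \<open>Weierstrass approximation gives proportional weights; their common value 1 at the origin forces \<open>k = 1\<close>.\<close>

lemma gauge_fun_determined:
  assumes N: "gauge_fun N" and M: "gauge_fun M"
    and eq: "\<And>f. real_polynomial_function f \<Longrightarrow> moment N (\<lambda>v. of_real (f v)) = k *\<^sub>R moment M (\<lambda>v. of_real (f v))"
  shows "N v = M v"
proof -
  define D where "D v = max 0 (1 - N v) - k * max 0 (1 - M v)" for v
  obtain c1 where c1: "c1 > 0" "\<And>v. c1 * norm v \<le> N v" using gauge_fun_lower_bound[OF N] by blast
  obtain c2 where c2: "c2 > 0" "\<And>v. c2 * norm v \<le> M v" using gauge_fun_lower_bound[OF M] by blast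
  define c where "c = min c1 c2"
  have "c * norm v \<le> c1 * norm v" "c * norm v \<le> c2 * norm v" for v :: "real^2"
    by (simp_all add: c_def mult_right_mono)
  then have c: "c > 0" "\<And>v. c * norm v \<le> N v" "\<And>v. c * norm v \<le> M v"
    using c1(1) c2(1) order_trans[OF _ c1(2)] order_trans[OF _ c2(2)] by (auto simp: c_def)
  let ?a = "- (\<chi> i. 1 / c) :: real^2" and ?b = "(\<chi> i. 1 / c) :: real^2"
  have cD: "continuous_on A D" for A
    unfolding D_def using N M by (intro continuous_intros) (auto simp: gauge_fun_def intro: continuous_on_subset)
  have D0: "D v = 0" if "v \<notin> cbox ?a ?b" for v
    using weight_support[OF c(1,2) that] weight_support[OF c(1,3) that] by (simp add: D_def)
  have orth: "integral (cbox ?a ?b) (\<lambda>v. D v * f v) = 0" if f: "real_polynomial_function f" for f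
  proof -
    have cf: "continuous_on A f" for A using f by (simp add: continuous_on_polymonial_function real_polynomial_function_eq)
    have cf': "continuous_on UNIV (\<lambda>v. complex_of_real (f v))" by (intro continuous_intros cf)
    have r: "(\<lambda>v. max 0 (1 - N v) * f v) integrable_on UNIV \<and>
        Re (moment N (\<lambda>v. of_real (f v))) = integral UNIV (\<lambda>v. max 0 (1 - N v) * f v)" if N: "gauge_fun N" for N
      using integrable_linear[OF moment_integrable_on[OF N cf'] bounded_linear_Re]
        integral_linear[OF moment_integrable_on[OF N cf'] bounded_linear_Re]
      by (simp add: moment_def o_def)
    have "integral UNIV (\<lambda>v. D v * f v) =
      integral UNIV (\<lambda>v. max 0 (1 - N v) * f v - k *\<^sub>R (max 0 (1 - M v) * f v))"
      by (simp add: D_def algebra_simps)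
    also have "\<dots> = integral UNIV (\<lambda>v. max 0 (1 - N v) * f v) - k *\<^sub>R integral UNIV (\<lambda>v. max 0 (1 - M v) * f v)"
      using r[OF N] r[OF M] by (subst integral_diff) (auto intro: integrable_on_mult_right)
    also have "\<dots> = 0" using r[OF N] r[OF M] arg_cong[OF eq[OF f], of Re] by simp
    finally have "integral UNIV (\<lambda>v. D v * f v) = 0" .
    then show ?thesis
      by (subst integral_compact_support(2)[symmetric]) (auto intro!: continuous_intros cD cf simp: D0)
  qed
  have int: "(\<lambda>v. D v * f v) integrable_on cbox ?a ?b" if "continuous_on (cbox ?a ?b) f" for f
    by (intro integrable_continuous continuous_intros cD that)
  \<comment> \<open>\<open>D\<close> is orthogonal to a polynomial \<open>f\<close> that is
    \<open>d\<close>-close to \<open>D\<close>, so the integral of \<open>D * D\<close> equals that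
    of \<open>D * (D - f)\<close> and is at most \<open>d\<close> times the integral of the modulus
    of \<open>D\<close>.\<close>
  have "integral (cbox ?a ?b) (\<lambda>v. D v * D v) \<le> e" if e: "e > 0" for e
  proof -
    define K where "K = integral (cbox ?a ?b) (\<lambda>v. \<bar>D v\<bar>)"
    have iD: "(\<lambda>v. \<bar>D v\<bar>) integrable_on cbox ?a ?b" by (intro integrable_continuous continuous_intros cD)
    then have K: "K \<ge> 0" unfolding K_def by (intro integral_nonneg) auto
    define d where "d = e / (K + 1)"
    have d: "d > 0" "d * K \<le> e" using e K by (auto simp: d_def field_simps)
    obtain f where f: "real_polynomial_function f" "\<And>x. x \<in> cbox ?a ?b \<Longrightarrow> \<bar>D x - f x\<bar> < d"
      using Stone_Weierstrass_real_polynomial_function[OF compact_cbox cD d(1)] by metis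
    have cf: "continuous_on (cbox ?a ?b) f" using f(1) by (simp add: continuous_on_polymonial_function real_polynomial_function_eq)
    have "integral (cbox ?a ?b) (\<lambda>v. D v * D v) = integral (cbox ?a ?b) (\<lambda>v. D v * D v - D v * f v)"
      using orth[OF f(1)] int[OF cD] int[OF cf] by (simp add: integral_diff)
    also have "\<dots> \<le> integral (cbox ?a ?b) (\<lambda>v. d *\<^sub>R \<bar>D v\<bar>)"
    proof (rule integral_le)
      show "(\<lambda>v. D v * D v - D v * f v) integrable_on cbox ?a ?b"
        using int[OF cD] int[OF cf] by (rule integrable_diff)
      show "(\<lambda>v. d *\<^sub>R \<bar>D v\<bar>) integrable_on cbox ?a ?b" using iD by (rule integrable_cmul)
      fix x assume x: "x \<in> cbox ?a ?b"
      have "D x * D x - D x * f x \<le> \<bar>D x\<bar> * \<bar>D x - f x\<bar>"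
        by (simp flip: abs_mult right_diff_distrib)
      also have "\<dots> \<le> \<bar>D x\<bar> * d" using f(2)[OF x] by (intro mult_left_mono) auto
      finally show "D x * D x - D x * f x \<le> d *\<^sub>R \<bar>D x\<bar>" by (simp add: mult.commute)
    qed
    also have "\<dots> = d * K" by (simp add: K_def)
    finally show ?thesis using d(2) by linarith
  qed
  then have "integral (cbox ?a ?b) (\<lambda>v. D v * D v) \<le> 0"
    using field_le_epsilon[of "integral (cbox ?a ?b) (\<lambda>v. D v * D v)" 0] by simp
  moreover have "integral (cbox ?a ?b) (\<lambda>v. D v * D v) \<ge> 0" using int[OF cD] by (intro integral_nonneg) auto
  ultimately have z: "((\<lambda>v. D v * D v) has_integral 0) (cbox ?a ?b)"
    using int[OF cD] by (simp add: has_integral_integrable_integral)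
  have "0 \<in> box ?a ?b" using c by (simp add: mem_box_cart)
  then have ne: "box ?a ?b \<noteq> {}" by blast
  have cDD: "continuous_on (cbox ?a ?b) (\<lambda>v. D v * D v)" by (intro continuous_intros cD)
  have "D v * D v = 0" if "v \<in> cbox ?a ?b" for v
    by (rule has_integral_0_cbox_imp_0[OF cDD _ z ne that]) simp
  then have D: "D v = 0" for v using D0[of v] by (cases "v \<in> cbox ?a ?b") auto
  then have "k = 1" using D[of 0] gauge_fun_0[OF N] gauge_fun_0[OF M] by (simp add: D_def)
  then have "max 0 (1 - N v) = max 0 (1 - M v)" for v using D[of v] by (simp add: D_def)
  then show ?thesis by (rule gauge_fun_eqI[OF N M])
qed

text \<open>Only the moments with \<open>a = b\<close> survive, and these ignore a rotation of
  \<open>z\<close>. Hence all polynomial moments are rotation invariant, so \<open>N\<close> is, and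
  a rotation invariant gauge is a multiple of \<open>cmod z\<close>.\<close>

lemma round_if_mixed_moments_vanish:
  assumes N: "gauge_fun N" and z: "linear z" "inj z"
    and van: "\<And>a b. b < a \<Longrightarrow> mixed_moment N z a b = 0"
  obtains C where "C > 0" "\<And>v. N v = C * cmod (z v)"
proof -
  have van': "mixed_moment N z a b = 0" if "a \<noteq> b" for a b
  proof (cases "b < a")
    case False
    then have "mixed_moment N z b a = 0" using that by (intro van) simp
    moreover have "mixed_moment N z a b = cnj (mixed_moment N z b a)"
      unfolding mixed_moment_def
      by (subst moment_cnj[OF N, symmetric]) (auto intro!: continuous_intros continuous_on_linear_complex[OF z(1)] simp: mult.commute)
    ultimately show ?thesis by simp
  qed (rule van)
  obtain g where g: "linear g" "g \<circ> z = id" using linear_injective_left_inverse[OF z] by blast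
  have "dim (range z) = DIM(complex)"
    using dim_image_eq[OF z(1), of UNIV] z(2) by simp
  then have "span (range z) = UNIV" using dim_eq_full by blast
  then have "surj z" using subspace_UNIV linear_subspace_image[OF z(1)] span_eq_iff by metis
  have zg: "z (g x) = x" and gz: "g (z v) = v" for x v
    using g(2) \<open>surj z\<close> by (metis comp_apply id_apply surj_def)+
  have inv: "N (g (u * z v)) = N v" if u: "cmod u = 1" for u v
  proof -
    have u0: "u \<noteq> 0" and uu: "u * cnj u = 1" using u complex_norm_square[of u] by auto
    define A where "A = (\<lambda>v. g (u * z v))"
    have "linear (\<lambda>x. u * x)" using bounded_linear_mult_right bounded_linear.linear by blast
    then have A: "linear A"
      unfolding A_def using linear_compose[OF linear_compose[OF z(1)] g(1)] by (simp add: o_def)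
    have zA: "z (A v) = u * z v" for v by (simp add: A_def zg)
    have iA: "inj A" by (rule injI) (metis zA z(2) injD mult_left_cancel u0)
    have cA: "continuous_on UNIV A" using A by (simp add: linear_continuous_on linear_conv_bounded_linear)
    note N' = gauge_fun_comp[OF N A iA]
    have "moment N f = moment N (\<lambda>v. f (A v))" if "zpoly z f" for f
      using that
    proof induction
      case (monomial c a b)
      have cm: "continuous_on UNIV (\<lambda>v. z v ^ a * cnj (z v) ^ b)"
        by (intro continuous_intros continuous_on_linear_complex z)
      have "moment N (\<lambda>v. c * (z (A v) ^ a * cnj (z (A v)) ^ b)) = moment N (\<lambda>v. (c * (u ^ a * cnj u ^ b)) * (z v ^ a * cnj (z v) ^ b))"
        by (simp add: zA power_mult_distrib mult_ac)
      also have "\<dots> = c * (u ^ a * cnj u ^ b) * mixed_moment N z a b"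
        unfolding mixed_moment_def by (rule moment_cmul[OF N cm])
      \<comment> \<open>The factor \<open>u ^ a * cnj u ^ b\<close> is 1 if \<open>a = b\<close>;
        otherwise the mixed moment is 0.\<close>
      also have "\<dots> = c * mixed_moment N z a b"
        using van'[of a b] uu by (cases "a = b") (auto simp flip: power_mult_distrib)
      finally show ?case by (simp add: moment_cmul[OF N cm] mixed_moment_def)
    next
      case (add f h)
      have "continuous_on UNIV f" "continuous_on UNIV h" using add continuous_on_zpoly z by blast+
      moreover from this have "continuous_on UNIV (\<lambda>v. f (A v))" "continuous_on UNIV (\<lambda>v. h (A v))"
        using continuous_on_compose2[OF _ cA] by blast+
      ultimately show ?case using add by (simp add: moment_add[OF N])
    qed
    then have p: "moment N f = moment N (\<lambda>v. f (A v))" if "zpoly z f" for f using that .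
    \<comment> \<open>The inverse rotation: substituting \<open>B\<close> undoes the
      \<open>A\<close> inside the moment of \<open>f (A v)\<close> and moves the rotation to the
      gauge.\<close>
    define B where "B = (\<lambda>v. g (cnj u * z v))"
    have BA: "B (A v) = v" and AB: "A (B v) = v" for v
      using uu by (simp_all add: A_def B_def zg gz flip: mult.assoc) (simp add: mult.commute gz)
    have "linear (\<lambda>x. cnj u * x)" using bounded_linear_mult_right bounded_linear.linear by blast
    then have B: "linear B"
      unfolding B_def using linear_compose[OF linear_compose[OF z(1)] g(1)] by (simp add: o_def)
    have iB: "inj B" by (metis AB injI)
    have "N v = N (B v)" for v
    proof (rule gauge_fun_determined[OF N gauge_fun_comp[OF N B iB]])
      fix f :: "real^2 \<Rightarrow> real" assume f: "real_polynomial_function f"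
      have cf: "continuous_on UNIV f" using f by (simp add: continuous_on_polymonial_function real_polynomial_function_eq)
      have "moment N (\<lambda>v. of_real (f v)) = moment N (\<lambda>v. of_real (f (A v)))"
        by (rule p[OF zpoly_real_polynomial_function[OF z f]])
      also have "\<dots> = \<bar>det (matrix B)\<bar> *\<^sub>R moment (\<lambda>v. N (B v)) (\<lambda>v. of_real (f (A (B v))))"
        using continuous_on_compose2[OF cf cA] by (intro moment_change[OF N B iB]) (auto intro: continuous_intros)
      finally show "moment N (\<lambda>v. of_real (f v)) = \<bar>det (matrix B)\<bar> *\<^sub>R moment (\<lambda>v. N (B v)) (\<lambda>v. of_real (f v))"
        by (simp add: AB)
    qed
    from this[of "A v"] show ?thesis by (simp add: BA) (simp add: A_def)
  qed
  show ?thesis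
  proof
    have "g 1 \<noteq> 0" using zg[of 1] linear_0[OF z(1)] by auto
    then show "N (g 1) > 0" using N by (simp add: gauge_fun_def)
    show "N v = N (g 1) * cmod (z v)" for v
    proof (cases "z v = 0")
      case True
      then have "v = 0" using z linear_injective_0 by blast
      then show ?thesis using True gauge_fun_0[OF N] by simp
    next
      case False
      \<comment> \<open>This unit number turns \<open>z v\<close> onto the positive real axis, where
        \<open>N\<close> is known from its value at \<open>g 1\<close>.\<close>
      define u where "u = cnj (z v) / of_real (cmod (z v))"
      have "cmod u = 1" using False by (simp add: u_def norm_divide)
      moreover have "u * z v = cmod (z v) *\<^sub>R 1"
        using False complex_norm_square[of "z v"] by (simp add: u_def field_simps power2_eq_square scaleR_conv_of_real)
      ultimately have "N v = N (cmod (z v) *\<^sub>R g 1)" using inv[of u v] linear_cmul[OF g(1)] by simp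
      then show ?thesis using gauge_fun_scale[OF N, of "cmod (z v)" "g 1"] by simp
    qed
  qed
qed

subsection \<open>The spin cover of the frame bundle\<close>

text \<open>The uniform lower bound puts all supports into one box, so this is the continuity of a
  parameter integral over a fixed compact set.\<close>

lemma continuous_on_moment:
  fixes N :: "'q::topological_space \<Rightarrow> real^2 \<Rightarrow> real"
  assumes c: "c > 0" "\<And>q v. q \<in> S \<Longrightarrow> c * norm v \<le> N q v"
    and N: "continuous_on (S \<times> UNIV) (\<lambda>(q, v). N q v)"
    and f: "continuous_on (S \<times> UNIV) (\<lambda>(q, v). f q v)"
  shows "continuous_on S (\<lambda>q. moment (N q) (f q))"
proof -
  let ?C = "cbox (- (\<chi> i. 1 / c)) (\<chi> i. 1 / c) :: (real^2) set"
  define g where "g q v = max 0 (1 - N q v) *\<^sub>R f q v" for q v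
  have "continuous_on (S \<times> ?C) (\<lambda>z. N (fst z) (snd z))" "continuous_on (S \<times> ?C) (\<lambda>z. f (fst z) (snd z))"
    using N f by (auto simp: case_prod_beta intro: continuous_on_subset)
  then have "continuous_on (S \<times> ?C) (\<lambda>(q, v). g q v)"
    unfolding g_def case_prod_beta by (intro continuous_intros)
  then have "continuous_on S (\<lambda>q. integral ?C (g q))" by (rule integral_continuous_on_param)
  moreover have "moment (N q) (f q) = integral ?C (g q)" if "q \<in> S" for q
  proof -
    have "(\<lambda>v. max 0 (1 - N q v) *\<^sub>R f q v) = (\<lambda>v. if v \<in> ?C then g q v else 0)"
      using weight_support[of c "N q"] c that by (auto simp: g_def)
    then show ?thesis unfolding moment_def by (simp only: integral_restrict_UNIV)
  qed
  ultimately show ?thesis by (simp cong: continuous_on_cong)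
qed

lemma gauge_family_lower_bound:
  fixes N :: "'q::topological_space \<Rightarrow> real^2 \<Rightarrow> real"
  assumes S: "compact S" and N: "continuous_on (S \<times> UNIV) (\<lambda>(q, v). N q v)"
    and gauge: "\<And>q. q \<in> S \<Longrightarrow> gauge_fun (N q)"
  obtains c where "c > 0" "\<And>q v. q \<in> S \<Longrightarrow> c * norm v \<le> N q v"
proof (cases "S = {}")
  case False
  have "continuous_on (S \<times> sphere 0 1) (\<lambda>(q, v). N q v)"
    using N by (rule continuous_on_subset) auto
  moreover have "compact (S \<times> sphere (0 :: real^2) 1)" by (intro compact_Times S) auto
  moreover have "sphere (0 :: real^2) 1 \<noteq> {}" by simp
  moreover from this have "S \<times> sphere (0 :: real^2) 1 \<noteq> {}" using False by blast
  ultimately obtain z where z: "z \<in> S \<times> sphere 0 1"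
      "\<And>y. y \<in> S \<times> sphere 0 1 \<Longrightarrow> (\<lambda>(q, v). N q v) z \<le> (\<lambda>(q, v). N q v) y"
    using continuous_attains_inf[of "S \<times> sphere 0 1" "\<lambda>(q, v). N q v"] by blast
  obtain q0 v0 where qv: "z = (q0, v0)" by (cases z)
  have qv0: "q0 \<in> S" "norm v0 = 1" and least: "N q0 v0 \<le> N q v" if "q \<in> S" "norm v = 1" for q v
    using z(1) z(2)[of "(q, v)"] that by (auto simp: qv)
  obtain q where q: "q \<in> S" using False by blast
  note qv0 = qv0[OF q norm_axis_1]
  show ?thesis
  proof
    show "N q0 v0 > 0" using gauge[OF qv0(1)] qv0(2) unfolding gauge_fun_def by (metis norm_zero zero_neq_one)
    fix q v assume q: "q \<in> S"
    show "N q0 v0 * norm v \<le> N q v"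
    proof (cases "v = 0")
      case False
      then have "N q0 v0 \<le> N q (v /\<^sub>R norm v)" by (intro least q) simp
      also have "\<dots> = N q v / norm v" using gauge_fun_scale[OF gauge[OF q], of "inverse (norm v)" v] by (simp add: divide_inverse)
      finally show ?thesis using False by (simp add: field_simps)
    qed (simp add: gauge_fun_0[OF gauge[OF q]])
  qed
qed (use that[of 1] in auto)

text \<open>Inertia and quadrupole are continuous in the parameter, and the denominator of
  \<open>beltrami\<close> is positive; so the explicit coordinate, and with it the mixed moment, is
  continuous.\<close>

lemma continuous_on_mixed_moment:
  fixes N :: "'q::topological_space \<Rightarrow> real^2 \<Rightarrow> real"
  assumes S: "compact S" and N: "continuous_on (S \<times> UNIV) (\<lambda>(q, v). N q v)"
    and gauge: "\<And>q. q \<in> S \<Longrightarrow> gauge_fun (N q)"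
  shows "continuous_on S (\<lambda>q. mixed_moment (N q) (conformal_coordinate (N q)) a b)"
proof -
  obtain c where c: "c > 0" "\<And>q v. q \<in> S \<Longrightarrow> c * norm v \<le> N q v"
    using gauge_family_lower_bound[OF assms] by blast
  note cm = continuous_on_moment[OF c N]
  have cp: "continuous_on (S \<times> UNIV) (\<lambda>z. plane_complex (snd z))"
    using continuous_on_compose2[OF continuous_on_plane_complex[of UNIV], of "S \<times> UNIV" snd]
    by (simp add: continuous_on_snd continuous_on_id)
  have I: "continuous_on S (\<lambda>q. inertia (N q))"
    unfolding inertia_def by (intro continuous_intros cm) (auto simp: case_prod_beta intro!: continuous_intros cp)
  have Q: "continuous_on S (\<lambda>q. quadrupole (N q))"
    unfolding quadrupole_def by (intro cm) (auto simp: case_prod_beta intro!: continuous_intros cp)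
  have nz: "complex_of_real (inertia (N q) + sqrt ((inertia (N q))\<^sup>2 - (cmod (quadrupole (N q)))\<^sup>2)) \<noteq> 0" if "q \<in> S" for q
  proof -
    have "sqrt ((inertia (N q))\<^sup>2 - (cmod (quadrupole (N q)))\<^sup>2) \<ge> 0"
      using quadrupole_less[OF gauge[OF that]] by (simp add: power_mono)
    then show ?thesis using inertia_pos[OF gauge[OF that]] unfolding of_real_eq_0_iff by linarith
  qed
  have B: "continuous_on S (\<lambda>q. beltrami (N q))"
    unfolding beltrami_def by (intro continuous_intros I Q) (use nz in blast)
  have B': "continuous_on (S \<times> (UNIV :: (real^2) set)) (\<lambda>z. beltrami (N (fst z)))"
    by (rule continuous_on_compose2[OF B]) (auto intro: continuous_intros)
  show ?thesis
    unfolding mixed_moment_def conformal_coordinate_def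
    by (intro cm) (auto simp: case_prod_beta intro!: continuous_intros cp B')
qed

text \<open>Let \<open>f = exp h\<close>. On the circle of points \<open>(cis t, 0)\<close> the
  function \<open>h - i m t\<close> has constant exponential, so its values lie at least 2 pi apart
  or coincide, and by continuity it is constant. Comparing \<open>t = 0\<close> with
  \<open>t = 2 * pi\<close> gives \<open>m = 0\<close>.\<close>

lemma no_equivariant_nonzero_function:
  fixes f :: "complex \<times> complex \<Rightarrow> complex" and m :: real
  assumes cf: "continuous_on (sphere 0 1) f" and nz: "\<And>q. q \<in> sphere 0 1 \<Longrightarrow> f q \<noteq> 0"
    and eq: "\<And>q t. q \<in> sphere 0 1 \<Longrightarrow> f (cis t * fst q, cis t * snd q) = cis (m * t) * f q"
  shows "m = 0"
proof -
  have "Borsukian (sphere (0 :: complex \<times> complex) 1)"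
    by (rule Borsukian_sphere) simp
  then obtain h where h: "continuous_on (sphere 0 1) h" "\<And>q. q \<in> sphere 0 1 \<Longrightarrow> f q = exp (h q)"
    using cf nz Borsukian_continuous_logarithm[THEN iffD1, rule_format, of "sphere 0 1" f] by blast
  define c where "c t = (cis t, 0 :: complex)" for t
  have c: "c t \<in> sphere 0 1" for t by (simp add: c_def norm_Pair)
  define u where "u t = h (c t) - \<i> * of_real (m * t)" for t
  have "continuous_on UNIV c" unfolding c_def by (intro continuous_intros)
  then have "continuous_on UNIV (\<lambda>t. h (c t))"
    using continuous_on_compose2[OF h(1)] c by blast
  then have cu: "continuous_on UNIV u" unfolding u_def by (intro continuous_intros)
  have eu: "exp (u t) = f (c 0)" for t
  proof -
    have "f (c t) = cis (m * t) * f (c 0)" using eq[OF c[of 0], of t] by (simp add: c_def)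
    then show ?thesis using h(2)[OF c[of t]] by (simp add: u_def exp_diff cis_conv_exp)
  qed
  have sep: "2 * pi \<le> norm (u s - u t)" if "u s \<noteq> u t" for s t
  proof -
    obtain n :: int where n: "u s = u t + (of_int (2 * n) * pi) * \<i>"
      using eu[of s] eu[of t] exp_eq[of "u s" "u t"] by auto
    then have "n \<noteq> 0" using that by auto
    then have "1 \<le> \<bar>real_of_int n\<bar>" by linarith
    moreover have "norm (u s - u t) = 2 * pi * \<bar>real_of_int n\<bar>"
      unfolding n by (simp add: norm_mult abs_mult)
    ultimately show ?thesis by simp
  qed
  have "u constant_on UNIV"
  proof (rule continuous_discrete_range_constant[OF connected_UNIV cu])
    show "\<exists>e>0. \<forall>y. y \<in> UNIV \<and> u y \<noteq> u x \<longrightarrow> e \<le> norm (u y - u x)" for x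
      using sep by (intro exI[of _ "2 * pi"]) auto
  qed
  then have "u (2 * pi) = u 0" by (metis UNIV_I constant_on_def)
  moreover have "c (2 * pi) = c 0" by (simp add: c_def)
  ultimately show ?thesis by (simp add: u_def)
qed

text \<open>A spinor \<open>(x, y)\<close> yields the isotropic vector \<open>(x\<^sup>2 - y\<^sup>2, i (x\<^sup>2 + y\<^sup>2), - 2 x y)\<close> of \<open>\<complex>\<^sup>3\<close>,
  whose real and imaginary parts form an orthonormal pair. This is the double cover of \<open>SO(3)\<close> by
  the 3-sphere, on which every nonvanishing function has a logarithm.\<close>

definition spin_e :: "complex \<times> complex \<Rightarrow> real^3" where
  "spin_e q = (case q of (x, y) \<Rightarrow> vector [Re (x\<^sup>2 - y\<^sup>2), Re (\<i> * (x\<^sup>2 + y\<^sup>2)), Re (- 2 * x * y)])"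

definition spin_f :: "complex \<times> complex \<Rightarrow> real^3" where
  "spin_f q = (case q of (x, y) \<Rightarrow> vector [Im (x\<^sup>2 - y\<^sup>2), Im (\<i> * (x\<^sup>2 + y\<^sup>2)), Im (- 2 * x * y)])"

text \<open>The point of the sphere at which \<open>spin_e q\<close> and \<open>spin_f q\<close>
  form an orthonormal tangent frame.\<close>

definition spin_p :: "complex \<times> complex \<Rightarrow> real^3" where
  "spin_p q = cross3 (spin_e q) (spin_f q)"

lemma inner_vector_3: "(x :: real^3) \<bullet> y = x $ 1 * y $ 1 + x $ 2 * y $ 2 + x $ 3 * y $ 3"
  by (simp add: inner_vec_def sum_3)

text \<open>Isotropy makes real and imaginary part orthogonal and equally long, and the squared
  Hermitian length is twice the fourth power of \<open>norm q\<close>. In real coordinates these are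
  polynomial identities.\<close>

lemma spin_orthonormal:
  assumes "q \<in> sphere 0 1"
  shows "spin_e q \<bullet> spin_e q = 1" "spin_f q \<bullet> spin_f q = 1" "spin_e q \<bullet> spin_f q = 0"
proof -
  obtain a b c d where q: "q = (Complex a b, Complex c d)" by (metis complex.exhaust prod.exhaust)
  have "norm q ^ 2 = 1" using assms by simp
  then have n: "a\<^sup>2 + b\<^sup>2 + c\<^sup>2 + d\<^sup>2 = 1" by (simp add: q norm_Pair cmod_def)
  have "spin_e q \<bullet> spin_e q = (a\<^sup>2 + b\<^sup>2 + c\<^sup>2 + d\<^sup>2)\<^sup>2"
    by (simp add: spin_e_def q inner_vector_3 power2_eq_square algebra_simps)
  then show "spin_e q \<bullet> spin_e q = 1" by (simp add: n)
  have "spin_f q \<bullet> spin_f q = (a\<^sup>2 + b\<^sup>2 + c\<^sup>2 + d\<^sup>2)\<^sup>2"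
    by (simp add: spin_f_def q inner_vector_3 power2_eq_square algebra_simps)
  then show "spin_f q \<bullet> spin_f q = 1" by (simp add: n)
  show "spin_e q \<bullet> spin_f q = 0"
    by (simp add: spin_e_def spin_f_def q inner_vector_3 power2_eq_square algebra_simps)
qed

lemma spin_p_sphere:
  assumes "q \<in> sphere 0 1"
  shows "spin_p q \<in> sphere 0 1" "spin_p q \<bullet> spin_e q = 0" "spin_p q \<bullet> spin_f q = 0"
proof -
  have "(norm (spin_p q))\<^sup>2 = 1"
    using norm_cross_dot[of "spin_e q" "spin_f q"] spin_orthonormal[OF assms]
    by (simp add: spin_p_def norm_eq_1[symmetric])
  then show "spin_p q \<in> sphere 0 1" by (simp add: power2_eq_1_iff) (smt (verit) norm_ge_zero)
qed (simp_all add: spin_p_def dot_cross_self)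

text \<open>The isotropic vector is homogeneous quadratic in the spinor, so the phase
  \<open>cis t\<close> multiplies it by \<open>cis (2 * t)\<close>: the frame turns at double
  speed.\<close>

lemma spin_phase:
  "spin_e (cis t * x, cis t * y) = cos (2 * t) *\<^sub>R spin_e (x, y) - sin (2 * t) *\<^sub>R spin_f (x, y)" (is ?e)
  "spin_f (cis t * x, cis t * y) = sin (2 * t) *\<^sub>R spin_e (x, y) + cos (2 * t) *\<^sub>R spin_f (x, y)" (is ?f)
proof -
  have "(cis t)\<^sup>2 = cis (2 * t)" by (simp add: power2_eq_square cis_mult)
  then have sq: "(cis t * z)\<^sup>2 = cis (2 * t) * z\<^sup>2" for z by (simp add: power_mult_distrib)
  have xy: "- 2 * (cis t * x) * (cis t * y) = cis (2 * t) * (- 2 * x * y)"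
    using sq[of 1] by (simp add: power2_eq_square mult_ac)
  have 1: "(cis t * x)\<^sup>2 - (cis t * y)\<^sup>2 = cis (2 * t) * (x\<^sup>2 - y\<^sup>2)" 
    "\<i> * ((cis t * x)\<^sup>2 + (cis t * y)\<^sup>2) = cis (2 * t) * (\<i> * (x\<^sup>2 + y\<^sup>2))"
    unfolding sq by (simp_all add: algebra_simps)
  have 2: "(vector [Re (cis s * w1), Re (cis s * w2), Re (cis s * w3)] :: real^3) =
      cos s *\<^sub>R vector [Re w1, Re w2, Re w3] - sin s *\<^sub>R vector [Im w1, Im w2, Im w3]"
    "(vector [Im (cis s * w1), Im (cis s * w2), Im (cis s * w3)] :: real^3) =
      sin s *\<^sub>R vector [Re w1, Re w2, Re w3] + cos s *\<^sub>R vector [Im w1, Im w2, Im w3]" for s w1 w2 w3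
    by (simp_all add: vec_eq_iff forall_3)
  show ?e ?f unfolding spin_e_def spin_f_def case_prod_conv 1 xy 2 by simp_all
qed

lemma spin_p_phase: "spin_p (cis t * x, cis t * y) = spin_p (x, y)"
proof -
  have "cross3 (c *\<^sub>R e - s *\<^sub>R f) (s *\<^sub>R e + c *\<^sub>R f) = (c\<^sup>2 + s\<^sup>2) *\<^sub>R cross3 e f" for c s e f
    by (simp add: cross3_def vec_eq_iff forall_3 power2_eq_square algebra_simps)
  then show ?thesis unfolding spin_p_def spin_phase by simp
qed

lemma continuous_on_spin:
  "continuous_on A spin_e" "continuous_on A spin_f" "continuous_on A spin_p"
proof -
  have v: "(vector [a, b, c] :: real^3) = a *\<^sub>R axis 1 1 + b *\<^sub>R axis 2 1 + c *\<^sub>R axis 3 1" for a b c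
    by (simp add: vec_eq_iff forall_3 axis_def)
  show *: "continuous_on A spin_e" "continuous_on A spin_f" for A
    unfolding spin_e_def[abs_def] spin_f_def[abs_def] case_prod_beta v by (intro continuous_intros)+
  show "continuous_on A spin_p" unfolding spin_p_def[abs_def]
    by (intro continuous_on_cross *)
qed

text \<open>In the frame \<open>spin_e\<close>, \<open>spin_f\<close> the mixed moment is a
  continuous function on the 3-sphere of nonzero weight \<open>2 * (a - b)\<close> under phases, so
  it must have a zero.\<close>

lemma spin_mixed_moment_vanishes:
  fixes F :: "(real^3) \<times> (real^3) \<Rightarrow> real"
  defines "N \<equiv> \<lambda>q v. \<bar>F (spin_p q, (v $ 1) *\<^sub>R spin_e q + (v $ 2) *\<^sub>R spin_f q)\<bar>"
  assumes F: "continuous_on {(p, v). p \<in> sphere 0 1 \<and> p \<bullet> v = 0} F"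
    and gauge: "\<And>q. q \<in> sphere 0 1 \<Longrightarrow> gauge_fun (N q)" and ab: "b < a"
  obtains q where "q \<in> sphere 0 1" "mixed_moment (N q) (conformal_coordinate (N q)) a b = 0"
proof -
  let ?S = "sphere (0 :: complex \<times> complex) 1"
  define f where "f q = mixed_moment (N q) (conformal_coordinate (N q)) a b" for q
  have cN: "continuous_on (?S \<times> UNIV) (\<lambda>(q, v). N q v)"
  proof -
    have *: "continuous_on (?S \<times> (UNIV :: (real^2) set)) (\<lambda>z. g (fst z))" if "\<And>A. continuous_on A g"
      for g :: "complex \<times> complex \<Rightarrow> real^3"
      using that[of ?S] by (rule continuous_on_compose2) (auto intro: continuous_intros)
    have "continuous_on (?S \<times> (UNIV :: (real^2) set))
       (\<lambda>z. F (spin_p (fst z), (snd z $ 1) *\<^sub>R spin_e (fst z) + (snd z $ 2) *\<^sub>R spin_f (fst z)))"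
      using spin_p_sphere
      by (intro continuous_on_compose2[OF F] continuous_intros * continuous_on_spin) (auto simp: inner_add_right)
    then show ?thesis unfolding N_def case_prod_beta by (intro continuous_intros)
  qed
  have cf: "continuous_on ?S f"
    unfolding f_def by (rule continuous_on_mixed_moment[OF compact_sphere cN gauge])
  have eq: "f (cis t * fst q, cis t * snd q) = cis ((2 * (real a - real b)) * t) * f q" if q: "q \<in> ?S" for q t
  proof -
    \<comment> \<open>A vector with coordinates \<open>v\<close> in the turned frame has coordinates
      \<open>rot ?u v\<close> in the original one, so the gauges differ by this rotation.\<close>
    let ?q = "(cis t * fst q, cis t * snd q)" and ?u = "cis (- 2 * t)"
    have "N ?q v = N q (rot ?u v)" for v
      unfolding N_def spin_p_phase spin_phase
      by (simp add: rot_def plane_complex_def algebra_simps)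
    then have "N ?q = (\<lambda>v. N q (rot ?u v))" by blast
    then have "f q = ?u ^ a * cnj ?u ^ b * f ?q"
      unfolding f_def using mixed_moment_rot[OF gauge[OF q], of ?u a b] by simp
    moreover have "?u ^ a * cnj ?u ^ b = cis (- ((2 * (real a - real b)) * t))"
      by (simp add: Complex.DeMoivre cis_mult cis_cnj algebra_simps)
    ultimately show ?thesis by (simp add: cis_mult flip: mult.assoc)
  qed
  have "\<exists>q\<in>?S. f q = 0"
  proof (rule ccontr)
    assume "\<not> ?thesis"
    then have "2 * (real a - real b) = 0"
      by (intro no_equivariant_nonzero_function[OF cf _ eq]) auto
    then show False using ab by simp
  qed
  then show ?thesis using that f_def by auto
qed

text \<open>Both \<open>conformal_coordinate N\<close> composed with \<open>A\<close> and the
  coordinate built from the composed gauge are conformal for the latter. Uniqueness compares them,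
  and the substitution contributes a nonzero determinant.\<close>

lemma mixed_moment_comp_iff:
  assumes N: "gauge_fun N" and A: "linear A" "inj A"
  shows "mixed_moment (\<lambda>v. N (A v)) (conformal_coordinate (\<lambda>v. N (A v))) a b = 0 \<longleftrightarrow>
    mixed_moment N (conformal_coordinate N) a b = 0"
proof -
  note z = conformal_conformal_coordinate[OF N] and N' = gauge_fun_comp[OF N A]
  have "det (matrix A) \<noteq> 0" using A det_nz_iff_inj by blast
  then show ?thesis
    using mixed_moment_comp[OF N A z, of a b]
      mixed_moment_unique[OF N' conformal_comp[OF N A z] conformal_conformal_coordinate[OF N'], of a b]
    by simp
qed

subsection \<open>Finsler metrics on the sphere\<close>

abbreviation S2 :: "(real^3) set" where "S2 \<equiv> sphere 0 1"

lemma tangent_space_S2: "p \<in> S2 \<Longrightarrow> tangent_space S2 p = {v. p \<bullet> v = 0}"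
  by (rule tangent_space_sphere) auto

lemma tangent_bundle_S2: "tangent_bundle S2 = {(p, v). p \<in> S2 \<and> p \<bullet> v = 0}"
  unfolding tangent_bundle_def using tangent_space_S2 by auto

definition frame_at :: "real^3 \<Rightarrow> (real^2 \<Rightarrow> real^3) \<Rightarrow> bool" where
  "frame_at p L \<longleftrightarrow> linear L \<and> inj L \<and> (\<forall>v. p \<bullet> L v = 0)"

text \<open>Along with \<open>F\<close>, also \<open>- F\<close> satisfies
  \<open>finsler_metric\<close>, so positivity is enforced by the absolute value.\<close>

definition fibre_gauge :: "((real^3) \<times> (real^3) \<Rightarrow> real) \<Rightarrow> real^3 \<Rightarrow> (real^2 \<Rightarrow> real^3) \<Rightarrow> real^2 \<Rightarrow> real" where
  "fibre_gauge F p L v = \<bar>F (p, L v)\<bar>"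

definition fibre_moment :: "((real^3) \<times> (real^3) \<Rightarrow> real) \<Rightarrow> real^3 \<Rightarrow> (real^2 \<Rightarrow> real^3) \<Rightarrow> nat \<Rightarrow> nat \<Rightarrow> complex" where
  "fibre_moment F p L = mixed_moment (fibre_gauge F p L) (conformal_coordinate (fibre_gauge F p L))"

lemma linear_span_pair: "linear (\<lambda>v :: real^2. (v $ 1) *\<^sub>R e + (v $ 2) *\<^sub>R (f :: 'a::real_vector))"
  by (rule linearI) (simp_all add: algebra_simps)

lemma frame_at_orthonormal:
  assumes "e \<bullet> e = 1" "f \<bullet> f = 1" "e \<bullet> f = 0" "p \<bullet> e = 0" "p \<bullet> f = 0"
  shows "frame_at p (\<lambda>v. (v $ 1) *\<^sub>R e + (v $ 2) *\<^sub>R f)"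
proof -
  have "v = 0" if "(v $ 1) *\<^sub>R e + (v $ 2) *\<^sub>R f = 0" for v :: "real^2"
  proof -
    have "((v $ 1) *\<^sub>R e + (v $ 2) *\<^sub>R f) \<bullet> e = 0" "((v $ 1) *\<^sub>R e + (v $ 2) *\<^sub>R f) \<bullet> f = 0" using that by auto
    then show "v = 0" using assms by (simp add: inner_add_left inner_add_right inner_commute vec_eq_iff forall_2)
  qed
  then have "inj (\<lambda>v :: real^2. (v $ 1) *\<^sub>R e + (v $ 2) *\<^sub>R f)"
    using linear_injective_0[OF linear_span_pair] by blast
  then show ?thesis using assms by (simp add: frame_at_def linear_span_pair inner_add_right)
qed

lemma orthonormal_tangent_pair:
  assumes "p \<in> S2"
  obtains e f :: "real^3" where "e \<bullet> e = 1" "f \<bullet> f = 1" "e \<bullet> f = 0" "p \<bullet> e = 0" "p \<bullet> f = 0"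
proof -
  have np: "norm p = 1" using assms by simp
  obtain y :: "real^3" where y: "y \<noteq> 0" "orthogonal p y"
    using orthogonal_to_vector_exists[of p] by auto
  define e where "e = y /\<^sub>R norm y"
  have e: "norm e = 1" "p \<bullet> e = 0" using y by (simp_all add: e_def orthogonal_def)
  have "(norm (cross3 p e))\<^sup>2 = 1" using norm_cross_dot[of p e] e np by simp
  then have "cross3 p e \<bullet> cross3 p e = 1" by (simp add: dot_square_norm)
  then show ?thesis
    using that[of e "cross3 p e"] e by (simp add: dot_cross_self norm_eq_1)
qed

text \<open>By dimension the range of \<open>L\<close> is the whole tangent plane, so
  \<open>K\<close> followed by a left inverse of \<open>L\<close> is the change of frame.\<close>

lemma frame_at_factor:
  assumes p: "p \<in> S2" and L: "frame_at p L" and K: "frame_at p K"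
  obtains A where "linear A" "inj A" "\<And>v. K v = L (A v)"
proof -
  have lL: "linear L" "inj L" and lK: "linear K" "inj K" using L K by (auto simp: frame_at_def)
  obtain g where g: "linear g" "g \<circ> L = id" using linear_injective_left_inverse[OF lL] by blast
  have "p \<noteq> 0" using p by auto
  have "range L = {v. p \<bullet> v = 0}"
  proof (rule subspace_dim_equal)
    show "subspace (range L)" using linear_subspace_image[OF lL(1) subspace_UNIV] .
    show "subspace {v. p \<bullet> v = 0}" by (rule subspace_hyperplane)
    show "range L \<subseteq> {v. p \<bullet> v = 0}" using L by (auto simp: frame_at_def)
    have "dim (range L) = 2" using dim_image_eq[OF lL(1), of UNIV] lL(2) by simp
    then show "dim {v. p \<bullet> v = 0} \<le> dim (range L)" using dim_hyperplane[OF \<open>p \<noteq> 0\<close>] by simp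
  qed
  then have "K v \<in> range L" for v using K by (auto simp: frame_at_def)
  then have *: "K v = L (g (K v))" for v using g(2) by (metis comp_apply id_apply imageE)
  show ?thesis
  proof
    show "linear (\<lambda>v. g (K v))" using linear_compose[OF lK(1) g(1)] by (simp add: o_def)
    show "inj (\<lambda>v. g (K v))"
    proof (rule injI)
      fix v w assume "g (K v) = g (K w)"
      then have "K v = K w" using *[of v] *[of w] by simp
      then show "v = w" using lK(2) by (rule injD[rotated])
    qed
  qed (rule *)
qed

text \<open>A nonzero \<open>y\<close> is completed to a frame, which factors through
  \<open>L\<close>.\<close>

lemma frame_at_surj:
  assumes p: "p \<in> S2" and L: "frame_at p L" and y: "p \<bullet> y = 0"
  obtains v where "y = L v"
proof -
  obtain e f :: "real^3" where ef: "e \<bullet> e = 1" "f \<bullet> f = 1" "e \<bullet> f = 0" "p \<bullet> e = 0" "p \<bullet> f = 0"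
    using orthonormal_tangent_pair[OF p] by blast
  show ?thesis
  proof (cases "y = 0")
    case True
    then show ?thesis using that[of 0] L by (simp add: frame_at_def linear_0)
  next
    case False
    define e where "e = y /\<^sub>R norm y"
    have e: "norm e = 1" "p \<bullet> e = 0" using False y by (simp_all add: e_def)
    have "(norm (cross3 p e))\<^sup>2 = 1" using norm_cross_dot[of p e] e p by simp
    then have "frame_at p (\<lambda>v. (v $ 1) *\<^sub>R e + (v $ 2) *\<^sub>R cross3 p e)"
      using e by (intro frame_at_orthonormal) (auto simp: dot_cross_self dot_square_norm norm_eq_1)
    then obtain A :: "real^2 \<Rightarrow> real^2" where A: "\<And>v. (v $ 1) *\<^sub>R e + (v $ 2) *\<^sub>R cross3 p e = L (A v)"
      by (rule frame_at_factor[OF p L]) (rule that)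
    have "y = L (A (norm y *\<^sub>R axis 1 1))"
      using False by (simp add: A[symmetric] axis_def e_def)
    then show ?thesis by (rule that)
  qed
qed

section \<open>Fibre moments of a Finsler metric on the sphere\<close>

locale finsler_sphere =
  fixes F :: "(real^3) \<times> (real^3) \<Rightarrow> real"
  assumes finsler: "finsler_metric S2 F"
begin

lemma F_cont: "continuous_on {(p, v). p \<in> S2 \<and> p \<bullet> v = 0} F"
  using finsler by (simp add: finsler_metric_def tangent_bundle_S2)

lemma F_homogeneous: "p \<in> S2 \<Longrightarrow> p \<bullet> v = 0 \<Longrightarrow> t > 0 \<Longrightarrow> F (p, t *\<^sub>R v) = t * F (p, v)"
  using finsler by (auto simp: finsler_metric_def tangent_bundle_S2)

lemma F_zero: "p \<in> S2 \<Longrightarrow> F (p, 0) = 0"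
  using F_homogeneous[of p 0 2] by simp

text \<open>If \<open>F (p, y)\<close> were 0, homogeneity would make \<open>F\<close> vanish on the
  ray through \<open>y\<close>, and the Hessian at \<open>y\<close> in the direction
  \<open>y\<close> would be 0, against positive definiteness.\<close>

lemma F_nonzero:
  assumes p: "p \<in> S2" and y: "p \<bullet> y = 0" "y \<noteq> 0"
  shows "F (p, y) \<noteq> 0"
proof
  assume F0: "F (p, y) = 0"
  let ?T = "{v. p \<bullet> v = 0}"
  have "independent {y}" using y(2) by simp
  then obtain B where B: "{y} \<subseteq> B" "B \<subseteq> ?T" "independent B" "?T \<subseteq> span B"
    using maximal_independent_subset_extend[of "{y}" ?T] y(1) by auto
  have "span B = ?T"
    using B(2,4) span_minimal[OF B(2) subspace_hyperplane] by blast
  then have spB: "span B = tangent_space S2 p" using tangent_space_S2[OF p] by simp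
  \<comment> \<open>Positive definiteness is formulated for coefficients over a basis; these pick
    out the diagonal entry at \<open>y\<close>.\<close>
  define a where "a u = (if u = y then 1 else 0 :: real)" for u
  have "(p, y) \<in> tangent_bundle S2" using p y by (simp add: tangent_bundle_S2)
  moreover have "\<exists>u\<in>B. a u \<noteq> 0" using B(1) by (auto simp: a_def)
  ultimately have "(\<Sum>u\<in>B. \<Sum>w\<in>B. a u * a w * fundamental_tensor F p y u w) > 0"
    using finsler B(3) spB y(2) unfolding finsler_metric_def by blast
  moreover have "(\<Sum>u\<in>B. \<Sum>w\<in>B. a u * a w * fundamental_tensor F p y u w) = fundamental_tensor F p y y y"
  proof -
    have fin: "finite B" using B(3) independent_imp_finite by blast
    have "a u * a w * fundamental_tensor F p y u w = (if w = y then if u = y then fundamental_tensor F p y y y else 0 else 0)" for u w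
      by (simp add: a_def)
    then show ?thesis using fin B(1) by (simp add: sum.delta)
  qed
  moreover have "fundamental_tensor F p y y y = 0"
  proof -
    \<comment> \<open>The argument is \<open>(1 + s + t) *\<^sub>R y\<close>. Homogeneity needs a
      positive factor, so the derivatives below are taken of functions known only near 0.\<close>
    have z: "F (p, y + s *\<^sub>R y + t *\<^sub>R y) = 0" if "1 + s + t > 0" for s t
      using F_homogeneous[OF p y(1) that] F0 by (simp add: algebra_simps)
    have d: "deriv (\<lambda>t. (F (p, y + s *\<^sub>R y + t *\<^sub>R y))\<^sup>2 / 2) 0 = 0" if s: "s > -1" for s
    proof -
      have "eventually (\<lambda>t. t \<in> {- 1 - s<..}) (nhds 0)" using s by (intro eventually_nhds_in_open) auto
      then have "eventually (\<lambda>t. (F (p, y + s *\<^sub>R y + t *\<^sub>R y))\<^sup>2 / 2 = 0) (nhds 0)"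
        by eventually_elim (simp add: z)
      then have "deriv (\<lambda>t. (F (p, y + s *\<^sub>R y + t *\<^sub>R y))\<^sup>2 / 2) 0 = deriv (\<lambda>t. 0) 0"
        by (rule deriv_cong_ev) simp
      then show ?thesis by simp
    qed
    have "eventually (\<lambda>s. s \<in> {- 1<..}) (nhds (0 :: real))" by (intro eventually_nhds_in_open) auto
    then have "eventually (\<lambda>s. deriv (\<lambda>t. (F (p, y + s *\<^sub>R y + t *\<^sub>R y))\<^sup>2 / 2) 0 = 0) (nhds 0)"
      by eventually_elim (simp add: d)
    then have "fundamental_tensor F p y y y = deriv (\<lambda>s. 0) 0"
      unfolding fundamental_tensor_def by (rule deriv_cong_ev) simp
    then show ?thesis by simp
  qed
  ultimately show False by simp
qed

lemma gauge_fun_fibre_gauge: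
  assumes p: "p \<in> S2" and L: "frame_at p L"
  shows "gauge_fun (fibre_gauge F p L)"
proof -
  have lL: "linear L" "inj L" "\<And>v. p \<bullet> L v = 0" using L by (auto simp: frame_at_def)
  have "continuous_on UNIV L" using lL(1) by (simp add: linear_continuous_on linear_conv_bounded_linear)
  then have "continuous_on UNIV (\<lambda>v. F (p, L v))"
    using p lL(3) by (intro continuous_on_compose2[OF F_cont]) (auto intro!: continuous_intros)
  then have "continuous_on UNIV (fibre_gauge F p L)"
    unfolding fibre_gauge_def[abs_def] by (intro continuous_intros)
  moreover have "L v \<noteq> 0" if "v \<noteq> 0" for v using lL that linear_injective_0 by blast
  ultimately show ?thesis
    using F_homogeneous[OF p lL(3)] F_nonzero[OF p lL(3)]
    by (auto simp: gauge_fun_def fibre_gauge_def linear_cmul[OF lL(1)] abs_mult)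
qed

lemma fibre_moment_frame_indep:
  assumes p: "p \<in> S2" and L: "frame_at p L" and K: "frame_at p K"
  shows "fibre_moment F p L a b = 0 \<longleftrightarrow> fibre_moment F p K a b = 0"
proof -
  obtain A where A: "linear A" "inj A" "\<And>v. K v = L (A v)" using frame_at_factor[OF assms] by blast
  then have "fibre_gauge F p K = (\<lambda>v. fibre_gauge F p L (A v))" by (auto simp: fibre_gauge_def)
  then show ?thesis
    unfolding fibre_moment_def using mixed_moment_comp_iff[OF gauge_fun_fibre_gauge[OF p L] A(1,2)] by simp
qed

text \<open>A property of the point alone: by \<open>fibre_moment_frame_indep\<close> one frame
  speaks for all.\<close>

definition vanishing :: "nat \<Rightarrow> nat \<Rightarrow> real^3 \<Rightarrow> bool" where
  "vanishing a b p \<longleftrightarrow> (\<exists>L. frame_at p L \<and> fibre_moment F p L a b = 0)"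

lemma vanishing_iff: "p \<in> S2 \<Longrightarrow> frame_at p L \<Longrightarrow> vanishing a b p \<longleftrightarrow> fibre_moment F p L a b = 0"
  unfolding vanishing_def using fibre_moment_frame_indep by blast

lemma vanishing_somewhere:
  assumes "b < a"
  obtains p where "p \<in> S2" "vanishing a b p"
proof -
  let ?L = "\<lambda>q v. (v $ 1) *\<^sub>R spin_e q + (v $ 2) *\<^sub>R spin_f q"
  have fr: "frame_at (spin_p q) (?L q)" if "q \<in> sphere 0 1" for q
    using spin_orthonormal[OF that] spin_p_sphere[OF that] by (intro frame_at_orthonormal)
  have g: "gauge_fun (\<lambda>v. \<bar>F (spin_p q, ?L q v)\<bar>)" if "q \<in> sphere 0 1" for q
    using gauge_fun_fibre_gauge[OF spin_p_sphere(1)[OF that] fr[OF that]] by (simp add: fibre_gauge_def[abs_def])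
  obtain q where q: "q \<in> sphere 0 1" "mixed_moment (\<lambda>v. \<bar>F (spin_p q, ?L q v)\<bar>)
      (conformal_coordinate (\<lambda>v. \<bar>F (spin_p q, ?L q v)\<bar>)) a b = 0"
    using spin_mixed_moment_vanishes[OF F_cont g assms] by blast
  show ?thesis
  proof
    show "spin_p q \<in> S2" by (rule spin_p_sphere(1)[OF q(1)])
    show "vanishing a b (spin_p q)"
      unfolding vanishing_def using fr[OF q(1)] q(2)
      by (intro exI[of _ "?L q"]) (simp add: fibre_moment_def fibre_gauge_def[abs_def])
  qed
qed

text \<open>Parallel transport carries a frame at \<open>c t0\<close> to one at \<open>c t\<close>
  on which the local Berwald metric \<open>F'\<close> has the same values. Back in terms of
  \<open>F\<close>, the two fibre gauges agree up to the ratio of the conformal factors.\<close>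

lemma vanishing_locally_constant:
  assumes lcb: "locally_conformally_berwald S2 F"
    and pw: "p \<bullet> p = 1" "w \<bullet> w = 1" "p \<bullet> w = 0"
  obtains d where "d > 0" "\<And>t. \<bar>t - t0\<bar> < d \<Longrightarrow> vanishing a b (great_circle p w t) \<longleftrightarrow> vanishing a b (great_circle p w t0)"
proof -
  let ?c = "great_circle p w"
  have cs: "?c t \<in> S2" for t
    using pw by (simp add: norm_eq_1 great_circle_def inner_add_left inner_add_right inner_commute flip: power2_eq_square)
  obtain U F' where U: "openin (top_of_set S2) U" "?c t0 \<in> U" and F': "conformally_equivalent U F F'" "berwald U F'"
    using lcb cs[of t0] unfolding locally_conformally_berwald_def by blast
  obtain nabla where nabla: "linear_connection U nabla" "compatible U F' nabla"
    using F'(2) unfolding berwald_def by blast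
  obtain \<alpha> where \<alpha>: "\<And>q v. q \<in> U \<Longrightarrow> q \<bullet> v = 0 \<Longrightarrow> F' (q, v) = exp (\<alpha> q) * F (q, v)"
    using F'(1) tangent_space_sphere[OF U(1)] unfolding conformally_equivalent_def tangent_bundle_def by fastforce
  interpret sphere_connection U nabla by unfold_locales (fact U(1) nabla(1))+
  obtain d where d: "d > 0" "\<And>t. \<bar>t - t0\<bar> < d \<Longrightarrow> ?c t \<in> U"
    and iso: "\<And>u1 u2. ?c t0 \<bullet> u1 = 0 \<Longrightarrow> ?c t0 \<bullet> u2 = 0 \<Longrightarrow>
      \<exists>V1 V2. \<forall>t. \<bar>t - t0\<bar> < d \<longrightarrow> ?c t \<bullet> V1 t = 0 \<and> ?c t \<bullet> V2 t = 0 \<and>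
        (\<forall>r s. F' (?c t, r *\<^sub>R V1 t + s *\<^sub>R V2 t) = F' (?c t0, r *\<^sub>R u1 + s *\<^sub>R u2))"
    using local_isometries[OF pw U(2) nabla(2)] by blast
  obtain e f where ef: "e \<bullet> e = 1" "f \<bullet> f = 1" "e \<bullet> f = 0" "?c t0 \<bullet> e = 0" "?c t0 \<bullet> f = 0"
    using orthonormal_tangent_pair[OF cs[of t0]] by blast
  define L0 where "L0 v = (v $ 1) *\<^sub>R e + (v $ 2) *\<^sub>R f" for v :: "real^2"
  have L0: "frame_at (?c t0) L0" unfolding L0_def[abs_def] by (rule frame_at_orthonormal[OF ef])
  obtain V1 V2 where V: "\<And>t. \<bar>t - t0\<bar> < d \<Longrightarrow> ?c t \<bullet> V1 t = 0 \<and> ?c t \<bullet> V2 t = 0 \<and>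
        (\<forall>r s. F' (?c t, r *\<^sub>R V1 t + s *\<^sub>R V2 t) = F' (?c t0, r *\<^sub>R e + s *\<^sub>R f))"
    using iso[OF ef(4,5)] by blast
  have "vanishing a b (?c t) \<longleftrightarrow> vanishing a b (?c t0)" if t: "\<bar>t - t0\<bar> < d" for t
  proof -
    define L where "L v = (v $ 1) *\<^sub>R V1 t + (v $ 2) *\<^sub>R V2 t" for v :: "real^2"
    have tan: "?c t \<bullet> L v = 0" for v using V[OF t] by (simp add: L_def inner_add_right)
    have tan0: "?c t0 \<bullet> L0 v = 0" for v using L0 by (simp add: frame_at_def)
    have "F' (?c t, L v) = F' (?c t0, L0 v)" for v using V[OF t] by (simp add: L_def L0_def)
    then have "exp (\<alpha> (?c t)) * F (?c t, L v) = exp (\<alpha> (?c t0)) * F (?c t0, L0 v)" for v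
      using \<alpha>[OF d(2)[OF t] tan] \<alpha>[OF U(2) tan0] by metis
    then have e: "F (?c t, L v) = exp (\<alpha> (?c t0) - \<alpha> (?c t)) * F (?c t0, L0 v)" for v
      by (simp add: exp_diff field_simps)
    \<comment> \<open>Injectivity of the transported frame follows from the preservation of length:
      only zero vectors have length 0.\<close>
    have "v = 0" if "L v = 0" for v
    proof -
      have "F (?c t0, L0 v) = 0" using e[of v] that F_zero[OF cs] by simp
      then have "L0 v = 0" using F_nonzero[OF cs tan0] by blast
      then show "v = 0" using L0 linear_injective_0 unfolding frame_at_def by blast
    qed
    moreover have lL: "linear L" unfolding L_def[abs_def] by (rule linear_span_pair)
    ultimately have L: "frame_at (?c t) L"
      using linear_injective_0[OF lL] tan by (simp add: frame_at_def)
    \<comment> \<open>By homogeneity the conformal ratio acts as a dilation of the plane, that is,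
      as another linear change of frame.\<close>
    define r where "r = exp (\<alpha> (?c t0) - \<alpha> (?c t))"
    have r: "r > 0" by (simp add: r_def)
    have "fibre_gauge F (?c t) L v = fibre_gauge F (?c t0) L0 (r *\<^sub>R v)" for v
      using gauge_fun_scale[OF gauge_fun_fibre_gauge[OF cs L0], of r v] r
      by (simp add: fibre_gauge_def e abs_mult r_def[symmetric])
    then have "fibre_gauge F (?c t) L = (\<lambda>v. fibre_gauge F (?c t0) L0 (r *\<^sub>R v))" by blast
    then have "fibre_moment F (?c t) L a b = 0 \<longleftrightarrow> fibre_moment F (?c t0) L0 a b = 0"
      unfolding fibre_moment_def
      using mixed_moment_comp_iff[OF gauge_fun_fibre_gauge[OF cs L0], of "\<lambda>v. r *\<^sub>R v" a b] r
      by (simp add: linear_scale_self inj_on_def)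
    then show ?thesis using vanishing_iff[OF cs L] vanishing_iff[OF cs L0] by simp
  qed
  then show ?thesis using that d(1) by blast
qed

lemma great_circle_through:
  assumes p: "p \<in> S2" and q: "q \<in> S2"
  obtains w t where "w \<bullet> w = 1" "p \<bullet> w = 0" "great_circle p w t = q"
proof -
  have pp: "p \<bullet> p = 1" "q \<bullet> q = 1" using p q by (auto simp: norm_eq_1)
  define u where "u = q - (p \<bullet> q) *\<^sub>R p"
  have pu: "p \<bullet> u = 0" using pp by (simp add: u_def inner_diff_right)
  obtain e f :: "real^3" where ef: "e \<bullet> e = 1" "p \<bullet> e = 0" using orthonormal_tangent_pair[OF p] by metis
  \<comment> \<open>If \<open>q\<close> is \<open>p\<close> or its antipode, every great circle
    through \<open>p\<close> meets \<open>q\<close> and any unit tangent vector serves.\<close>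
  define w where "w = (if u = 0 then e else u /\<^sub>R norm u)"
  have w: "w \<bullet> w = 1" "p \<bullet> w = 0"
    using ef pu by (auto simp: w_def dot_square_norm power2_eq_square)
  have q': "q = (p \<bullet> q) *\<^sub>R p + norm u *\<^sub>R w" by (auto simp: w_def u_def)
  have "q \<bullet> q = (p \<bullet> q)\<^sup>2 + (norm u)\<^sup>2"
    using w pp(1) by (subst (1 2) q') (simp add: inner_add_left inner_add_right inner_commute power2_eq_square)
  then obtain t where "p \<bullet> q = cos t" "norm u = sin t"
    using sincos_total_2pi[of "p \<bullet> q" "norm u"] pp(2) by metis
  then show ?thesis using that[OF w, of t] q' by (simp add: great_circle_def)
qed

text \<open>Along a great circle through \<open>p\<close> and \<open>q\<close>, the parameters with
  the property form a set that is open with open complement; the line is connected.\<close>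

lemma vanishing_constant:
  assumes lcb: "locally_conformally_berwald S2 F" and p: "p \<in> S2" and q: "q \<in> S2"
    and v: "vanishing a b p"
  shows "vanishing a b q"
proof -
  obtain w t where w: "w \<bullet> w = 1" "p \<bullet> w = 0" "great_circle p w t = q"
    using great_circle_through[OF p q] by blast
  have pp: "p \<bullet> p = 1" using p by (simp add: norm_eq_1)
  define A where "A = {t. vanishing a b (great_circle p w t)}"
  have loc: "\<exists>d>0. \<forall>t. \<bar>t - t0\<bar> < d \<longrightarrow> (t \<in> A \<longleftrightarrow> t0 \<in> A)" for t0
    using vanishing_locally_constant[OF lcb pp w(1,2), of t0 a b] unfolding A_def by (metis mem_Collect_eq)
  have "open A" unfolding open_dist dist_real_def using loc by metis
  moreover have "open (- A)" unfolding open_dist dist_real_def using loc by (metis Compl_iff)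
  moreover have "0 \<in> A" using v by (simp add: A_def great_circle_def)
  ultimately have "A = UNIV" using clopen[of A] by (auto simp: closed_def)
  then show ?thesis using w(3) by (auto simp: A_def)
qed

text \<open>The gauge is \<open>C\<close> times the modulus of its conformal coordinate, so
  \<open>B\<close> is this multiple of the coordinate after a left inverse of the frame, defined on
  all of \<open>real^3\<close>.\<close>

lemma fibre_quadratic:
  assumes p: "p \<in> S2" and van: "\<And>a b. b < a \<Longrightarrow> vanishing a b p"
  obtains B :: "real^3 \<Rightarrow> complex" where "linear B" "\<And>y. p \<bullet> y = 0 \<Longrightarrow> (F (p, y))\<^sup>2 = B y \<bullet> B y"
proof -
  obtain e f :: "real^3" where ef: "e \<bullet> e = 1" "f \<bullet> f = 1" "e \<bullet> f = 0" "p \<bullet> e = 0" "p \<bullet> f = 0"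
    using orthonormal_tangent_pair[OF p] by blast
  define L where "L v = (v $ 1) *\<^sub>R e + (v $ 2) *\<^sub>R f" for v :: "real^2"
  have L: "frame_at p L" unfolding L_def[abs_def] by (rule frame_at_orthonormal[OF ef])
  let ?N = "fibre_gauge F p L"
  have N: "gauge_fun ?N" by (rule gauge_fun_fibre_gauge[OF p L])
  have z: "linear (conformal_coordinate ?N)" "inj (conformal_coordinate ?N)"
    using conformal_conformal_coordinate[OF N] by (auto simp: conformal_def)
  have "mixed_moment ?N (conformal_coordinate ?N) a b = 0" if "b < a" for a b
    using van[OF that] vanishing_iff[OF p L] by (simp add: fibre_moment_def)
  then obtain C where C: "C > 0" "\<And>v. ?N v = C * cmod (conformal_coordinate ?N v)"
    using round_if_mixed_moments_vanish[OF N z] by blast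
  have lL: "linear L" "inj L" using L by (auto simp: frame_at_def)
  obtain g where g: "linear g" "g \<circ> L = id" using linear_injective_left_inverse[OF lL] by blast
  show ?thesis
  proof
    show "linear (\<lambda>y. C *\<^sub>R conformal_coordinate ?N (g y))"
      using linear_compose_scale_right[OF linear_compose[OF g(1) z(1)], of C] by (simp add: o_def)
    fix y assume "p \<bullet> y = 0"
    then obtain v where v: "y = L v" using frame_at_surj[OF p L] by blast
    then have "g y = v" using g(2) by (metis comp_apply id_apply)
    have "(F (p, y))\<^sup>2 = (?N v)\<^sup>2" by (simp add: fibre_gauge_def v)
    also have "\<dots> = (C * cmod (conformal_coordinate ?N v))\<^sup>2" by (rule arg_cong[OF C(2)])
    also have "\<dots> = (C *\<^sub>R conformal_coordinate ?N (g y)) \<bullet> (C *\<^sub>R conformal_coordinate ?N (g y))"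
      unfolding \<open>g y = v\<close> by (simp add: power_mult_distrib flip: power2_norm_eq_inner)
    finally show "(F (p, y))\<^sup>2 = (C *\<^sub>R conformal_coordinate ?N (g y)) \<bullet> (C *\<^sub>R conformal_coordinate ?N (g y))" .
  qed
qed

section \<open>Construction of the Riemannian metric\<close>

lemma smooth_on_locally:
  assumes "\<And>x. x \<in> M \<Longrightarrow> \<exists>T. open T \<and> x \<in> T \<and> smooth_on (M \<inter> T) f"
  shows "smooth_on M f"
  unfolding smooth_on_def
proof
  fix x assume x: "x \<in> M"
  then obtain T where T: "open T" "x \<in> T" "smooth_on (M \<inter> T) f" using assms by blast
  then have "x \<in> M \<inter> T" using x by blast
  then obtain W g where g: "open W" "x \<in> W" "\<And>k. C_k_on k W g" "\<And>y. y \<in> W \<inter> (M \<inter> T) \<Longrightarrow> g y = f y"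
    by (rule smooth_onE[OF T(3)]) (rule that)
  have "C_k_on k (W \<inter> T) g" for k by (rule C_k_on_subset[OF g(3)]) blast
  then show "\<exists>W g. open W \<and> x \<in> W \<and> (\<forall>k. C_k_on k W g) \<and> (\<forall>y\<in>W \<inter> M. g y = f y)"
    using T(1,2) g(1,2,4) by (intro exI[of _ "W \<inter> T"] exI[of _ g] conjI allI ballI) auto
qed

lemma vector_fields_S2: "X \<in> vector_fields S2 \<longleftrightarrow> smooth_on S2 X \<and> (\<forall>q\<in>S2. q \<bullet> X q = 0)"
  unfolding vector_fields_def using tangent_space_S2 by auto

lemma smooth_F_nonvanishing_field:
  assumes X: "smooth_on A X" "A \<subseteq> S2" "\<And>q. q \<in> A \<Longrightarrow> q \<bullet> X q = 0 \<and> X q \<noteq> 0"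
  shows "smooth_on A (\<lambda>q. (F (q, X q))\<^sup>2)"
proof -
  have "smooth_on {(p, v) \<in> tangent_bundle S2. v \<noteq> 0} F"
    using finsler by (simp add: finsler_metric_def)
  then have "smooth_on A (\<lambda>q. F (q, X q))"
    using X(2,3) by (intro smooth_on_compose[OF smooth_on_Pair[OF smooth_on_ident X(1)]])
      (auto simp: tangent_bundle_S2)
  then show ?thesis unfolding power2_eq_square by (intro smooth_on_mult)
qed

text \<open>\<open>F\<^sup>2\<close> is only known to be smooth off the zero section, so \<open>F\<^sup>2(X)\<close> is expressed near a zero of
  \<open>X\<close> by the parallelogram law through the nonvanishing fields \<open>X + Z\<close>, \<open>X - Z\<close> and \<open>Z\<close>.\<close>

lemma smooth_F_field:
  assumes quad: "\<And>q u v. q \<in> S2 \<Longrightarrow> q \<bullet> u = 0 \<Longrightarrow> q \<bullet> v = 0 \<Longrightarrow>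
      (F (q, u + v))\<^sup>2 + (F (q, u - v))\<^sup>2 = 2 * (F (q, u))\<^sup>2 + 2 * (F (q, v))\<^sup>2"
    and X: "X \<in> vector_fields S2"
  shows "smooth_on S2 (\<lambda>q. (F (q, X q))\<^sup>2)"
proof (rule smooth_on_locally)
  fix p :: "real^3" assume p: "p \<in> S2"
  obtain e f :: "real^3" where ef: "e \<bullet> e = 1" "p \<bullet> e = 0"
    using orthonormal_tangent_pair[OF p] by metis
  \<comment> \<open>A vector longer than \<open>X p\<close>, so that \<open>Z\<close>,
    \<open>X + Z\<close> and \<open>X - Z\<close> are nonzero at \<open>p\<close> and by continuity
    nearby.\<close>
  define b where "b = (norm (X p) + 1) *\<^sub>R e"
  have nb: "norm b = norm (X p) + 1" using ef by (simp add: b_def norm_eq_1)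
  define Z where "Z = tangential b"
  have Zp: "Z p = b" using ef by (simp add: Z_def tangential_def b_def inner_commute)
  have sX: "smooth_on S2 X" "\<And>q. q \<in> S2 \<Longrightarrow> q \<bullet> X q = 0" using X by (auto simp: vector_fields_S2)
  have sZ: "smooth_on S2 Z"
    unfolding Z_def tangential_def[abs_def] by (intro smooth_intros)
  have tZ: "q \<bullet> Z q = 0" if "q \<in> S2" for q
  proof -
    have "q \<bullet> q = 1" using that by (simp add: norm_eq_1)
    then show ?thesis by (simp add: Z_def tangential_def inner_diff_right inner_commute)
  qed
  have nz: "Z p \<noteq> 0" "X p + Z p \<noteq> 0" "X p - Z p \<noteq> 0"
    using nb norm_ge_zero[of "X p"] unfolding Zp by (auto simp: add_eq_0_iff simp del: norm_ge_zero)
  have cont: "continuous_on S2 Z" "continuous_on S2 (\<lambda>q. X q + Z q)" "continuous_on S2 (\<lambda>q. X q - Z q)"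
    using smooth_on_continuous[OF sX(1)] smooth_on_continuous[OF sZ] by (auto intro!: continuous_intros)
  have ex: "\<exists>T. open T \<and> p \<in> T \<and> (\<forall>q\<in>S2 \<inter> T. Y q \<noteq> 0)" if "continuous_on S2 Y" "Y p \<noteq> 0" for Y :: "real^3 \<Rightarrow> real^3"
  proof -
    have "openin (top_of_set S2) (S2 \<inter> Y -` (- {0}))"
      using that(1) by (intro continuous_openin_preimage_gen) auto
    then obtain T where "open T" "S2 \<inter> Y -` (- {0}) = S2 \<inter> T" by (auto simp: openin_open)
    then show ?thesis using p that(2) by (intro exI[of _ T]) blast
  qed
  obtain T1 where T1: "open T1" "p \<in> T1" "\<forall>q\<in>S2 \<inter> T1. Z q \<noteq> 0" using ex[OF cont(1) nz(1)] by blast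
  obtain T2 where T2: "open T2" "p \<in> T2" "\<forall>q\<in>S2 \<inter> T2. X q + Z q \<noteq> 0" using ex[OF cont(2) nz(2)] by blast
  obtain T3 where T3: "open T3" "p \<in> T3" "\<forall>q\<in>S2 \<inter> T3. X q - Z q \<noteq> 0" using ex[OF cont(3) nz(3)] by blast
  let ?T = "T1 \<inter> T2 \<inter> T3" and ?A = "S2 \<inter> (T1 \<inter> T2 \<inter> T3)"
  have s: "smooth_on ?A X" "smooth_on ?A Z" using sX(1) sZ smooth_on_subset by blast+
  have "smooth_on ?A (\<lambda>q. (F (q, Z q))\<^sup>2)"
    using tZ T1(3) by (intro smooth_F_nonvanishing_field s) auto
  moreover have "smooth_on ?A (\<lambda>q. (F (q, X q + Z q))\<^sup>2)"
    using tZ sX(2) T2(3) by (intro smooth_F_nonvanishing_field smooth_on_add s) (auto simp: inner_add_right)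
  moreover have "smooth_on ?A (\<lambda>q. (F (q, X q - Z q))\<^sup>2)"
    using tZ sX(2) T3(3) by (intro smooth_F_nonvanishing_field smooth_on_diff s) (auto simp: inner_diff_right)
  ultimately have "smooth_on ?A (\<lambda>q. (1/2) * ((F (q, X q + Z q))\<^sup>2 + (F (q, X q - Z q))\<^sup>2) - (F (q, Z q))\<^sup>2)"
    by (intro smooth_intros)
  moreover have "(1/2) * ((F (q, X q + Z q))\<^sup>2 + (F (q, X q - Z q))\<^sup>2) - (F (q, Z q))\<^sup>2 = (F (q, X q))\<^sup>2" if "q \<in> ?A" for q
    using quad[of q "X q" "Z q"] sX(2)[of q] tZ[of q] that by (simp add: field_simps)
  ultimately have "smooth_on ?A (\<lambda>q. (F (q, X q))\<^sup>2)"
    by (subst smooth_on_cong) auto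
  then show "\<exists>T. open T \<and> p \<in> T \<and> smooth_on (S2 \<inter> T) (\<lambda>q. (F (q, X q))\<^sup>2)"
    using T1 T2 T3 by (intro exI[of _ ?T]) blast
qed

text \<open>Polarisation of \<open>F\<^sup>2\<close> yields \<open>\<gamma>\<close>. It is bilinear
  because on each fibre \<open>F\<^sup>2\<close> is the squared norm of a linear map, and smooth
  because \<open>smooth_F_field\<close> applies to the sum and the difference of two fields.\<close>

lemma riemannian_if_vanishing:
  assumes van: "\<And>p a b. p \<in> S2 \<Longrightarrow> b < a \<Longrightarrow> vanishing a b p"
  shows "riemannian S2 F"
proof -
  define \<gamma> where "\<gamma> p u v = ((F (p, u + v))\<^sup>2 - (F (p, u - v))\<^sup>2) / 4" for p u v
  have B: "\<exists>B :: real^3 \<Rightarrow> complex. linear B \<and> (\<forall>y. p \<bullet> y = 0 \<longrightarrow> (F (p, y))\<^sup>2 = B y \<bullet> B y)" if "p \<in> S2" for p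
    using fibre_quadratic[OF that van[OF that]] by metis
  have g: "\<exists>B :: real^3 \<Rightarrow> complex. linear B \<and> (\<forall>u v. p \<bullet> u = 0 \<longrightarrow> p \<bullet> v = 0 \<longrightarrow> \<gamma> p u v = B u \<bullet> B v)"
    if p: "p \<in> S2" for p
  proof -
    obtain B :: "real^3 \<Rightarrow> complex" where B: "linear B" "\<And>y. p \<bullet> y = 0 \<Longrightarrow> (F (p, y))\<^sup>2 = B y \<bullet> B y"
      using B[OF p] by blast
    have "\<gamma> p u v = B u \<bullet> B v" if "p \<bullet> u = 0" "p \<bullet> v = 0" for u v
      using that by (simp add: \<gamma>_def B(2) inner_add_right inner_diff_right linear_add[OF B(1)] linear_diff[OF B(1)])
        (simp add: inner_add_left inner_add_right inner_diff_left inner_diff_right inner_commute)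
    then show ?thesis using B(1) by blast
  qed
  have diag: "\<gamma> p v v = (F (p, v))\<^sup>2" if "p \<in> S2" "p \<bullet> v = 0" for p v
    using F_homogeneous[OF that, of 2] F_zero[OF that(1)] by (simp add: \<gamma>_def scaleR_2 power_mult_distrib)
  have quad: "(F (q, u + v))\<^sup>2 + (F (q, u - v))\<^sup>2 = 2 * (F (q, u))\<^sup>2 + 2 * (F (q, v))\<^sup>2"
    if q: "q \<in> S2" and uv: "q \<bullet> u = 0" "q \<bullet> v = 0" for q u v
  proof -
    obtain B :: "real^3 \<Rightarrow> complex" where B: "linear B" "\<And>y. q \<bullet> y = 0 \<Longrightarrow> (F (q, y))\<^sup>2 = B y \<bullet> B y"
      using B[OF q] by blast
    show ?thesis
      using uv by (simp add: B(2) inner_add_right inner_diff_right linear_add[OF B(1)] linear_diff[OF B(1)])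
        (simp add: inner_add_left inner_add_right inner_diff_left inner_diff_right inner_commute)
  qed
  have "riemannian_metric S2 \<gamma>"
    unfolding riemannian_metric_def
  proof (intro conjI ballI)
    fix p u v assume p: "p \<in> S2" and "u \<in> tangent_space S2 p" "v \<in> tangent_space S2 p"
    then have u: "p \<bullet> u = 0" and v: "p \<bullet> v = 0" using tangent_space_S2[OF p] by auto
    obtain B :: "real^3 \<Rightarrow> complex" where B: "linear B" "\<And>u v. p \<bullet> u = 0 \<Longrightarrow> p \<bullet> v = 0 \<Longrightarrow> \<gamma> p u v = B u \<bullet> B v"
      using g[OF p] by blast
    show "\<gamma> p u v = \<gamma> p v u" using B(2) u v by (simp add: inner_commute)
    show "u \<noteq> 0 \<longrightarrow> \<gamma> p u u > 0" using diag[OF p u] F_nonzero[OF p u] by simp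
    show "\<forall>r. \<gamma> p (r *\<^sub>R u) v = r * \<gamma> p u v" using B u v by (simp add: linear_cmul)
    show "\<gamma> p (u + w) v = \<gamma> p u v + \<gamma> p w v" if "w \<in> tangent_space S2 p" for w
      using that tangent_space_S2[OF p] B u v by (simp add: linear_add inner_add_left inner_add_right)
  next
    fix X Y assume XY: "X \<in> vector_fields S2" "Y \<in> vector_fields S2"
    then have "(\<lambda>q. X q + Y q) \<in> vector_fields S2" "(\<lambda>q. X q - Y q) \<in> vector_fields S2"
      by (auto simp: vector_fields_S2 smooth_on_add smooth_on_diff inner_add_right inner_diff_right)
    from smooth_F_field[OF quad this(1)] smooth_F_field[OF quad this(2)]
    have "smooth_on S2 (\<lambda>q. (1/4) * ((F (q, X q + Y q))\<^sup>2 - (F (q, X q - Y q))\<^sup>2))"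
      by (intro smooth_intros)
    then show "smooth_on S2 (\<lambda>q. \<gamma> q (X q) (Y q))" by (simp add: \<gamma>_def)
  qed
  moreover have "\<forall>(p, v)\<in>tangent_bundle S2. (F (p, v))\<^sup>2 = \<gamma> p v v"
    using diag by (auto simp: tangent_bundle_S2)
  ultimately show ?thesis unfolding riemannian_def by blast
qed

lemma riemannian_if_locally_conformally_berwald:
  assumes "locally_conformally_berwald S2 F"
  shows "riemannian S2 F"
proof (rule riemannian_if_vanishing)
  fix p :: "real^3" and a b :: nat assume p: "p \<in> S2" and "b < a"
  then obtain q where "q \<in> S2" "vanishing a b q" using vanishing_somewhere by blast
  then show "vanishing a b p" using vanishing_constant[OF assms _ p] by blast
qed

end

lemma locally_conformally_flat_imp_berwald:
  "locally_conformally_flat M F \<Longrightarrow> locally_conformally_berwald M F"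
  unfolding locally_conformally_flat_def locally_conformally_berwald_def locally_minkowski_def berwald_def
  by meson

theorem corollary5:
  shows "(\<nexists>F. finsler_metric (sphere (0 :: real^3) 1) F
             \<and> \<not> riemannian (sphere (0 :: real^3) 1) F
             \<and> locally_conformally_berwald (sphere (0 :: real^3) 1) F)
       \<and> (\<nexists>F. finsler_metric (sphere (0 :: real^3) 1) F
             \<and> \<not> riemannian (sphere (0 :: real^3) 1) F
             \<and> locally_conformally_flat (sphere (0 :: real^3) 1) F)"
  using finsler_sphere.riemannian_if_locally_conformally_berwald[OF finsler_sphere.intro]
    locally_conformally_flat_imp_berwald by blast

end
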